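(* Let $c$ be a Coxeter element of a finite Coxeter group $W$. For every $c$-sortable element $w$, the following are equivalent: (1) the descents of $w$ pairwise commute; (2) the interval $[\mathrm{pop}^{\downarrow}_{\mathrm{Weak}(W)}(w),w]$ of $\mathrm{Weak}(W)$ is a distributive lattice; (3) this interval is a Boolean lattice; (4) the interval $[\mathrm{pop}^{\downarrow}_{\mathrm{Camb}_c}(w),w]$ of $\mathrm{Camb}_c$ is a distributive lattice; (5) this interval is a Boolean lattice; (6) the interval $[\mathrm{pop}^{\downarrow}_{\mathrm{Camb}_c}(w),w]$ of $\mathrm{Camb}_c$ equals the interval $[\mathrm{pop}^{\downarrow}_{\mathrm{Weak}(W)}(w),w]$ of $\mathrm{Weak}(W)$.
   Context: $(W,S)$ is a finite Coxeter system with length function $\ell$. The (right) weak order $\mathrm{Weak}(W)$: $u\le v$ iff some reduced word for $v$ has a reduced word for $u$ as a prefix; it is a lattice. A descent of $w$ is $s\in S$ with $\ell(ws)<\ell(w)$. A Coxeter element is a product of all simple reflections, each once, in some order. Fix a reduced word $\mathsf{c}$ for $c$ and let $\mathsf{c}^\infty=\mathsf{c}\mathsf{c}\mathsf{c}\cdots$. The $\mathsf{c}$-sorting word of $w$ is the reduced word for $w$ that is lexicographically first (in terms of positions) among subwords of $\mathsf{c}^\infty$; let $I^{(k)}(w)$ be the set of simple reflections it uses from the $k$-th copy of $\mathsf{c}$. $w$ is $c$-sortable if $I^{(1)}(w)\supseteq I^{(2)}(w)\supseteq\cdots$ (this does not depend on the choice of $\mathsf{c}$). The $c$-Cambrian lattice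 $\mathrm{Camb}_c$ is the set of $c$-sortable elements with the induced weak order; it is a sublattice of $\mathrm{Weak}(W)$. For a finite lattice $L$, $\mathrm{pop}^{\downarrow}_L(x)=x\wedge\bigwedge\{y:y\lessdot x\}$ (covers and meets taken in $L$). *)

theory Defs
  imports "HOL-Algebra.Multiplicative_Group"
begin

definition word_eval :: "('a, 'b) monoid_scheme \<Rightarrow> 'a list \<Rightarrow> 'a" where
  "word_eval G ws = foldr (\<lambda>s acc. s \<otimes>\<^bsub>G\<^esub> acc) ws \<one>\<^bsub>G\<^esub>"

inductive cox_congr :: "('a, 'b) monoid_scheme \<Rightarrow> 'a set \<Rightarrow> 'a list \<Rightarrow> 'a list \<Rightarrow> bool"
  for G S where
  refl: "cox_congr G S u u"
| sym: "cox_congr G S u v \<Longrightarrow> cox_congr G S v u"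
| trans: "cox_congr G S u v \<Longrightarrow> cox_congr G S v w \<Longrightarrow> cox_congr G S u w"
| del_sq: "s \<in> S \<Longrightarrow> cox_congr G S (u @ [s, s] @ v) (u @ v)"
| braid: "s \<in> S \<Longrightarrow> t \<in> S \<Longrightarrow>
     cox_congr G S (u @ concat (replicate (group.ord G (s \<otimes>\<^bsub>G\<^esub> t)) [s, t]) @ v) (u @ v)"

text \<open>(G,S) is a finite Coxeter system: G is a finite group generated by the set S of
  involutions, and G has the Coxeter presentation on S, i.e. two words over S represent
  the same element iff they are related by the Coxeter relations.\<close>
definition coxeter_system :: "('a, 'b) monoid_scheme \<Rightarrow> 'a set \<Rightarrow> bool" where
  "coxeter_system G S \<longleftrightarrow>
     group G \<and> finite (carrier G) \<and> S \<subseteq> carrier G \<and>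
     (\<forall>s\<in>S. s \<noteq> \<one>\<^bsub>G\<^esub> \<and> s \<otimes>\<^bsub>G\<^esub> s = \<one>\<^bsub>G\<^esub>) \<and>
     (\<forall>w\<in>carrier G. \<exists>ws\<in>lists S. word_eval G ws = w) \<and>
     (\<forall>u\<in>lists S. \<forall>v\<in>lists S. word_eval G u = word_eval G v \<longrightarrow> cox_congr G S u v)"

definition cox_len :: "('a, 'b) monoid_scheme \<Rightarrow> 'a set \<Rightarrow> 'a \<Rightarrow> nat" where
  "cox_len G S w = (LEAST n. \<exists>ws\<in>lists S. length ws = n \<and> word_eval G ws = w)"

definition reduced_word :: "('a, 'b) monoid_scheme \<Rightarrow> 'a set \<Rightarrow> 'a list \<Rightarrow> 'a \<Rightarrow> bool" where
  "reduced_word G S ws w \<longleftrightarrow> ws \<in> lists S \<and> word_eval G ws = w \<and> length ws = cox_len G S w"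

definition weak_le :: "('a, 'b) monoid_scheme \<Rightarrow> 'a set \<Rightarrow> 'a \<Rightarrow> 'a \<Rightarrow> bool" where
  "weak_le G S u v \<longleftrightarrow> (\<exists>a b. reduced_word G S a u \<and> reduced_word G S (a @ b) v)"

definition descents :: "('a, 'b) monoid_scheme \<Rightarrow> 'a set \<Rightarrow> 'a \<Rightarrow> 'a set" where
  "descents G S w = {s \<in> S. cox_len G S (w \<otimes>\<^bsub>G\<^esub> s) < cox_len G S w}"

definition cinf :: "'a list \<Rightarrow> nat \<Rightarrow> 'a" where
  "cinf cw i = cw ! (i mod length cw)"

definition lex_le :: "nat list \<Rightarrow> nat list \<Rightarrow> bool" where
  "lex_le ps qs \<longleftrightarrow> ps = qs \<or> (ps, qs) \<in> lexord {(a, b). a < b}"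

text \<open>ps is the list of positions in c^\<infinity> of the c-sorting word of w: among all subwords of
  c^\<infinity> (increasing position lists) which are reduced words for w, it is lexicographically
  first in terms of positions.\<close>
definition sorting_positions :: "('a, 'b) monoid_scheme \<Rightarrow> 'a set \<Rightarrow> 'a list \<Rightarrow> 'a \<Rightarrow> nat list \<Rightarrow> bool" where
  "sorting_positions G S cw w ps \<longleftrightarrow>
     sorted_wrt (<) ps \<and> reduced_word G S (map (cinf cw) ps) w \<and>
     (\<forall>qs. sorted_wrt (<) qs \<and> reduced_word G S (map (cinf cw) qs) w \<longrightarrow> lex_le ps qs)"

text \<open>Letters used from the k-th copy of cw (k = 0 is the first copy, i.e. I^(k+1)).\<close>
definition sort_block :: "'a list \<Rightarrow> nat list \<Rightarrow> nat \<Rightarrow> 'a set" where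
  "sort_block cw ps k = {cinf cw i | i. i \<in> set ps \<and> i div length cw = k}"

definition c_sortable :: "('a, 'b) monoid_scheme \<Rightarrow> 'a set \<Rightarrow> 'a list \<Rightarrow> 'a \<Rightarrow> bool" where
  "c_sortable G S cw w \<longleftrightarrow> w \<in> carrier G \<and>
     (\<exists>ps. sorting_positions G S cw w ps \<and> (\<forall>k. sort_block cw ps (Suc k) \<subseteq> sort_block cw ps k))"

definition camb :: "('a, 'b) monoid_scheme \<Rightarrow> 'a set \<Rightarrow> 'a list \<Rightarrow> 'a set" where
  "camb G S cw = {w \<in> carrier G. c_sortable G S cw w}"

definition covby :: "'c set \<Rightarrow> ('c \<Rightarrow> 'c \<Rightarrow> bool) \<Rightarrow> 'c \<Rightarrow> 'c \<Rightarrow> bool" where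
  "covby X r y x \<longleftrightarrow> y \<in> X \<and> x \<in> X \<and> r y x \<and> y \<noteq> x \<and>
     \<not> (\<exists>z\<in>X. r y z \<and> r z x \<and> z \<noteq> y \<and> z \<noteq> x)"

definition is_glb :: "'c set \<Rightarrow> ('c \<Rightarrow> 'c \<Rightarrow> bool) \<Rightarrow> 'c set \<Rightarrow> 'c \<Rightarrow> bool" where
  "is_glb X r A z \<longleftrightarrow> z \<in> X \<and> (\<forall>a\<in>A. r z a) \<and> (\<forall>z'\<in>X. (\<forall>a\<in>A. r z' a) \<longrightarrow> r z' z)"

definition is_lub :: "'c set \<Rightarrow> ('c \<Rightarrow> 'c \<Rightarrow> bool) \<Rightarrow> 'c set \<Rightarrow> 'c \<Rightarrow> bool" where
  "is_lub X r A z \<longleftrightarrow> z \<in> X \<and> (\<forall>a\<in>A. r a z) \<and> (\<forall>z'\<in>X. (\<forall>a\<in>A. r a z') \<longrightarrow> r z z')"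

definition meet_set :: "'c set \<Rightarrow> ('c \<Rightarrow> 'c \<Rightarrow> bool) \<Rightarrow> 'c set \<Rightarrow> 'c" where
  "meet_set X r A = (THE z. is_glb X r A z)"

definition meet2 :: "'c set \<Rightarrow> ('c \<Rightarrow> 'c \<Rightarrow> bool) \<Rightarrow> 'c \<Rightarrow> 'c \<Rightarrow> 'c" where
  "meet2 X r x y = (THE z. is_glb X r {x, y} z)"

definition join2 :: "'c set \<Rightarrow> ('c \<Rightarrow> 'c \<Rightarrow> bool) \<Rightarrow> 'c \<Rightarrow> 'c \<Rightarrow> 'c" where
  "join2 X r x y = (THE z. is_lub X r {x, y} z)"

definition pop_down :: "'c set \<Rightarrow> ('c \<Rightarrow> 'c \<Rightarrow> bool) \<Rightarrow> 'c \<Rightarrow> 'c" where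
  "pop_down X r x = meet_set X r (insert x {y. covby X r y x})"

definition interval :: "'c set \<Rightarrow> ('c \<Rightarrow> 'c \<Rightarrow> bool) \<Rightarrow> 'c \<Rightarrow> 'c \<Rightarrow> 'c set" where
  "interval X r a b = {x \<in> X. r a x \<and> r x b}"

definition is_lattice_on :: "'c set \<Rightarrow> ('c \<Rightarrow> 'c \<Rightarrow> bool) \<Rightarrow> bool" where
  "is_lattice_on X r \<longleftrightarrow>
     (\<forall>x\<in>X. r x x) \<and> (\<forall>x\<in>X. \<forall>y\<in>X. r x y \<and> r y x \<longrightarrow> x = y) \<and>
     (\<forall>x\<in>X. \<forall>y\<in>X. \<forall>z\<in>X. r x y \<and> r y z \<longrightarrow> r x z) \<and>
     (\<forall>x\<in>X. \<forall>y\<in>X. (\<exists>z. is_glb X r {x, y} z) \<and> (\<exists>z. is_lub X r {x, y} z))"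

definition distrib_lattice_on :: "'c set \<Rightarrow> ('c \<Rightarrow> 'c \<Rightarrow> bool) \<Rightarrow> bool" where
  "distrib_lattice_on X r \<longleftrightarrow> is_lattice_on X r \<and>
     (\<forall>x\<in>X. \<forall>y\<in>X. \<forall>z\<in>X.
        meet2 X r x (join2 X r y z) = join2 X r (meet2 X r x y) (meet2 X r x z))"

definition boolean_lattice_on :: "'c set \<Rightarrow> ('c \<Rightarrow> 'c \<Rightarrow> bool) \<Rightarrow> bool" where
  "boolean_lattice_on X r \<longleftrightarrow> distrib_lattice_on X r \<and>
     (\<exists>bot\<in>X. \<exists>top\<in>X. (\<forall>x\<in>X. r bot x \<and> r x top) \<and>
        (\<forall>x\<in>X. \<exists>y\<in>X. meet2 X r x y = bot \<and> join2 X r x y = top))"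

definition weak_pop_interval :: "('a, 'b) monoid_scheme \<Rightarrow> 'a set \<Rightarrow> 'a \<Rightarrow> 'a set" where
  "weak_pop_interval G S w =
     interval (carrier G) (weak_le G S) (pop_down (carrier G) (weak_le G S) w) w"

definition camb_pop_interval :: "('a, 'b) monoid_scheme \<Rightarrow> 'a set \<Rightarrow> 'a list \<Rightarrow> 'a \<Rightarrow> 'a set" where
  "camb_pop_interval G S cw w =
     interval (camb G S cw) (weak_le G S) (pop_down (camb G S cw) (weak_le G S) w) w"

end

(*
  Realise W on the span of the simple roots.  An element is determined by its set of inversions, a
  set of positive roots, and the weak order is inclusion of these sets.  If the descents of w
  commute, the interval below w is the power set of the set of roots of its cover reflections.

  Reading the word c cyclically and using a letter whenever it is a left descent of what remains
  of x (dropping it for good otherwise) produces the largest c-sortable element below x.  The roots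
  attached to the skipped letters bound the simplicial cone of all chambers with this projection,
  and they are triangular for the Euler form of c.  This yields that the projection is order
  preserving and that, when an initial letter a of c is a cover reflection of the sortable element
  w, every other cover reflection of w lies in the parabolic subgroup that omits a.  An
  induction on length and rank, removing or rotating the initial letter, then reduces every claim
  to this situation.

  For commuting descents the claim is that removing cover reflections preserves sortability.  For
  non-commuting descents s and t, two elements of one chain of the polygon below w have different
  projections but the same meet and the same join with the projection of the coatom on the other
  chain: this pentagon excludes distributivity.  Equality of the intervals would make both ws and wt
  sortable, which forces s and t to commute.
*)
theory Submission
  imports Defs Complex_Main
begin

text \<open>Sortability is defined by positions in an infinite word, which does not induct well.
  Deleting every passed-over letter turns it into a recursion with two moves, and each move acts on
  roots by the identity or by one simple reflection. The Euler form is built to be invariant under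
  the second move, so an orthogonality or a sign has to be checked only at the moment when a letter
  is deleted, and there it is a statement about one coordinate. The obstacle is a letter that is a
  left descent of one element but not of its neighbour: the two readings then continue with
  different words. Comparing them requires that \<open>sroot a\<close> is a wall of a cone and, for
  cover reflections, that reading the shorter word loses no inversion supported on it. The latter
  can fail for a general element; alignment, a condition on rank-two subsystems, guarantees it for
  sortable ones. In the negative directions meets and joins are supplied by the assumed distributive
  lattice, and the contradiction is phrased through common bounds alone.\<close>

locale coxeter = group G for G :: "('a, 'b) monoid_scheme" (structure) +
  fixes S :: "'a set"
  assumes coxeter_system: "coxeter_system G S"
begin

subsection \<open>The geometric representation\<close>

abbreviation ev :: "'a list \<Rightarrow> 'a" where "ev \<equiv> word_eval G"
abbreviation len :: "'a \<Rightarrow> nat" where "len \<equiv> cox_len G S"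

lemma S_closed: "s \<in> S \<Longrightarrow> s \<in> carrier G"
  and finite_S: "finite S"
  and S_square: "s \<in> S \<Longrightarrow> s \<otimes> s = \<one>"
  and finite_G: "finite (carrier G)"
  and word_ex: "w \<in> carrier G \<Longrightarrow> \<exists>ws\<in>lists S. ev ws = w"
  and word_congr: "u \<in> lists S \<Longrightarrow> v \<in> lists S \<Longrightarrow> ev u = ev v \<Longrightarrow> cox_congr G S u v"
  using coxeter_system unfolding coxeter_system_def by (auto intro: finite_subset)

lemma S_inv: "s \<in> S \<Longrightarrow> inv s = s"
  using S_square S_closed inv_equality by blast

lemma ev_Nil [simp]: "ev [] = \<one>"
  and ev_Cons [simp]: "ev (s # ws) = s \<otimes> ev ws"
  by (simp_all add: word_eval_def)

lemma ev_closed [simp]: "ws \<in> lists S \<Longrightarrow> ev ws \<in> carrier G"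
  by (induction ws) (auto simp: S_closed)

lemma ev_append: "us \<in> lists S \<Longrightarrow> vs \<in> lists S \<Longrightarrow> ev (us @ vs) = ev us \<otimes> ev vs"
  by (induction us) (auto simp: S_closed m_assoc)

lemma rev_lists: "ws \<in> lists S \<Longrightarrow> rev ws \<in> lists S"
  by (simp add: in_lists_conv_set)

lemma ev_rev: "ws \<in> lists S \<Longrightarrow> ev (rev ws) = inv (ev ws)"
proof (induction ws)
  case (Cons a ws)
  then have "a \<in> S" "ws \<in> lists S" by auto
  then show ?case using Cons by (simp add: ev_append rev_lists inv_mult_group S_inv S_closed)
qed simp

lemma cancel_SS [simp]: "s \<in> S \<Longrightarrow> w \<in> carrier G \<Longrightarrow> s \<otimes> (s \<otimes> w) = w"
  "s \<in> S \<Longrightarrow> w \<in> carrier G \<Longrightarrow> w \<otimes> s \<otimes> s = w"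
  by (simp_all add: S_closed S_square flip: m_assoc) (simp add: S_closed S_square m_assoc)

text \<open>Every defining relation changes the length by an even number. This is the sign
  character, and it excludes \<open>len (w \<otimes> s) = len w\<close>.\<close>

lemma cox_congr_parity: "cox_congr G S u v \<Longrightarrow> even (length u) = even (length v)"
  by (induction rule: cox_congr.induct) (auto simp: length_concat sum_list_replicate)

lemma reduced_ex: assumes "w \<in> carrier G" shows "\<exists>ws. reduced_word G S ws w"
proof -
  obtain ws where "ws \<in> lists S" "ev ws = w" using word_ex[OF assms] by blast
  then have "\<exists>n. \<exists>ws\<in>lists S. length ws = n \<and> ev ws = w" by blast
  from LeastI_ex[OF this] show ?thesis unfolding reduced_word_def cox_len_def by metis
qed

lemma len_le: "ws \<in> lists S \<Longrightarrow> len (ev ws) \<le> length ws"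
  unfolding cox_len_def by (rule Least_le) blast

lemma len_one [simp]: "len \<one> = 0"
  using len_le[of "[]"] by simp

lemma len_0: "w \<in> carrier G \<Longrightarrow> len w = 0 \<Longrightarrow> w = \<one>"
  using reduced_ex[of w] by (auto simp: reduced_word_def)

lemma len_parity: assumes "ws \<in> lists S" shows "even (len (ev ws)) = even (length ws)"
proof -
  obtain us where "us \<in> lists S" "ev us = ev ws" "length us = len (ev ws)"
    using reduced_ex[of "ev ws"] assms unfolding reduced_word_def by auto
  then show ?thesis using cox_congr_parity[OF word_congr[of us ws]] assms by simp
qed

lemma len_mult_ev: assumes "w \<in> carrier G" "ws \<in> lists S"
  shows "len (w \<otimes> ev ws) \<le> len w + length ws"
proof -
  obtain us where "reduced_word G S us w" using reduced_ex assms by blast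
  then show ?thesis using len_le[of "us @ ws"] assms
    by (auto simp: reduced_word_def ev_append)
qed

lemma len_inv: assumes "w \<in> carrier G" shows "len (inv w) = len w"
proof -
  have le: "len (inv v) \<le> len v" if "v \<in> carrier G" for v
  proof -
    note vc = that
    obtain us where us: "us \<in> lists S" "ev us = v" "length us = len v"
      using reduced_ex[OF vc] unfolding reduced_word_def by blast
    then show ?thesis using len_le[OF rev_lists[OF us(1)]] ev_rev[OF us(1)] by simp
  qed
  show ?thesis using le[OF assms] le[OF inv_closed[OF assms]] assms by simp
qed

lemma len_right: assumes "w \<in> carrier G" "s \<in> S"
  shows "len (w \<otimes> s) = len w + 1 \<or> len w = len (w \<otimes> s) + 1"
proof -
  have 1: "len (w \<otimes> s) \<le> len w + 1" using len_mult_ev[of w "[s]"] assms by (simp add: S_closed)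
  have 2: "len w \<le> len (w \<otimes> s) + 1"
    using len_mult_ev[of "w \<otimes> s" "[s]"] assms by (simp add: S_closed)
  obtain us where us: "us \<in> lists S" "ev us = w" using word_ex assms by blast
  have "even (len (ev (us @ [s]))) \<noteq> even (len (ev us))"
    using len_parity[of us] len_parity[of "us @ [s]"] us assms by auto
  then have "len (w \<otimes> s) \<noteq> len w" using us assms by (auto simp: ev_append S_closed)
  with 1 2 show ?thesis by linarith
qed

section \<open>The Tits form and the simple reflections\<close>

definition bil :: "'a \<Rightarrow> 'a \<Rightarrow> real" where "bil s t = - cos (pi / real (ord (s \<otimes> t)))"
text \<open>Vectors are total functions on the type; only their coordinates in \<open>S\<close>
  enter the form.\<close>

definition form :: "('a \<Rightarrow> real) \<Rightarrow> ('a \<Rightarrow> real) \<Rightarrow> real" where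
  "form x y = (\<Sum>s\<in>S. \<Sum>t\<in>S. x s * y t * bil s t)"
definition sroot :: "'a \<Rightarrow> 'a \<Rightarrow> real" where "sroot s = (\<lambda>x. if x = s then 1 else 0)"
definition reflect :: "'a \<Rightarrow> ('a \<Rightarrow> real) \<Rightarrow> 'a \<Rightarrow> real" where
  "reflect s v = (\<lambda>x. v x - 2 * form (sroot s) v * sroot s x)"

lemma ord_pos: "w \<in> carrier G \<Longrightarrow> ord w > 0"
  using finite_G ord_ge_1 by force

lemma bil_self: "s \<in> S \<Longrightarrow> bil s s = 1"
  by (simp add: bil_def S_square)

lemma mult_ne_one: "s \<in> S \<Longrightarrow> t \<in> S \<Longrightarrow> s \<noteq> t \<Longrightarrow> s \<otimes> t \<noteq> \<one>"
  using inv_equality[of s t] S_inv S_closed by (metis)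

lemma ord_ge2: assumes "s \<in> S" "t \<in> S" "s \<noteq> t" shows "ord (s \<otimes> t) \<ge> 2"
proof -
  have "ord (s \<otimes> t) \<noteq> 1" using mult_ne_one[OF assms] assms S_closed ord_eq_1[of "s \<otimes> t"] by auto
  moreover have "ord (s \<otimes> t) > 0" using ord_pos assms S_closed by auto
  ultimately show ?thesis by linarith
qed

lemma mult_commute_inv: assumes "s \<in> S" "t \<in> S" shows "inv (s \<otimes> t) = t \<otimes> s"
  using assms by (simp add: inv_mult_group S_closed S_inv)

lemma ord_commute: assumes "s \<in> S" "t \<in> S" shows "ord (s \<otimes> t) = ord (t \<otimes> s)"
  using ord_inv[of "s \<otimes> t"] mult_commute_inv[OF assms] assms S_closed by auto

lemma bil_sym: "s \<in> S \<Longrightarrow> t \<in> S \<Longrightarrow> bil s t = bil t s"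
  unfolding bil_def using ord_commute by metis

lemma bil_nonpos: assumes "s \<in> S" "t \<in> S" "s \<noteq> t" shows "bil s t \<le> 0"
proof -
  have "real (ord (s \<otimes> t)) \<ge> 2" using ord_ge2[OF assms] by linarith
  then have "pi / real (ord (s \<otimes> t)) \<le> pi / 2" by (intro divide_left_mono) auto
  moreover have "pi / real (ord (s \<otimes> t)) \<ge> 0" by simp
  ultimately have "cos (pi / real (ord (s \<otimes> t))) \<ge> 0" by (intro cos_ge_zero) linarith+
  then show ?thesis unfolding bil_def by simp
qed

text \<open>The bridge from group to geometry: commuting descents become orthogonal cover roots,
  since both conditions say that the product has order 2.\<close>

lemma bil_zero_iff: assumes "s \<in> S" "t \<in> S" "s \<noteq> t" shows "bil s t = 0 \<longleftrightarrow> s \<otimes> t = t \<otimes> s"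
proof -
  let ?m = "ord (s \<otimes> t)"
  have m2: "?m \<ge> 2" using ord_ge2[OF assms] .
  have c: "s \<in> carrier G" "t \<in> carrier G" using assms S_closed by auto
  have "s \<otimes> t = t \<otimes> s \<longleftrightarrow> (s \<otimes> t) [^] (2::nat) = \<one>"
  proof -
    have "(s \<otimes> t) [^] (2::nat) = (s \<otimes> t) \<otimes> (s \<otimes> t)" using c by (simp add: numeral_2_eq_2)
    moreover have "(s \<otimes> t) \<otimes> (s \<otimes> t) = \<one> \<longleftrightarrow> inv (s \<otimes> t) = s \<otimes> t"
      using c by (metis inv_equality l_inv m_closed)
    ultimately show ?thesis using mult_commute_inv assms by auto
  qed
  also have "\<dots> \<longleftrightarrow> ?m dvd 2" using c pow_eq_id[of "s \<otimes> t" 2] by auto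
  also have "\<dots> \<longleftrightarrow> ?m = 2" using m2 by (auto dest: dvd_imp_le)
  also have "\<dots> \<longleftrightarrow> bil s t = 0"
  proof
    assume "?m = 2" then show "bil s t = 0" by (simp add: bil_def)
  next
    assume z: "bil s t = 0"
    show "?m = 2"
    proof (rule ccontr)
      assume "?m \<noteq> 2"
      then have "real ?m > 2" using m2 by simp
      then have "pi / real ?m < pi / 2" by (intro divide_strict_left_mono) auto
      moreover have "pi / real ?m > 0" using m2 by simp
      ultimately have "cos (pi / real ?m) > 0" by (intro cos_gt_zero) auto
      then show False using z by (simp add: bil_def)
    qed
  qed
  finally show ?thesis by simp
qed

lemma form_lin_l: "form (\<lambda>x. p * u x + q * v x) y = p * form u y + q * form v y"
  unfolding form_def by (simp add: sum_distrib_left sum.distrib algebra_simps)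

lemma form_lin_r: "form y (\<lambda>x. p * u x + q * v x) = p * form y u + q * form y v"
  unfolding form_def by (simp add: sum_distrib_left sum.distrib algebra_simps)

lemma form_sym: "form x y = form y x"
  unfolding form_def by (subst sum.swap) (simp add: bil_sym mult.commute mult.left_commute cong: sum.cong)

lemma form_sroot_l: "s \<in> S \<Longrightarrow> form (sroot s) y = (\<Sum>t\<in>S. y t * bil s t)"
proof -
  assume s: "s \<in> S"
  have "form (sroot s) y = (\<Sum>s'\<in>S. if s' = s then (\<Sum>t\<in>S. y t * bil s t) else 0)"
    unfolding form_def sroot_def by (rule sum.cong) (auto simp: sum_distrib_left)
  then show ?thesis using s finite_S by simp
qed

lemma form_sroot_sroot: assumes "s \<in> S" "t \<in> S" shows "form (sroot s) (sroot t) = bil s t"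
proof -
  have "form (sroot s) (sroot t) = (\<Sum>u\<in>S. if u = t then bil s t else 0)"
    using assms unfolding form_sroot_l[OF assms(1)] by (intro sum.cong) (auto simp: sroot_def)
  then show ?thesis using assms finite_S by simp
qed

lemma form_self: "s \<in> S \<Longrightarrow> form (sroot s) (sroot s) = 1"
  by (simp add: form_sroot_sroot bil_self)

lemma reflect_alt: "reflect s v = (\<lambda>x. 1 * v x + (- 2 * form (sroot s) v) * sroot s x)"
  by (auto simp: reflect_def)

lemma form_reflect_sroot: "s \<in> S \<Longrightarrow> form (sroot s) (reflect s v) = - form (sroot s) v"
  unfolding reflect_alt form_lin_r by (simp add: form_self)

lemma reflect_reflect: "s \<in> S \<Longrightarrow> reflect s (reflect s v) = v"
  using form_reflect_sroot[of s v] by (auto simp: reflect_def)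

lemma reflect_form: "s \<in> S \<Longrightarrow> form (reflect s u) (reflect s v) = form u v"
proof -
  assume s: "s \<in> S"
  have "form (reflect s u) (reflect s v) = form u (reflect s v) - 2 * form (sroot s) u * form (sroot s) (reflect s v)"
    unfolding reflect_alt[of s u] form_lin_l by simp
  also have "form u (reflect s v) = form u v - 2 * form (sroot s) v * form u (sroot s)"
    unfolding reflect_alt[of s v] form_lin_r by simp
  finally show ?thesis using form_reflect_sroot[OF s, of v] form_sym[of u "sroot s"] by simp
qed

lemma reflect_lin: "reflect s (\<lambda>x. p * u x + q * v x) = (\<lambda>x. p * reflect s u x + q * reflect s v x)"
  unfolding reflect_def form_lin_r by (auto simp: algebra_simps)

lemma fold_reflect_lin: "foldr reflect ws (\<lambda>x. p * u x + q * v x) = (\<lambda>x. p * foldr reflect ws u x + q * foldr reflect ws v x)"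
  by (induction ws) (simp_all add: reflect_lin)

lemma fold_reflect_form: "ws \<in> lists S \<Longrightarrow> form (foldr reflect ws u) (foldr reflect ws v) = form u v"
  by (induction ws) (auto simp: reflect_form)

text \<open>Built from the right: the last letter is always \<open>t\<close>.\<close>
fun alt :: "'a \<Rightarrow> 'a \<Rightarrow> nat \<Rightarrow> 'a list" where
  "alt t s 0 = []"
| "alt t s (Suc k) = (if even k then t else s) # alt t s k"

lemma alt_lists: "s \<in> S \<Longrightarrow> t \<in> S \<Longrightarrow> alt t s k \<in> lists S"
  by (induction k) auto

lemma length_alt [simp]: "length (alt t s k) = k"
  by (induction k) auto

lemma alt_double: "alt t s (2 * k) = concat (replicate k [s, t])"
  by (induction k) auto

lemma alt_drop: "j \<le> k \<Longrightarrow> \<exists>us. alt t s k = us @ alt t s j \<and> set us \<subseteq> {s, t}"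
proof (induction k)
  case (Suc k)
  show ?case
  proof (cases "j = Suc k")
    case False
    then obtain us where "alt t s k = us @ alt t s j" "set us \<subseteq> {s, t}" using Suc by auto
    then show ?thesis by (intro exI[of _ "(if even k then t else s) # us"]) auto
  qed auto
qed auto

section \<open>Dihedral subgroups and the braid relation\<close>

definition angle :: "'a \<Rightarrow> 'a \<Rightarrow> real" where "angle s t = pi / real (ord (s \<otimes> t))"

lemma angle_sym: "s \<in> S \<Longrightarrow> t \<in> S \<Longrightarrow> angle s t = angle t s"
  unfolding angle_def using ord_commute by metis

lemma sin_angle_pos: assumes "s \<in> S" "t \<in> S" "s \<noteq> t" shows "sin (angle s t) > 0"
proof (rule sin_gt_zero)
  have "real (ord (s \<otimes> t)) \<ge> 2" using ord_ge2[OF assms] by linarith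
  then show "0 < angle s t" "angle s t < pi" unfolding angle_def by (auto simp: field_simps)
qed

lemma reflect_comb: assumes "s \<in> S" "t \<in> S"
  shows "reflect t (\<lambda>x. p * sroot s x + q * sroot t x) =
    (\<lambda>x. p * sroot s x + (2 * cos (angle s t) * p - q) * sroot t x)"
proof -
  have "form (sroot t) (\<lambda>x. p * sroot s x + q * sroot t x) = - cos (angle s t) * p + q"
    unfolding form_lin_r using assms by (simp add: form_sroot_sroot bil_self bil_def[of t s] angle_def ord_commute)
  then show ?thesis unfolding reflect_def by (simp only:) (auto simp: algebra_simps)
qed

lemma sin_step: "2 * cos x * sin ((real k + 1) * x) - sin (real k * x) = sin ((real k + 2) * (x::real))"
proof -
  have "sin ((real k + 2) * x) = sin ((real k + 1) * x + x)" by (simp add: algebra_simps)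
  moreover have "sin (real k * x) = sin ((real k + 1) * x - x)" by (simp add: algebra_simps)
  ultimately show ?thesis by (simp add: sin_add sin_diff)
qed

text \<open>Inside the plane of the two simple roots the coefficients are Chebyshev values of the
  second kind at \<open>cos (angle s t)\<close>, and \<open>sin_step\<close> is their recurrence.
  The parity of \<open>k\<close> tells which root was reflected in last.\<close>

lemma fold_alt: assumes "s \<in> S" "t \<in> S" "s \<noteq> t"
  shows "foldr reflect (alt t s k) (sroot s) =
   (if even k then (\<lambda>x. sin ((real k + 1) * angle s t) / sin (angle s t) * sroot s x
                          + sin (real k * angle s t) / sin (angle s t) * sroot t x)
    else (\<lambda>x. sin (real k * angle s t) / sin (angle s t) * sroot s x
                          + sin ((real k + 1) * angle s t) / sin (angle s t) * sroot t x))"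
proof (induction k)
  case 0
  then show ?case using sin_angle_pos[OF assms] by simp
next
  case (Suc k)
  define A where "A = sin (real k * angle s t) / sin (angle s t)"
  define B where "B = sin ((real k + 1) * angle s t) / sin (angle s t)"
  define C where "C = sin ((real k + 2) * angle s t) / sin (angle s t)"
  have e: "2 * cos (angle s t) * B - A = C"
    unfolding A_def B_def C_def by (subst sin_step[symmetric]) (simp add: diff_divide_distrib)
  have C: "sin ((real (Suc k) + 1) * angle s t) / sin (angle s t) = C"
    "sin (real (Suc k) * angle s t) / sin (angle s t) = B"
    by (simp_all add: C_def B_def add.commute)
  show ?case
  proof (cases "even k")
    case True
    then have "foldr reflect (alt t s k) (sroot s) = (\<lambda>x. B * sroot s x + A * sroot t x)"
      using Suc A_def B_def by simp
    then show ?thesis using True reflect_comb[OF assms(1,2), of B A] e C by simp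
  next
    case False
    then have "foldr reflect (alt t s k) (sroot s) = (\<lambda>x. B * sroot t x + A * sroot s x)"
      using Suc A_def B_def by (simp add: add.commute)
    then show ?thesis using False reflect_comb[OF assms(2,1), of B A] e C angle_sym[OF assms(2,1)]
      by (simp add: add.commute)
  qed
qed

text \<open>The alternating word fixes both simple roots. As it is an isometry, it moves
  \<open>v\<close> by a vector that is orthogonal to both roots, and as a product of the two
  reflections it moves \<open>v\<close> inside their plane. The form is nondegenerate on that plane
  because \<open>sin (angle s t)\<close> is not 0, so the displacement vanishes.\<close>

lemma fold_braid: assumes "s \<in> S" "t \<in> S"
  shows "foldr reflect (concat (replicate (ord (s \<otimes> t)) [s, t])) v = v"
proof (cases "s = t")
  case True
  then show ?thesis using assms reflect_reflect by (simp add: S_square)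
next
  case False
  let ?m = "ord (s \<otimes> t)" and ?a = "angle s t"
  have m: "?m \<ge> 2" using ord_ge2[OF assms False] .
  have ma: "real ?m * ?a = pi" using m by (simp add: angle_def)
  have supp: "sin ?a > 0" using sin_angle_pos[OF assms False] .
  let ?W = "alt t s (2 * ?m)"
  have Wl: "?W \<in> lists S" using alt_lists assms by auto
  have 2: "real (2 * ?m) * ?a = 2 * pi" using ma by simp
  have s1: "foldr reflect ?W (sroot s) = sroot s"
  proof -
    have "sin ((real (2 * ?m) + 1) * ?a) = sin (2 * pi + ?a)" using 2 by (simp add: algebra_simps)
    also have "\<dots> = sin ?a" by (simp add: sin_add)
    finally have "sin ((real (2 * ?m) + 1) * ?a) = sin ?a" .
    moreover have "sin (real (2 * ?m) * ?a) = 0" unfolding 2 by simp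
    ultimately show ?thesis using fold_alt[OF assms False, of "2 * ?m"] supp by (simp del: of_nat_mult)
  qed
  \<comment> \<open>The last letter negates \<open>sroot t\<close>; what remains is an alternating
    word of odd length with \<open>s\<close> and \<open>t\<close> exchanged.\<close>
  have t1: "foldr reflect ?W (sroot t) = sroot t"
  proof -
    obtain n where n: "2 * ?m = Suc n" "odd n" using m by (intro that[of "2 * ?m - 1"]) auto
    have split: "alt t s (Suc k) = alt s t k @ [t]" for k by (induction k) auto
    have rt: "reflect t (sroot t) = (\<lambda>x. - sroot t x)"
      using assms by (auto simp: reflect_def form_self)
    have nonneg: "real n = real (2 * ?m) - 1" using n(1) by linarith
    have "real n * ?a = 2 * pi - ?a" unfolding nonneg using 2 by (simp only: left_diff_distrib)
    then have "sin (real n * ?a) = sin (2 * pi - ?a)" by (rule arg_cong)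
    also have "\<dots> = - sin ?a" by (simp add: sin_diff)
    finally have sn: "sin (real n * ?a) = - sin ?a" .
    have "(real n + 1) * ?a = 2 * pi" unfolding nonneg using 2 by (simp only: diff_add_cancel)
    then have sn2: "sin ((real n + 1) * ?a) = 0" by (simp only: sin_two_pi)
    have "foldr reflect (alt s t n) (sroot t) = (\<lambda>x. - sroot t x)"
      using fold_alt[OF assms(2,1) False[symmetric], of n] n(2) sn sn2 supp
      by (simp del: of_nat_mult add: angle_sym[OF assms(2,1)])
    then show ?thesis unfolding n(1) split
      using fold_reflect_lin[of "alt s t n" "-1" "sroot t" 0 "sroot t"] by (simp add: rt)
  qed
  define u where "u = (\<lambda>x. foldr reflect ?W v x - v x)"
  have diff: "\<exists>A B. \<forall>x. foldr reflect ws v x - v x = A * sroot s x + B * sroot t x" if "set ws \<subseteq> {s, t}" for ws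
    using that
  proof (induction ws)
    case (Cons a ws)
    then obtain A B where AB: "\<forall>x. foldr reflect ws v x - v x = A * sroot s x + B * sroot t x" by auto
    define c where "c = - 2 * form (sroot a) (foldr reflect ws v)"
    have *: "reflect a (foldr reflect ws v) x = foldr reflect ws v x + c * sroot a x" for x
      by (simp add: reflect_def c_def)
    have "a = s \<or> a = t" using Cons by auto
    then show ?case
    proof
      assume "a = s"
      then have "\<forall>x. foldr reflect (a # ws) v x - v x = (A + c) * sroot s x + B * sroot t x"
        using AB * by (auto simp: algebra_simps)
      then show ?thesis by blast
    next
      assume "a = t"
      then have "\<forall>x. foldr reflect (a # ws) v x - v x = A * sroot s x + (B + c) * sroot t x"
        using AB * by (auto simp: algebra_simps)
      then show ?thesis by blast
    qed
  next
    case Nil show ?case by (intro exI[of _ 0]) auto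
  qed
  have "set ?W \<subseteq> {s, t}" using alt_double[of t s] by (auto split: if_splits)
  then obtain A B where AB: "\<forall>x. u x = A * sroot s x + B * sroot t x"
    using diff[of ?W] unfolding u_def by blast
  have inv_u: "form (\<lambda>x. 1 * foldr reflect ?W v x + (-1) * v x) r = 0" if "foldr reflect ?W r = r" for r
    unfolding form_lin_l using fold_reflect_form[OF Wl, of v r] that by simp
  have u': "(\<lambda>x. 1 * foldr reflect ?W v x + (-1) * v x) = (\<lambda>x. A * sroot s x + B * sroot t x)"
    using AB unfolding u_def by auto
  have b: "bil s t = - cos ?a" "bil t s = - cos ?a"
    using assms ord_commute by (auto simp: bil_def angle_def)
  have e1: "A - B * cos ?a = 0" using inv_u[OF s1] assms b unfolding u' form_lin_l
    by (simp add: form_sroot_sroot bil_self)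
  have e2: "B - A * cos ?a = 0" using inv_u[OF t1] assms b unfolding u' form_lin_l
    by (simp add: form_sroot_sroot bil_self)
  have B: "B = A * cos ?a" using e2 by linarith
  have "A - A * cos ?a * cos ?a = 0" using e1 unfolding B .
  moreover have "A * (1 - (cos ?a)\<^sup>2) = A - A * cos ?a * cos ?a"
    by (simp only: right_diff_distrib power2_eq_square mult_1_right mult.assoc)
  ultimately have "A * (1 - (cos ?a)\<^sup>2) = 0" by argo
  then have "A * (sin ?a)\<^sup>2 = 0" using sin_squared_eq[of ?a] by simp
  then have "A = 0" using supp by simp
  then have "B = 0" using e2 by simp
  have "foldr reflect ?W v = v" using AB \<open>A = 0\<close> \<open>B = 0\<close> unfolding u_def by fastforce
  then show ?thesis unfolding alt_double .
qed

lemma cox_congr_fold: "cox_congr G S u v \<Longrightarrow> foldr reflect u x = foldr reflect v x"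
  by (induction arbitrary: x rule: cox_congr.induct) (auto simp: reflect_reflect fold_braid)

section \<open>The action of group elements\<close>

definition act :: "'a \<Rightarrow> ('a \<Rightarrow> real) \<Rightarrow> 'a \<Rightarrow> real" where
  "act w = foldr reflect (SOME ws. ws \<in> lists S \<and> ev ws = w)"

text \<open>Independence of the chosen word: two words for one element are congruent by the
  presentation, and congruent words act alike.\<close>

lemma act_ev: assumes "ws \<in> lists S" shows "act (ev ws) = foldr reflect ws"
proof -
  define us where "us = (SOME us. us \<in> lists S \<and> ev us = ev ws)"
  have "us \<in> lists S \<and> ev us = ev ws" unfolding us_def by (rule someI[of _ ws]) (use assms in auto)
  then have "cox_congr G S us ws" using word_congr assms by auto
  then show ?thesis unfolding act_def us_def[symmetric] using cox_congr_fold by fastforce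
qed

lemma act_one [simp]: "act \<one> v = v"
  using act_ev[of "[]"] by simp

lemma act_S: "s \<in> S \<Longrightarrow> act s = reflect s"
  using act_ev[of "[s]"] by (auto simp: S_closed)

lemma act_mult: assumes "u \<in> carrier G" "w \<in> carrier G" shows "act (u \<otimes> w) v = act u (act w v)"
proof -
  obtain us ws where "us \<in> lists S" "ev us = u" "ws \<in> lists S" "ev ws = w" using word_ex assms by metis
  then show ?thesis using act_ev[of "us @ ws"] act_ev[of us] act_ev[of ws] by (auto simp: ev_append)
qed

lemma act_lin: assumes "w \<in> carrier G"
  shows "act w (\<lambda>x. p * u x + q * v x) = (\<lambda>x. p * act w u x + q * act w v x)"
proof -
  obtain ws where "ws \<in> lists S" "ev ws = w" using word_ex assms by metis
  then show ?thesis using act_ev[of ws] fold_reflect_lin[of ws] by simp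
qed

lemma act_form: assumes "w \<in> carrier G" shows "form (act w u) (act w v) = form u v"
proof -
  obtain ws where "ws \<in> lists S" "ev ws = w" using word_ex assms by metis
  then show ?thesis using act_ev[of ws] fold_reflect_form[of ws] by simp
qed

subsection \<open>Roots, inversions and the weak order\<close>

lemma ev_alt_double: assumes "s \<in> S" "t \<in> S" shows "ev (alt t s (2 * ord (s \<otimes> t))) = \<one>"
proof -
  have "ev (concat (replicate n [s, t])) = (s \<otimes> t) [^] n" for n
  proof (induction n)
    case (Suc n)
    have "(s \<otimes> t) [^] Suc n = (s \<otimes> t) \<otimes> (s \<otimes> t) [^] n"
      using assms S_closed nat_pow_Suc2 by auto
    then show ?case using Suc assms S_closed by (simp add: m_assoc)
  qed simp
  then show ?thesis unfolding alt_double using assms S_closed pow_ord_eq_1 by auto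
qed

definition nonneg :: "('a \<Rightarrow> real) \<Rightarrow> bool" where "nonneg v \<longleftrightarrow> (\<forall>x. 0 \<le> v x)"

lemma act_scale: "w \<in> carrier G \<Longrightarrow> act w (\<lambda>x. c * v x) = (\<lambda>x. c * act w v x)"
  using act_lin[of w c v 0 v] by simp

lemma act_neg: "w \<in> carrier G \<Longrightarrow> act w (\<lambda>x. - v x) = (\<lambda>x. - act w v x)"
  using act_scale[of w "-1" v] by simp

lemma nonneg_comb: "nonneg u \<Longrightarrow> nonneg v \<Longrightarrow> 0 \<le> p \<Longrightarrow> 0 \<le> q \<Longrightarrow> nonneg (\<lambda>x. p * u x + q * v x)"
  by (simp add: nonneg_def)

lemma nonneg_sroot: "nonneg (sroot s)"
  by (simp add: nonneg_def sroot_def)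

text \<open>Humphreys, Section 5.4: split off a maximal alternating right factor in the two
  generators \<open>s\<close> and a descent \<open>t\<close>.\<close>
lemma act_pos: "w \<in> carrier G \<Longrightarrow> s \<in> S \<Longrightarrow> len (w \<otimes> s) > len w \<Longrightarrow> nonneg (act w (sroot s))"
proof (induction "len w" arbitrary: w s rule: less_induct)
  case less
  show ?case
  proof (cases "w = \<one>")
    case True
    then show ?thesis using nonneg_sroot by simp
  next
    case False
    obtain ws where ws: "reduced_word G S ws w" using reduced_ex less by blast
    have "ws \<noteq> []" using ws False by (auto simp: reduced_word_def)
    then obtain vs t where vs: "ws = vs @ [t]" by (metis rev_exhaust)
    have t: "t \<in> S" and vsl: "vs \<in> lists S" using ws vs by (auto simp: reduced_word_def)
    have "ev vs \<otimes> t = w" using ws vs t vsl by (auto simp: reduced_word_def ev_append S_closed)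
    then have wt: "w \<otimes> t = ev vs" using t ev_closed[OF vsl] by auto
    have lwt: "len (w \<otimes> t) < len w" using len_le[OF vsl] ws vs unfolding wt by (simp add: reduced_word_def)
    then have st: "s \<noteq> t" using less.prems by auto
    \<comment> \<open>A length-additive right factor of length \<open>k\<close> ending in
      \<open>t\<close>. The descent \<open>t\<close> gives \<open>P 1\<close>, and the length of
      \<open>w\<close> bounds \<open>k\<close>, so a largest one exists.\<close>
    define P where "P k \<longleftrightarrow> (\<exists>v\<in>carrier G. w = v \<otimes> ev (alt t s k) \<and> len w = len v + k)" for k
    have "P 1"
      unfolding P_def using less.prems t lwt len_right[of w t] S_closed
      by (intro bexI[of _ "w \<otimes> t"]) auto
    moreover have bound: "P k \<Longrightarrow> k \<le> len w" for k unfolding P_def by auto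
    ultimately obtain k where k: "P k" "\<And>j. P j \<Longrightarrow> j \<le> k"
      using GreatestI_nat[of P 1 "len w"] Greatest_le_nat[of P _ "len w"] by blast
    have k1: "k \<ge> 1" using k \<open>P 1\<close> by blast
    have al: "alt t s j \<in> lists S" for j using alt_lists t less.prems by auto
    obtain v where v: "v \<in> carrier G" "w = v \<otimes> ev (alt t s k)" "len w = len v + k"
      using k(1) P_def by auto
    let ?m = "ord (s \<otimes> t)"
    \<comment> \<open>From length \<open>ord (s \<otimes> t)\<close> on, the alternating factor
      could be rewritten so as to end in \<open>s\<close>, and \<open>s\<close> would shorten
      \<open>w\<close>.\<close>
    have km: "k < ?m"
    proof (rule ccontr)
      assume "\<not> k < ?m"
      then obtain us where us: "alt t s k = us @ alt t s ?m" "set us \<subseteq> {s, t}"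
        using alt_drop[of ?m k t s] by auto
      have usl: "us \<in> lists S" using us t less.prems by auto
      have lus: "length us + ?m = k" using us(1) by (metis length_alt length_append)
      define v2 where "v2 = v \<otimes> ev us"
      have v2: "v2 \<in> carrier G" "w = v2 \<otimes> ev (alt t s ?m)" "len v2 \<le> len v + length us"
        using v usl al us len_mult_ev[of v us] unfolding v2_def by (auto simp: ev_append m_assoc)
      have m2: "?m \<ge> 2" using ord_ge2 less.prems t st by auto
      obtain xs where xs: "alt t s (2 * ?m) = xs @ alt t s ?m" "set xs \<subseteq> {s, t}"
        using alt_drop[of ?m "2 * ?m" t s] by auto
      obtain n where n: "2 * ?m = Suc n" "odd n" using m2 by (intro that[of "2 * ?m - 1"]) auto
      have lx: "length xs = ?m" using xs(1) by (metis length_alt length_append add_right_cancel mult_2)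
      obtain x xs' where x: "xs = x # xs'" using lx m2 by (cases xs) auto
      have "alt t s (2 * ?m) = s # alt t s n" using n by simp
      then have xs_s: "xs = s # xs'" using xs(1) x by simp
      have xl: "xs' \<in> lists S" "xs \<in> lists S" using xs x t less.prems by auto
      have "ev xs \<otimes> ev (alt t s ?m) = \<one>"
        using ev_alt_double[of s t] xs t less.prems xl al by (simp add: ev_append)
      then have "ev (alt t s ?m) = inv (ev xs)"
        using xl al inv_equality inv_inv ev_closed by metis
      then have "ev (alt t s ?m) = ev (rev xs') \<otimes> s"
        using xl less.prems unfolding xs_s by (simp add: ev_rev inv_mult_group S_closed S_inv)
      then have "w \<otimes> s = v2 \<otimes> ev (rev xs')"
        using v2 xl less.prems rev_lists by (simp add: m_assoc S_closed S_square)
      then have "len (w \<otimes> s) \<le> len v2 + length xs'"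
        using len_mult_ev[OF v2(1) rev_lists[OF xl(1)]] by simp
      then show False using v2 v lus lx xs_s less.prems by simp
    qed
    \<comment> \<open>\<open>y\<close> is the letter that would prolong the alternating factor and
      \<open>z\<close> its first letter. Maximality of \<open>k\<close> shows that \<open>y\<close>
      is an ascent of \<open>v\<close>, additivity of lengths does it for \<open>z\<close>, and
      together they are \<open>s\<close> and \<open>t\<close>.\<close>
    define y where "y = (if even k then t else s)"
    define z where "z = (if even k then s else t)"
    have yz: "y \<in> S" "z \<in> S" using t less.prems by (auto simp: y_def z_def)
    have ly: "len (v \<otimes> y) > len v"
    proof (rule ccontr)
      assume "\<not> ?thesis"
      then have l: "len v = len (v \<otimes> y) + 1" using len_right[OF v(1) yz(1)] by linarith
      have "w = (v \<otimes> y) \<otimes> ev (alt t s (Suc k))"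
        using v yz al by (simp add: m_assoc S_closed flip: y_def)
      then have "P (Suc k)" unfolding P_def using l v yz S_closed by (intro bexI[of _ "v \<otimes> y"]) auto
      then show False using k(2) by fastforce
    qed
    have lz: "len (v \<otimes> z) > len v"
    proof -
      obtain j where j: "k = Suc j" using k1 by (cases k) auto
      have "alt t s k = z # alt t s j" using j by (simp add: z_def)
      then have "w = (v \<otimes> z) \<otimes> ev (alt t s j)" using v yz al[of j] by (simp add: m_assoc S_closed)
      then have "len w \<le> len (v \<otimes> z) + j"
        using len_mult_ev[of "v \<otimes> z" "alt t s j"] al v yz S_closed by auto
      then show ?thesis using v j by simp
    qed
    have "len v < len w" using v k1 by simp
    then have nny: "nonneg (act v (sroot y))" "nonneg (act v (sroot z))" using less.hyps v yz ly lz by auto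
    have nnst: "nonneg (act v (sroot s))" "nonneg (act v (sroot t))" using nny by (auto simp: y_def z_def split: if_splits)
    have ma: "real ?m * angle s t = pi" "angle s t > 0"
      using km by (auto simp: angle_def)
    have sn: "sin (real j * angle s t) / sin (angle s t) \<ge> 0" if "j \<le> ?m" for j
    proof -
      have "real j * angle s t \<le> real ?m * angle s t" using that ma by (intro mult_right_mono) auto
      then show ?thesis using sin_angle_pos[OF less.prems(2) t st] ma
        by (intro divide_nonneg_pos sin_ge_zero) auto
    qed
    have sn': "sin (real k * angle s t) / sin (angle s t) \<ge> 0"
      "sin ((real k + 1) * angle s t) / sin (angle s t) \<ge> 0"
      using sn[of k] sn[of "Suc k"] km by (simp_all add: add.commute)
    have "act w (sroot s) = act v (foldr reflect (alt t s k) (sroot s))"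
      using v al by (simp add: act_mult act_ev)
    moreover have c: "nonneg (act v (\<lambda>x. p * sroot s x + q * sroot t x))" if "0 \<le> p" "0 \<le> q" for p q
      unfolding act_lin[OF v(1)] using nonneg_comb nnst that by blast
    ultimately show ?thesis
      unfolding fold_alt[OF less.prems(2) t st, of k]
      using c[OF sn'(1) sn'(2)] c[OF sn'(2) sn'(1)] by (simp only: simp_thms split: if_splits)
  qed
qed

section \<open>Roots and their signs\<close>

definition is_root :: "('a \<Rightarrow> real) \<Rightarrow> bool" where "is_root r \<longleftrightarrow> (\<exists>w\<in>carrier G. \<exists>s\<in>S. r = act w (sroot s))"
definition pos :: "('a \<Rightarrow> real) \<Rightarrow> bool" where "pos r \<longleftrightarrow> is_root r \<and> nonneg r"
text \<open>These are left inversions: the inverse is applied, so that a prefix of a reduced word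
  has the smaller set.\<close>

definition Inv :: "'a \<Rightarrow> ('a \<Rightarrow> real) set" where "Inv w = {r. pos r \<and> \<not> nonneg (act (inv w) r)}"

lemma root_act: "g \<in> carrier G \<Longrightarrow> is_root r \<Longrightarrow> is_root (act g r)"
proof -
  assume g: "g \<in> carrier G" and "is_root r"
  then obtain w s where w: "w \<in> carrier G" "s \<in> S" "r = act w (sroot s)" unfolding is_root_def by blast
  then have "act g r = act (g \<otimes> w) (sroot s)" using g by (simp add: act_mult)
  then show ?thesis unfolding is_root_def using w g by blast
qed

lemma root_sroot: "s \<in> S \<Longrightarrow> is_root (sroot s)"
  unfolding is_root_def by (intro bexI[of _ \<one>] bexI[of _ s]) auto

lemma pos_sroot: "s \<in> S \<Longrightarrow> pos (sroot s)"
  by (simp add: pos_def root_sroot nonneg_sroot)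

lemma reflect_sroot: "s \<in> S \<Longrightarrow> reflect s (sroot s) = (\<lambda>x. - sroot s x)"
  by (auto simp: reflect_def form_self)

lemma act_right: "w \<in> carrier G \<Longrightarrow> s \<in> S \<Longrightarrow> act (w \<otimes> s) v = act w (reflect s v)"
  by (simp add: act_mult S_closed act_S)

lemma act_right_sroot: "w \<in> carrier G \<Longrightarrow> s \<in> S \<Longrightarrow> act (w \<otimes> s) (sroot s) = (\<lambda>x. - act w (sroot s) x)"
  by (simp add: act_right reflect_sroot act_neg)

lemma root_neg: "is_root r \<Longrightarrow> is_root (\<lambda>x. - r x)"
proof -
  assume "is_root r"
  then obtain w s where w: "w \<in> carrier G" "s \<in> S" "r = act w (sroot s)" unfolding is_root_def by blast
  then have "(\<lambda>x. - r x) = act (w \<otimes> s) (sroot s)" by (simp add: act_right_sroot)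
  then show ?thesis unfolding is_root_def using w S_closed by blast
qed

lemma root_form: "is_root r \<Longrightarrow> form r r = 1"
  unfolding is_root_def using act_form form_self by auto

lemma form_zero [simp]: "form (\<lambda>x. 0) v = 0"
  by (simp add: form_def)

lemma root_not_both: "is_root r \<Longrightarrow> nonneg r \<Longrightarrow> nonneg (\<lambda>x. - r x) \<Longrightarrow> False"
proof -
  assume "is_root r" "nonneg r" "nonneg (\<lambda>x. - r x)"
  then have "r = (\<lambda>x. 0)" by (auto simp: nonneg_def order_antisym)
  then show False using root_form[OF \<open>is_root r\<close>] by simp
qed

text \<open>The images of \<open>sroot s\<close> under \<open>w\<close> and
  \<open>w \<otimes> s\<close> are opposite, and \<open>act_pos\<close> applies to the shorter of
  the two elements.\<close>

lemma root_sign: assumes "is_root r" shows "nonneg (\<lambda>x. - r x) \<longleftrightarrow> \<not> nonneg r"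
proof -
  obtain w s where w: "w \<in> carrier G" "s \<in> S" "r = act w (sroot s)" using assms by (auto simp: is_root_def)
  have "nonneg r \<or> nonneg (\<lambda>x. - r x)"
  proof (cases "len (w \<otimes> s) > len w")
    case True
    then show ?thesis using act_pos w by auto
  next
    case False
    then have "len (w \<otimes> s \<otimes> s) > len (w \<otimes> s)" using len_right[OF w(1,2)] w by auto
    then have "nonneg (act (w \<otimes> s) (sroot s))" using act_pos[of "w \<otimes> s" s] w S_closed by auto
    then show ?thesis using w by (simp add: act_right_sroot)
  qed
  then show ?thesis using root_not_both assms by blast
qed

lemma pos_neg: "is_root r \<Longrightarrow> pos (\<lambda>x. - r x) \<longleftrightarrow> \<not> pos r"
  by (simp add: pos_def root_sign root_neg)

lemma act_sum: assumes "g \<in> carrier G" "finite A"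
  shows "act g (\<lambda>x. \<Sum>s\<in>A. c s * f s x) = (\<lambda>x. \<Sum>s\<in>A. c s * act g (f s) x)"
  using assms(2)
proof (induction A rule: finite_induct)
  case empty
  then show ?case using act_scale[OF assms(1), of 0 "\<lambda>x. 0"] by simp
next
  case (insert a A)
  then show ?case using act_lin[OF assms(1), of "c a" "f a" 1 "\<lambda>x. \<Sum>s\<in>A. c s * f s x"] by simp
qed

lemma expand: assumes "J \<subseteq> S" "\<forall>x. x \<notin> J \<longrightarrow> v x = 0"
  shows "v = (\<lambda>x. \<Sum>s\<in>J. v s * sroot s x)"
proof
  fix x
  have "finite J" using assms finite_S finite_subset by blast
  moreover have "(\<Sum>s\<in>J. v s * sroot s x) = (\<Sum>s\<in>J. if s = x then v x else 0)"
    by (rule sum.cong) (auto simp: sroot_def)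
  ultimately show "v x = (\<Sum>s\<in>J. v s * sroot s x)" using assms by simp
qed

lemma act_expand: assumes "g \<in> carrier G" "J \<subseteq> S" "\<forall>x. x \<notin> J \<longrightarrow> v x = 0"
  shows "act g v = (\<lambda>x. \<Sum>s\<in>J. v s * act g (sroot s) x)"
proof -
  have fin: "finite J" using assms finite_S finite_subset by blast
  show ?thesis
    by (subst (1) expand[OF assms(2,3)]) (rule act_sum[OF assms(1) fin])
qed

lemma nonneg_act: assumes "g \<in> carrier G" "J \<subseteq> S" "\<forall>x. x \<notin> J \<longrightarrow> v x = 0" "nonneg v"
  "\<And>j. j \<in> J \<Longrightarrow> nonneg (act g (sroot j))"
  shows "nonneg (act g v)"
  unfolding act_expand[OF assms(1-3)] using assms(4,5)
  by (auto simp: nonneg_def intro!: sum_nonneg)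

lemma form_expand: assumes "a \<in> S" "J \<subseteq> S" "\<forall>x. x \<notin> J \<longrightarrow> v x = 0"
  shows "form (sroot a) v = (\<Sum>t\<in>J. v t * bil a t)"
  unfolding form_sroot_l[OF assms(1)]
  by (rule sum.mono_neutral_right) (use assms finite_S in auto)

lemma form_nonpos: assumes "a \<in> S" "nonneg v" "v a = 0" shows "form (sroot a) v \<le> 0"
  unfolding form_sroot_l[OF assms(1)]
proof (rule sum_nonpos)
  fix t assume "t \<in> S"
  then show "v t * bil a t \<le> 0"
    using assms bil_nonpos[of a t] by (cases "a = t") (auto simp: nonneg_def mult_nonneg_nonpos)
qed

lemma form_neg_l: "form (\<lambda>x. - u x) v = - form u v" and form_neg_r: "form u (\<lambda>x. - v x) = - form u v"
  by (simp_all add: form_def sum_negf)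

text \<open>The reflection alters the coordinate at \<open>a\<close> only. A root concentrated there
  has norm 1 and is simple; any other positive root keeps a positive coordinate, and that decides
  the sign.\<close>

lemma pos_reflect: assumes "pos r" "a \<in> S" "r \<noteq> sroot a" shows "pos (reflect a r)"
proof -
  have rt: "is_root (reflect a r)" using assms root_act[of a r] by (simp add: act_S S_closed pos_def)
  have "\<exists>x. x \<noteq> a \<and> r x \<noteq> 0"
  proof (rule ccontr)
    assume "\<not> ?thesis"
    then have e: "r = (\<lambda>x. r a * sroot a x + 0 * sroot a x)" by (intro ext) (auto simp: sroot_def)
    have "form r r = r a * r a" by (subst (1 2) e) (simp only: form_lin_l form_lin_r form_self[OF assms(2)], simp)
    then have "r a * r a = 1" using root_form assms by (simp add: pos_def)
    moreover have "r a \<ge> 0" using assms by (simp add: pos_def nonneg_def)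
    ultimately have "r a = 1" by (metis abs_of_nonneg abs_mult_self_eq mult_1_right real_sqrt_abs2 real_sqrt_one)
    then show False using e assms by auto
  qed
  then obtain x where x: "x \<noteq> a" "r x \<noteq> 0" by blast
  then have "reflect a r x > 0" using assms by (simp add: pos_def nonneg_def reflect_def sroot_def order_less_le)
  then have "\<not> nonneg (\<lambda>x. - reflect a r x)" by (auto simp: nonneg_def not_le intro!: exI[of _ x])
  then show ?thesis using root_sign[OF rt] rt by (simp add: pos_def)
qed

section \<open>Descents and inversion sets\<close>

definition Des :: "'a \<Rightarrow> 'a set" where "Des w = {s \<in> S. \<not> nonneg (act w (sroot s))}"
text \<open>For a descent \<open>s\<close>, \<open>croot w s\<close> is the root of the cover reflection
  \<open>w s w\<close>\<open>\<^sup>-\<^sup>1\<close> of \<open>w\<close>.\<close>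
definition croot :: "'a \<Rightarrow> 'a \<Rightarrow> 'a \<Rightarrow> real" where "croot w s = (\<lambda>x. - act w (sroot s) x)"

lemma len_des: assumes "w \<in> carrier G" "s \<in> S"
  shows "len (w \<otimes> s) < len w \<longleftrightarrow> \<not> nonneg (act w (sroot s))"
proof
  assume "len (w \<otimes> s) < len w"
  then have "nonneg (act (w \<otimes> s) (sroot s))" using act_pos[of "w \<otimes> s" s] assms S_closed by auto
  then show "\<not> nonneg (act w (sroot s))"
    using root_sign[of "act w (sroot s)"] root_act root_sroot assms by (simp add: act_right_sroot)
next
  assume "\<not> nonneg (act w (sroot s))"
  then show "len (w \<otimes> s) < len w" using act_pos[OF assms] len_right[OF assms] by linarith
qed

lemma descents_D: "w \<in> carrier G \<Longrightarrow> descents G S w = Des w"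
  unfolding descents_def Des_def using len_des by auto

lemma len_left: assumes "w \<in> carrier G" "a \<in> S"
  shows "len (a \<otimes> w) < len w \<longleftrightarrow> sroot a \<in> Inv w"
proof -
  have "len (a \<otimes> w) = len (inv w \<otimes> a)"
    using len_inv[of "a \<otimes> w"] assms by (simp add: inv_mult_group S_closed S_inv)
  then show ?thesis using len_des[of "inv w" a] len_inv[of w] assms pos_sroot by (simp add: Inv_def)
qed

lemma len_left_Suc: assumes "w \<in> carrier G" "a \<in> S" "sroot a \<in> Inv w"
  shows "len w = Suc (len (a \<otimes> w))"
proof -
  have "len (a \<otimes> w) = len (inv w \<otimes> a)"
    using len_inv[of "a \<otimes> w"] assms by (simp add: inv_mult_group S_closed S_inv)
  then show ?thesis using len_right[of "inv w" a] len_inv[of w] len_left[of w a] assms by auto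
qed

lemma left_des_ex: assumes "w \<in> carrier G" "w \<noteq> \<one>" shows "\<exists>a\<in>S. sroot a \<in> Inv w"
proof -
  obtain ws where ws: "reduced_word G S ws w" using reduced_ex assms by blast
  then obtain a vs where "ws = a # vs" using assms by (cases ws) (auto simp: reduced_word_def)
  then have a: "a \<in> S" "vs \<in> lists S" "w = a \<otimes> ev vs" "len w = Suc (length vs)"
    using ws by (auto simp: reduced_word_def)
  then have "len (a \<otimes> w) < len w" using len_le[of vs] by simp
  then show ?thesis using len_left assms a by blast
qed

lemma right_des_ex: assumes "w \<in> carrier G" "w \<noteq> \<one>" shows "\<exists>s\<in>S. s \<in> Des w"
proof -
  obtain a where a: "a \<in> S" "sroot a \<in> Inv (inv w)"
    using left_des_ex[of "inv w"] assms inv_eq_1_iff by auto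
  then have "a \<in> Des w" using assms by (simp add: Des_def Inv_def)
  then show ?thesis using a by auto
qed

lemma Inv_one [simp]: "Inv \<one> = {}"
  by (auto simp: Inv_def pos_def)

lemma Inv_pos: "r \<in> Inv w \<Longrightarrow> pos r"
  by (simp add: Inv_def)

lemma Inv_left: assumes "w \<in> carrier G" "a \<in> S" "pos r" "r \<noteq> sroot a"
  shows "r \<in> Inv (a \<otimes> w) \<longleftrightarrow> reflect a r \<in> Inv w"
  using assms pos_reflect by (simp add: Inv_def inv_mult_group S_closed S_inv act_right)

lemma Inv_left': assumes "w \<in> carrier G" "a \<in> S" "pos r" "r \<noteq> sroot a"
  shows "reflect a r \<in> Inv (a \<otimes> w) \<longleftrightarrow> r \<in> Inv w"
proof -
  have "reflect a r \<noteq> sroot a"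
  proof
    assume e: "reflect a r = sroot a"
    then have "r = (\<lambda>x. - sroot a x)" using reflect_reflect[OF assms(2), of r] reflect_sroot assms by simp
    then show False using assms pos_neg[of "sroot a"] pos_sroot root_sroot by auto
  qed
  then show ?thesis using Inv_left[of w a "reflect a r"] pos_reflect assms by (simp add: reflect_reflect)
qed

lemma Inv_left_sroot: assumes "w \<in> carrier G" "a \<in> S"
  shows "sroot a \<in> Inv (a \<otimes> w) \<longleftrightarrow> sroot a \<notin> Inv w"
proof -
  have "is_root (act (inv w) (sroot a))" using assms root_act root_sroot by simp
  then show ?thesis using assms pos_sroot root_sign
    by (simp add: Inv_def inv_mult_group S_closed S_inv act_right_sroot)
qed

lemma act_inv_cancel: assumes "w \<in> carrier G" shows "act (inv w) (act w v) = v" "act w (act (inv w) v) = v"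
  using assms by (simp_all flip: act_mult)

lemma croot_pos: assumes "w \<in> carrier G" "s \<in> Des w" shows "pos (croot w s)"
  using assms root_act root_sroot by (simp add: croot_def Des_def pos_def root_neg root_sign)

lemma croot_Inv: assumes "w \<in> carrier G" "s \<in> Des w" shows "croot w s \<in> Inv w"
  using assms croot_pos[OF assms] root_sign[of "sroot s"] root_sroot nonneg_sroot
  by (simp add: Inv_def croot_def act_neg act_inv_cancel Des_def)

text \<open>\<open>s\<close> permutes the positive roots other than \<open>sroot s\<close>, so only
  the root that \<open>inv w\<close> sends to the negative of \<open>sroot s\<close> stops being an
  inversion.\<close>

lemma Inv_right: assumes "w \<in> carrier G" "s \<in> Des w"
  shows "Inv (w \<otimes> s) = Inv w - {croot w s}"
proof -
  have s: "s \<in> S" using assms by (simp add: Des_def)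
  have "\<not> nonneg (reflect s (act (inv w) r)) \<longleftrightarrow> \<not> nonneg (act (inv w) r) \<and> r \<noteq> croot w s" if r: "pos r" for r
  proof -
    let ?g = "act (inv w) r"
    have g: "is_root ?g" using root_act assms r by (simp add: pos_def)
    have e1: "?g = (\<lambda>x. - sroot s x) \<longleftrightarrow> r = croot w s"
    proof
      assume "?g = (\<lambda>x. - sroot s x)"
      then have "act w ?g = croot w s" using assms by (simp add: act_neg croot_def)
      then show "r = croot w s" using assms act_inv_cancel by simp
    next
      assume "r = croot w s"
      then show "?g = (\<lambda>x. - sroot s x)" using assms act_inv_cancel by (simp add: croot_def act_neg)
    qed
    have e2: "?g \<noteq> sroot s"
    proof
      assume "?g = sroot s"
      then have "r = act w (sroot s)" using assms act_inv_cancel by metis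
      then show False using r assms by (simp add: Des_def pos_def)
    qed
    show ?thesis
    proof (cases "nonneg ?g")
      case True
      then have "nonneg (reflect s ?g)" using pos_reflect[of ?g s] g s e2 by (simp add: pos_def)
      then show ?thesis using True by simp
    next
      case False
      have n: "reflect s (\<lambda>x. - ?g x) = (\<lambda>x. - reflect s ?g x)" using act_neg[of s] s by (simp add: act_S S_closed)
      have pn: "pos (\<lambda>x. - ?g x)" using False g by (simp add: pos_def root_neg root_sign)
      have rr: "is_root (reflect s ?g)" using root_act[of s ?g] g s by (simp add: act_S S_closed)
      show ?thesis
      proof (cases "r = croot w s")
        case True
        then have "reflect s ?g = sroot s" using e1 s act_neg[of s "sroot s"] by (simp add: act_S S_closed reflect_sroot)
        then show ?thesis using True nonneg_sroot by simp
      next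
        case f: False
        have "(\<lambda>x. - ?g x) \<noteq> sroot s"
        proof
          assume h: "(\<lambda>x. - ?g x) = sroot s"
          have "?g = (\<lambda>x. - sroot s x)" unfolding h[symmetric] by simp
          then show False using e1 f by blast
        qed
        then have "nonneg (\<lambda>x. - reflect s ?g x)" using pos_reflect[OF pn s] n by (simp add: pos_def)
        then show ?thesis using root_sign[OF rr] False f by simp
      qed
    qed
  qed
  then show ?thesis using assms s
    by (auto simp: Inv_def inv_mult_group S_closed S_inv act_mult act_S)
qed

lemma D_S: "s \<in> Des w \<Longrightarrow> s \<in> S"
  by (simp add: Des_def)

lemma D_right: assumes "w \<in> carrier G" "s \<in> S" shows "s \<in> Des (w \<otimes> s) \<longleftrightarrow> s \<notin> Des w"
  using assms root_sign[of "act w (sroot s)"] root_act root_sroot by (simp add: Des_def act_right_sroot)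

section \<open>The weak order as inclusion of inversion sets\<close>

definition wle :: "'a \<Rightarrow> 'a \<Rightarrow> bool" where
  "wle u v \<longleftrightarrow> u \<in> carrier G \<and> v \<in> carrier G \<and> Inv u \<subseteq> Inv v"

text \<open>Left multiplication by \<open>a\<close> permutes the positive roots other than
  \<open>sroot a\<close> and toggles \<open>sroot a\<close>, so agreement at \<open>sroot a\<close>
  is all that is needed. This carries the inductions over initial letters.\<close>

lemma Inv_sub_left: assumes "u \<in> carrier G" "v \<in> carrier G" "a \<in> S" "sroot a \<in> Inv u \<longleftrightarrow> sroot a \<in> Inv v"
  shows "Inv (a \<otimes> u) \<subseteq> Inv (a \<otimes> v) \<longleftrightarrow> Inv u \<subseteq> Inv v"
proof -
  have *: "Inv (a \<otimes> u) \<subseteq> Inv (a \<otimes> v)"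
    if "u \<in> carrier G" "v \<in> carrier G" "sroot a \<in> Inv u \<longleftrightarrow> sroot a \<in> Inv v" "Inv u \<subseteq> Inv v" for u v
  proof
    fix r assume r: "r \<in> Inv (a \<otimes> u)"
    show "r \<in> Inv (a \<otimes> v)"
    proof (cases "r = sroot a")
      case True
      then show ?thesis using r that assms Inv_left_sroot by blast
    next
      case False
      then show ?thesis using r that assms Inv_left[OF _ assms(3) Inv_pos[OF r] False] by blast
    qed
  qed
  have "Inv u \<subseteq> Inv v" if "Inv (a \<otimes> u) \<subseteq> Inv (a \<otimes> v)"
    using *[of "a \<otimes> u" "a \<otimes> v"] that assms Inv_left_sroot by (simp add: S_closed)
  then show ?thesis using *[of u v] assms by blast
qed

text \<open>A left descent of \<open>u\<close> is also one of \<open>v\<close> by inclusion, so both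
  reduced words can start with it, and the rest is an induction on the length of
  \<open>u\<close>.\<close>

lemma wle_weak: "u \<in> carrier G \<Longrightarrow> v \<in> carrier G \<Longrightarrow> Inv u \<subseteq> Inv v \<Longrightarrow> weak_le G S u v"
proof (induction "len u" arbitrary: u v)
  case 0
  then have "u = \<one>" using len_0 by simp
  moreover obtain b where "reduced_word G S b v" using reduced_ex 0 by blast
  moreover have "reduced_word G S [] \<one>" by (simp add: reduced_word_def)
  ultimately show ?case unfolding weak_le_def by (metis append_Nil)
next
  case (Suc n)
  then obtain a where a: "a \<in> S" "sroot a \<in> Inv u" using left_des_ex[of u] by fastforce
  then have av: "sroot a \<in> Inv v" using Suc by blast
  have lu: "len u = Suc (len (a \<otimes> u))" "len v = Suc (len (a \<otimes> v))"
    using len_left_Suc Suc.prems a av by auto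
  have "weak_le G S (a \<otimes> u) (a \<otimes> v)"
    using Suc.hyps(1)[of "a \<otimes> u" "a \<otimes> v"] Inv_sub_left[of u v a] Suc a av lu S_closed by auto
  then obtain p b where pb: "reduced_word G S p (a \<otimes> u)" "reduced_word G S (p @ b) (a \<otimes> v)"
    unfolding weak_le_def by blast
  have "reduced_word G S (a # p) u" "reduced_word G S (a # p @ b) v"
    using pb a lu Suc.prems unfolding reduced_word_def by auto
  then show ?case unfolding weak_le_def by (metis append_Cons)
qed

lemma weak_Inv: "reduced_word G S p u \<Longrightarrow> reduced_word G S (p @ b) v \<Longrightarrow> Inv u \<subseteq> Inv v"
proof (induction p arbitrary: u v)
  case Nil
  then show ?case by (auto simp: reduced_word_def)
next
  case (Cons a p)
  then have a: "a \<in> S" "p \<in> lists S" "b \<in> lists S" "u = a \<otimes> ev p" "v = a \<otimes> ev (p @ b)"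
    and l: "len u = Suc (length p)" "len v = Suc (length (p @ b))" by (auto simp: reduced_word_def)
  have c: "u \<in> carrier G" "v \<in> carrier G" using a S_closed ev_closed[of "p @ b"] by auto
  have au: "a \<otimes> u = ev p" "a \<otimes> v = ev (p @ b)" using a ev_closed[of "p @ b"] by auto
  have "len (a \<otimes> u) < len u" "len (a \<otimes> v) < len v"
    using len_le[of p] len_le[of "p @ b"] a l unfolding au by auto
  then have s: "sroot a \<in> Inv u" "sroot a \<in> Inv v" using len_left[OF c(1) a(1)] len_left[OF c(2) a(1)] by blast+
  have "reduced_word G S p (a \<otimes> u)" "reduced_word G S (p @ b) (a \<otimes> v)"
    using len_left_Suc[OF c(1) a(1) s(1)] len_left_Suc[OF c(2) a(1) s(2)] l au a by (auto simp: reduced_word_def)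
  then have "Inv (a \<otimes> u) \<subseteq> Inv (a \<otimes> v)" by (rule Cons.IH)
  then show ?case using Inv_sub_left[OF c a(1)] s by simp
qed

lemma weak_le_iff: "weak_le G S u v \<longleftrightarrow> wle u v"
proof
  assume "weak_le G S u v"
  then obtain p b where pb: "reduced_word G S p u" "reduced_word G S (p @ b) v" by (auto simp: weak_le_def)
  then have "u \<in> carrier G" "v \<in> carrier G"
    using ev_closed[of p] ev_closed[of "p @ b"] by (auto simp: reduced_word_def)
  then show "wle u v" using weak_Inv[OF pb] by (simp add: wle_def)
qed (auto simp: wle_def wle_weak)

lemma wle_refl: "u \<in> carrier G \<Longrightarrow> wle u u"
  by (simp add: wle_def)

lemma wle_trans: "wle u v \<Longrightarrow> wle v w \<Longrightarrow> wle u w"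
  by (auto simp: wle_def)

lemma wle_antisym: assumes "wle u v" "wle v u" shows "u = v"
proof -
  obtain p b where 1: "reduced_word G S p u" "reduced_word G S (p @ b) v"
    using assms(1) unfolding weak_le_iff[symmetric] weak_le_def by blast
  obtain q c where 2: "reduced_word G S q v" "reduced_word G S (q @ c) u"
    using assms(2) unfolding weak_le_iff[symmetric] weak_le_def by blast
  have "length (p @ b) = length q" "length (q @ c) = length p" using 1 2 by (auto simp: reduced_word_def)
  then have "length b = 0" unfolding length_append by linarith
  then have "b = []" by simp
  then show ?thesis using 1 by (auto simp: reduced_word_def)
qed

lemma Inv_inj: "u \<in> carrier G \<Longrightarrow> v \<in> carrier G \<Longrightarrow> Inv u = Inv v \<Longrightarrow> u = v"
  by (rule wle_antisym) (auto simp: wle_def)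

text \<open>The cocycle property of inversions. If \<open>act u r\<close> were negative, its
  opposite would be an inversion of \<open>u\<close>, hence of \<open>w\<close>, contrary to the
  sign of \<open>act (inv w) (act u r)\<close>.\<close>

lemma Inv_decomp: assumes "wle u w" "r \<in> Inv (inv u \<otimes> w)" shows "act u r \<in> Inv w - Inv u"
proof -
  have c: "u \<in> carrier G" "w \<in> carrier G" using assms by (auto simp: wle_def)
  have r: "pos r" "\<not> nonneg (act (inv w) (act u r))"
    using assms c by (auto simp: Inv_def inv_mult_group act_mult)
  have rt: "is_root (act u r)" using r c root_act by (simp add: pos_def)
  have "nonneg (act u r)"
  proof (rule ccontr)
    assume n: "\<not> nonneg (act u r)"
    let ?b = "\<lambda>x. - act u r x"
    have b: "pos ?b" using n rt by (simp add: pos_def root_neg root_sign)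
    have "act (inv u) ?b = (\<lambda>x. - r x)" using c by (simp add: act_neg act_inv_cancel)
    then have "?b \<in> Inv u" using b r root_sign[of r] by (auto simp: Inv_def pos_def)
    then have "?b \<in> Inv w" using assms by (auto simp: wle_def)
    then have "\<not> nonneg (\<lambda>x. - act (inv w) (act u r) x)" using c by (simp add: Inv_def act_neg)
    then show False using r root_sign[of "act (inv w) (act u r)"] rt root_act c by simp
  qed
  then show ?thesis using r rt c act_inv_cancel by (auto simp: Inv_def pos_def)
qed

lemma wle_right: assumes "w \<in> carrier G" "s \<in> Des w" shows "wle (w \<otimes> s) w"
  using assms Inv_right D_S S_closed by (auto simp: wle_def)

text \<open>A right descent of \<open>inv u \<otimes> w\<close> has a cover root; transported by
  \<open>u\<close> it becomes a cover root of \<open>w\<close> that \<open>u\<close> lacks. The weak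
  order is thus coatomic below \<open>w\<close>.\<close>

lemma wlt_des: assumes "wle u w" "u \<noteq> w" shows "\<exists>s\<in>Des w. wle u (w \<otimes> s)"
proof -
  have c: "u \<in> carrier G" "w \<in> carrier G" using assms by (auto simp: wle_def)
  let ?v = "inv u \<otimes> w"
  have "?v \<noteq> \<one>" using assms c by (metis inv_closed inv_equality inv_inv)
  then obtain s where s: "s \<in> S" "s \<in> Des ?v" using right_des_ex[of ?v] c by auto
  have "croot ?v s \<in> Inv ?v" using croot_Inv c s by simp
  from Inv_decomp[OF assms(1) this] have d: "act u (croot ?v s) \<in> Inv w - Inv u" .
  have e: "act u (croot ?v s) = croot w s"
    using c s act_mult[of u ?v "sroot s"] by (simp add: croot_def act_neg flip: m_assoc)
  have "s \<in> Des w" using d e s Inv_pos[of "croot w s" w] root_sign[of "act w (sroot s)"] root_act root_sroot c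
    by (auto simp: croot_def Des_def pos_def)
  then show ?thesis using d e assms Inv_right[OF c(2)] c s S_closed by (intro bexI[of _ s]) (auto simp: wle_def)
qed

subsection \<open>Sortable elements and the Cambrian projection\<close>

definition supp :: "'a set \<Rightarrow> ('a \<Rightarrow> real) \<Rightarrow> bool" where "supp K v \<longleftrightarrow> (\<forall>x. x \<notin> K \<longrightarrow> v x = 0)"

text \<open>The Euler form of the Coxeter element given by the word: it is unitriangular with respect to
  the order of the letters, and its antisymmetrisation is the form \<open>\<omega>\<^sub>c\<close> of Reading and
  Speyer.\<close>
fun euler :: "'a list \<Rightarrow> ('a \<Rightarrow> real) \<Rightarrow> ('a \<Rightarrow> real) \<Rightarrow> real" where
  "euler [] x y = 0"
| "euler (a # C) x y = x a * y a + 2 * (\<Sum>j\<in>set C. x j * bil j a) * y a + euler C x y"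

abbreviation wd :: "'a list \<Rightarrow> bool" where "wd C \<equiv> distinct C \<and> set C \<subseteq> S"

lemma euler_lin_l: "euler C (\<lambda>x. p * u x + q * v x) y = p * euler C u y + q * euler C v y"
proof (induction C)
  case (Cons a C)
  have "(\<Sum>j\<in>set C. (p * u j + q * v j) * bil j a)
      = p * (\<Sum>j\<in>set C. u j * bil j a) + q * (\<Sum>j\<in>set C. v j * bil j a)"
    by (simp add: sum_distrib_left sum.distrib algebra_simps)
  then show ?case using Cons by (simp add: algebra_simps)
qed simp

lemma euler_lin_r: "euler C y (\<lambda>x. p * u x + q * v x) = p * euler C y u + q * euler C y v"
  by (induction C) (simp_all add: algebra_simps)

lemma euler_cong: "(\<And>j. j \<in> set C \<Longrightarrow> x j = x' j) \<Longrightarrow> (\<And>j. j \<in> set C \<Longrightarrow> y j = y' j) \<Longrightarrow> euler C x y = euler C x' y'"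
proof (induction C)
  case (Cons a C)
  have "(\<Sum>j\<in>set C. x j * bil j a) = (\<Sum>j\<in>set C. x' j * bil j a)"
    by (rule sum.cong) (use Cons in auto)
  then show ?case using Cons by simp
qed simp

lemma euler_snoc: "distinct (C @ [a]) \<Longrightarrow>
  euler (C @ [a]) x y = euler C x y + x a * y a + 2 * x a * (\<Sum>j\<in>set C. bil a j * y j)"
proof (induction C)
  case (Cons b C)
  have "(\<Sum>j\<in>set (C @ [a]). x j * bil j b) = (\<Sum>j\<in>set C. x j * bil j b) + x a * bil a b"
    using Cons by simp
  then show ?case using Cons by (simp add: algebra_simps)
qed simp

lemma form_split: assumes "wd (a # C)" "supp (set (a # C)) x"
  shows "form (sroot a) x = x a + (\<Sum>j\<in>set C. x j * bil a j)"
  using form_expand[of a "set (a # C)" x] assms by (simp add: supp_def bil_self)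

lemma reflect_other: "j \<noteq> a \<Longrightarrow> reflect a x j = x j"
  by (simp add: reflect_def sroot_def)

lemma reflect_self: "reflect a x a = x a - 2 * form (sroot a) x"
  by (simp add: reflect_def sroot_def)

lemma supp_reflect: "supp K x \<Longrightarrow> a \<in> K \<Longrightarrow> supp K (reflect a x)"
  by (auto simp: supp_def reflect_def sroot_def)

lemma supp_sroot: "a \<in> K \<Longrightarrow> supp K (sroot a)"
  by (auto simp: supp_def sroot_def)

text \<open>Moving the initial letter to the end is a source-sink move; reflecting both arguments in
  that letter compensates for it.\<close>

lemma euler_rot: assumes "wd (a # C)" "supp (set (a # C)) x" "supp (set (a # C)) y"
  shows "euler (C @ [a]) (reflect a x) (reflect a y) = euler (a # C) x y"
proof -
  let ?X = "\<Sum>j\<in>set C. x j * bil a j" and ?Y = "\<Sum>j\<in>set C. bil a j * y j"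
  have ne: "j \<noteq> a" if "j \<in> set C" for j using assms that by auto
  have 1: "euler C (reflect a x) (reflect a y) = euler C x y" by (rule euler_cong) (simp_all add: ne reflect_other)
  have 2: "(\<Sum>j\<in>set C. bil a j * reflect a y j) = ?Y"
    by (rule sum.cong) (simp_all add: ne reflect_other)
  have 3: "reflect a x a = - x a - 2 * ?X" using form_split[OF assms(1,2)] by (simp add: reflect_self)
  have "form (sroot a) y = y a + ?Y" using form_split[OF assms(1,3)] by (simp add: mult.commute)
  then have 4: "reflect a y a = - y a - 2 * ?Y" by (simp add: reflect_self)
  have 5: "(\<Sum>j\<in>set C. x j * bil j a) = ?X"
    by (rule sum.cong) (use assms in \<open>auto simp: bil_sym subset_iff\<close>)
  have d: "distinct (C @ [a])" using assms by simp
  show ?thesis unfolding euler_snoc[OF d] euler.simps 1 2 3 4 5 by (simp add: algebra_simps)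
qed

text \<open>Pairing with the initial simple root on the left reads off a coordinate. The three
  companions treat the right argument and the last letter, where in two cases the reflected
  coordinate appears; so Euler pairings become sign information on roots.\<close>

lemma euler_front: assumes "wd (a # C)" shows "euler (a # C) (sroot a) y = y a"
proof -
  have "euler C (sroot a) y = euler C (\<lambda>x. 0) y" by (rule euler_cong) (use assms in \<open>auto simp: sroot_def\<close>)
  moreover have "euler C (\<lambda>x. 0) y = 0" using euler_lin_l[of C 0 y 0 y y] by simp
  moreover have "(\<Sum>j\<in>set C. sroot a j * bil j a) = 0" by (rule sum.neutral) (use assms in \<open>auto simp: sroot_def\<close>)
  ultimately show ?thesis by (simp add: sroot_def)
qed

lemma euler_front_r: assumes "wd (a # C)" "supp (set (a # C)) y" shows "euler (a # C) y (sroot a) = - reflect a y a"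
proof -
  have "euler C y (sroot a) = euler C y (\<lambda>x. 0)" by (rule euler_cong) (use assms in \<open>auto simp: sroot_def\<close>)
  moreover have "euler C y (\<lambda>x. 0) = 0" using euler_lin_r[of C y 0 y 0 y] by simp
  moreover have "(\<Sum>j\<in>set C. y j * bil j a) = (\<Sum>j\<in>set C. y j * bil a j)"
    by (rule sum.cong) (use assms in \<open>auto simp: bil_sym subset_iff\<close>)
  ultimately show ?thesis using form_split[OF assms] by (simp add: sroot_def reflect_def)
qed

lemma euler_back: assumes "wd (a # C)" "supp (set (a # C)) y" shows "euler (C @ [a]) (sroot a) y = - reflect a y a"
proof -
  have "euler C (sroot a) y = euler C (\<lambda>x. 0) y" by (rule euler_cong) (use assms in \<open>auto simp: sroot_def\<close>)
  moreover have "euler C (\<lambda>x. 0) y = 0" using euler_lin_l[of C 0 y 0 y y] by simp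
  ultimately show ?thesis using form_split[OF assms] assms by (simp add: euler_snoc sroot_def reflect_def mult.commute)
qed

lemma euler_back_r: assumes "wd (a # C)" shows "euler (C @ [a]) y (sroot a) = y a"
proof -
  have "euler C y (sroot a) = euler C y (\<lambda>x. 0)" by (rule euler_cong) (use assms in \<open>auto simp: sroot_def\<close>)
  moreover have "euler C y (\<lambda>x. 0) = 0" using euler_lin_r[of C y 0 y 0 y] by simp
  moreover have "(\<Sum>j\<in>set C. bil a j * sroot a j) = 0" by (rule sum.neutral) (use assms in \<open>auto simp: sroot_def\<close>)
  ultimately show ?thesis using assms by (simp add: euler_snoc sroot_def)
qed

lemma euler_zero: "y a = 0 \<Longrightarrow> euler (a # C) x y = euler C x y"
  by simp

declare euler.simps(2) [simp del]

text \<open>\<open>run C x w B\<close>: reading the word \<open>C\<close> cyclically, where a letter is used if it is a left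
  descent of what remains of \<open>x\<close> and is deleted otherwise, spells \<open>w\<close>, and \<open>B\<close> lists the roots
  of the deleted letters, transported back to the start.\<close>
inductive run :: "'a list \<Rightarrow> 'a \<Rightarrow> 'a \<Rightarrow> ('a \<Rightarrow> real) list \<Rightarrow> bool" where
  nil: "run [] x \<one> []"
| use: "sroot a \<in> Inv x \<Longrightarrow> run (C @ [a]) (a \<otimes> x) w B \<Longrightarrow> run (a # C) x (a \<otimes> w) (map (reflect a) B)"
| skip: "sroot a \<notin> Inv x \<Longrightarrow> run C x w B \<Longrightarrow> run (a # C) x w (sroot a # B)"

section \<open>Runs and the cones they determine\<close>

inductive_cases run_NilE: "run [] x w B"
inductive_cases run_ConsE: "run (a # C) x w B"

text \<open>The clause on \<open>B\<close> places the chamber of \<open>x\<close> on the nonnegative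
  side of every skipped root; \<open>run_fibre\<close> supplies the converse. The support statements
  hold because a skipped letter never returns.\<close>

lemma run_facts: "run C x w B \<Longrightarrow> x \<in> carrier G \<Longrightarrow> wd C \<Longrightarrow>
   w \<in> carrier G \<and> wle w x \<and> (\<forall>r\<in>Inv w. supp (set C) r) \<and>
   (\<forall>b\<in>set B. is_root b \<and> supp (set C) b \<and> nonneg (act (inv x) b))"
proof (induction rule: run.induct)
  case (nil x)
  then show ?case by (simp add: wle_def)
next
  case (use a x C w B)
  have a: "a \<in> S" using use by simp
  have ax: "a \<otimes> x \<in> carrier G" using use S_closed by simp
  have IH: "w \<in> carrier G" "wle w (a \<otimes> x)" "\<forall>r\<in>Inv w. supp (set (a # C)) r"
    "\<forall>b\<in>set B. is_root b \<and> supp (set (a # C)) b \<and> nonneg (act (inv (a \<otimes> x)) b)"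
    using use.IH use.prems a ax by auto
  have nax: "sroot a \<notin> Inv (a \<otimes> x)" using Inv_left_sroot use a by blast
  then have nw: "sroot a \<notin> Inv w" using IH by (auto simp: wle_def)
  have "Inv (a \<otimes> w) \<subseteq> Inv x"
    using Inv_sub_left[of w "a \<otimes> x" a] IH nax nw a ax use.prems by (auto simp: wle_def)
  then have 1: "wle (a \<otimes> w) x" using IH use.prems a S_closed by (simp add: wle_def)
  have 2: "supp (set (a # C)) r" if r: "r \<in> Inv (a \<otimes> w)" for r
  proof (cases "r = sroot a")
    case False
    then have "reflect a r \<in> Inv w" using Inv_left[OF IH(1) a Inv_pos[OF r]] r by blast
    then have "supp (set (a # C)) (reflect a (reflect a r))" using IH(3) supp_reflect[of "set (a # C)" "reflect a r" a] by simp
    then show ?thesis using reflect_reflect a by simp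
  qed (simp add: supp_sroot)
  have 3: "is_root (reflect a b) \<and> supp (set (a # C)) (reflect a b) \<and> nonneg (act (inv x) (reflect a b))" if "b \<in> set B" for b
    using IH(4) that root_act[of a b] supp_reflect[of "set (a # C)" b a] use.prems a
    by (simp add: act_S S_closed S_inv inv_mult_group act_right)
  show ?case using 1 2 3 IH a S_closed by auto
next
  case (skip a x C w B)
  then have IH: "w \<in> carrier G" "wle w x" "\<forall>r\<in>Inv w. supp (set C) r"
    "\<forall>b\<in>set B. is_root b \<and> supp (set C) b \<and> nonneg (act (inv x) b)" by auto
  have "supp (set (a # C)) r" if "supp (set C) r" for r using that by (auto simp: supp_def)
  moreover have "nonneg (act (inv x) (sroot a))" using skip pos_sroot by (simp add: Inv_def)
  ultimately show ?case using IH skip.prems root_sroot supp_sroot by auto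
qed

lemmas run_closed = run_facts[THEN conjunct1]
lemmas run_le = run_facts[THEN conjunct2, THEN conjunct1]

lemma run_supp: "run C x w B \<Longrightarrow> x \<in> carrier G \<Longrightarrow> wd C \<Longrightarrow> r \<in> Inv w \<Longrightarrow> supp (set C) r"
  using run_facts by blast

lemma run_base: "run C x w B \<Longrightarrow> x \<in> carrier G \<Longrightarrow> wd C \<Longrightarrow> b \<in> set B \<Longrightarrow>
   is_root b \<and> supp (set C) b \<and> nonneg (act (inv x) b)"
  using run_facts by blast

text \<open>Using a letter shortens \<open>x\<close> and keeps the number of letters; skipping
  shortens the word and keeps \<open>x\<close>.\<close>

lemma run_total: "x \<in> carrier G \<Longrightarrow> wd C \<Longrightarrow> \<exists>w B. run C x w B"
proof (induction "len x + length C" arbitrary: x C rule: less_induct)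
  case less
  show ?case
  proof (cases C)
    case Nil
    then show ?thesis using run.nil by blast
  next
    case (Cons a C')
    have a: "a \<in> S" using less Cons by simp
    show ?thesis
    proof (cases "sroot a \<in> Inv x")
      case True
      then have "len x = Suc (len (a \<otimes> x))" using len_left_Suc less.prems a by simp
      then obtain w B where "run (C' @ [a]) (a \<otimes> x) w B"
        using less.hyps[of "a \<otimes> x" "C' @ [a]"] less.prems Cons a S_closed by auto
      then show ?thesis using run.use True Cons by blast
    next
      case False
      then show ?thesis using less.hyps[of x C'] less.prems Cons run.skip by fastforce
    qed
  qed
qed

lemma run_det: "run C x w B \<Longrightarrow> run C x w' B' \<Longrightarrow> w = w' \<and> B = B'"
proof (induction arbitrary: w' B' rule: run.induct)
  case (nil x)
  then show ?case by (auto elim: run_NilE)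
next
  case (use a x C w B)
  from use.prems use.hyps show ?case by (auto elim!: run_ConsE dest: use.IH)
next
  case (skip a x C w B)
  from skip.prems skip.hyps show ?case by (auto elim!: run_ConsE dest: skip.IH)
qed

text \<open>The output makes the same choices when it is read itself: a used letter is still a left
  descent of it, and a skipped one lies outside its support.\<close>

lemma run_self: "run C x w B \<Longrightarrow> x \<in> carrier G \<Longrightarrow> wd C \<Longrightarrow> run C w w B"
proof (induction rule: run.induct)
  case (nil x)
  show ?case by (rule run.nil)
next
  case (use a x C w B)
  have a: "a \<in> S" "a \<otimes> x \<in> carrier G" using use S_closed by auto
  have w: "w \<in> carrier G" "wle w (a \<otimes> x)" using run_closed[OF use.hyps(2)] run_le[OF use.hyps(2)] a use.prems by auto
  have "sroot a \<notin> Inv (a \<otimes> x)" using Inv_left_sroot use a by blast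
  then have "sroot a \<notin> Inv w" using w by (auto simp: wle_def)
  then have "sroot a \<in> Inv (a \<otimes> w)" using Inv_left_sroot w a by blast
  moreover have "run (C @ [a]) (a \<otimes> (a \<otimes> w)) w B" using use a w by simp
  ultimately show ?case by (rule run.use)
next
  case (skip a x C w B)
  then have "\<forall>r\<in>Inv w. r a = 0" using run_supp[OF skip.hyps(2)] by (auto simp: supp_def)
  then have "sroot a \<notin> Inv w" by (auto simp: sroot_def)
  then show ?case using skip run.skip by auto
qed

text \<open>A vector \<open>v\<close> satisfying these conditions is a nonnegative combination of \<open>B\<close>; the
  conclusion only records what this means for the signs of images.\<close>
lemma run_cone: "run C x w B \<Longrightarrow> x \<in> carrier G \<Longrightarrow> wd C \<Longrightarrow> nonneg v \<Longrightarrow> supp (set C) v \<Longrightarrow>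
   (\<And>z. z \<in> Inv w \<Longrightarrow> euler C v z \<le> 0) \<Longrightarrow> y \<in> carrier G \<Longrightarrow>
   (\<And>b. b \<in> set B \<Longrightarrow> nonneg (act (inv y) b)) \<Longrightarrow> nonneg (act (inv y) v)"
proof (induction arbitrary: v y rule: run.induct)
  case (nil x)
  then have "v = (\<lambda>x. 0)" by (auto simp: supp_def)
  then show ?case using act_scale[of "inv y" 0 v] nil by (simp add: nonneg_def)
next
  case (use a x C w B)
  have a: "a \<in> S" "a \<otimes> x \<in> carrier G" using use S_closed by auto
  have w: "w \<in> carrier G" "wle w (a \<otimes> x)" using run_closed[OF use.hyps(2)] run_le[OF use.hyps(2)] a use.prems by auto
  have "sroot a \<notin> Inv (a \<otimes> x)" using Inv_left_sroot use a by blast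
  then have nw: "sroot a \<notin> Inv w" using w by (auto simp: wle_def)
  have wdr: "wd (C @ [a])" using use by auto
  have "sroot a \<in> Inv (a \<otimes> w)" using Inv_left_sroot w a nw by blast
  \<comment> \<open>\<open>sroot a\<close> is an inversion of the output. This instance of the
    hypothesis is what keeps the reflected vector nonnegative.\<close>
  then have "euler (a # C) v (sroot a) \<le> 0" using use by blast
  then have "reflect a v a \<ge> 0" using euler_front_r use.prems by fastforce
  then have nnv: "nonneg (reflect a v)" using use.prems reflect_other unfolding nonneg_def by metis
  have spv: "supp (set (C @ [a])) (reflect a v)" using supp_reflect[OF use.prems(4)] by simp
  have E: "euler (C @ [a]) (reflect a v) z \<le> 0" if z: "z \<in> Inv w" for z
  proof -
    have "z \<noteq> sroot a" using z nw by auto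
    then have "reflect a z \<in> Inv (a \<otimes> w)" using Inv_left'[OF w(1) a(1) Inv_pos[OF z]] z by simp
    then have "euler (a # C) v (reflect a z) \<le> 0" using use by blast
    moreover have "supp (set (C @ [a])) z" using run_supp[OF use.hyps(2) a(2) wdr z] .
    then have "supp (set (a # C)) (reflect a z)" using supp_reflect[of "set (a # C)" z a] by simp
    ultimately show ?thesis using euler_rot[OF use.prems(2,4), of "reflect a z"] reflect_reflect a by simp
  qed
  have base: "nonneg (act (inv (a \<otimes> y)) b)" if "b \<in> set B" for b
    using use.prems(7)[of "reflect a b"] that use.prems(6) a by (simp add: S_closed S_inv inv_mult_group act_right)
  have "nonneg (act (inv (a \<otimes> y)) (reflect a v))"
    by (rule use.IH[OF a(2) wdr nnv spv E _ base]) (use a use.prems S_closed in auto)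
  then show ?case using use.prems a by (simp add: S_closed S_inv inv_mult_group act_right reflect_reflect)
next
  case (skip a x C w B)
  \<comment> \<open>The part of \<open>v\<close> that the later letters can account for; the
    coordinate at \<open>a\<close> is supplied by the skipped root \<open>sroot a\<close>
    itself.\<close>
  define v' where "v' = (\<lambda>i. 1 * v i + (- v a) * sroot a i)"
  have "a \<notin> set C" using skip by simp
  have v': "v' i = (if i = a then 0 else v i)" for i by (simp add: v'_def sroot_def)
  have IH: "nonneg (act (inv y) v')"
  proof (rule skip.IH)
    show "nonneg v'" "supp (set C) v'" using skip.prems v' by (auto simp: nonneg_def supp_def)
    fix z assume z: "z \<in> Inv w"
    have "z a = 0" using run_supp[OF skip.hyps(2) _ _ z] skip.prems by (simp add: supp_def)
    then have "euler C v z \<le> 0" using skip.prems(5)[OF z] by (simp add: euler_zero)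
    moreover have "euler C v z = euler C v' z" by (rule euler_cong) (use \<open>a \<notin> set C\<close> v' in auto)
    ultimately show "euler C v' z \<le> 0" by simp
  qed (use skip in auto)
  have e: "v = (\<lambda>i. 1 * v' i + v a * sroot a i)" by (auto simp: v'_def)
  have "nonneg (act (inv y) (\<lambda>i. 1 * v' i + v a * sroot a i))"
    unfolding act_lin[OF inv_closed[OF skip.prems(6)]]
    by (rule nonneg_comb) (use IH skip.prems in \<open>auto simp: nonneg_def\<close>)
  then show ?case using e by simp
qed

text \<open>For the last letter, the Euler pairing of \<open>sroot a\<close> with an inversion is
  minus a reflected coordinate, and this is not positive because \<open>sroot a\<close> is no
  inversion. So \<open>run_cone\<close> applies to \<open>sroot a\<close>.\<close>

lemma run_back: assumes "run (C @ [a]) x w B" "x \<in> carrier G" "wd (a # C)" "sroot a \<notin> Inv w" "y \<in> carrier G"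
  "\<And>b. b \<in> set B \<Longrightarrow> nonneg (act (inv y) b)"
  shows "nonneg (act (inv y) (sroot a))"
proof (rule run_cone[OF assms(1,2) _ _ _ _ assms(5,6)])
  show "wd (C @ [a])" "nonneg (sroot a)" "supp (set (C @ [a])) (sroot a)" using assms by (auto simp: nonneg_sroot supp_sroot)
  fix z assume z: "z \<in> Inv w"
  have zs: "supp (set (a # C)) z" using run_supp[OF assms(1,2) _ z] assms by auto
  have "z \<noteq> sroot a" using z assms by auto
  then have "nonneg (reflect a z)" using pos_reflect[OF Inv_pos[OF z]] assms by (simp add: pos_def)
  then show "euler (C @ [a]) (sroot a) z \<le> 0" using euler_back[OF assms(3) zs] by (simp add: nonneg_def)
qed

text \<open>The cone bounded by \<open>B\<close> lies in one fibre of the projection: its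
  inequalities settle each skipped letter directly, and \<open>run_back\<close> settles each used
  one.\<close>

lemma run_fibre: "run C x w B \<Longrightarrow> x \<in> carrier G \<Longrightarrow> wd C \<Longrightarrow> y \<in> carrier G \<Longrightarrow>
   (\<And>b. b \<in> set B \<Longrightarrow> nonneg (act (inv y) b)) \<Longrightarrow> run C y w B"
proof (induction arbitrary: y rule: run.induct)
  case (nil x)
  show ?case by (rule run.nil)
next
  case (use a x C w B)
  have a: "a \<in> S" "a \<otimes> x \<in> carrier G" "a \<otimes> y \<in> carrier G" using use S_closed by auto
  have w: "w \<in> carrier G" "wle w (a \<otimes> x)" using run_closed[OF use.hyps(2)] run_le[OF use.hyps(2)] a use.prems by auto
  have "sroot a \<notin> Inv (a \<otimes> x)" using Inv_left_sroot use a by blast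
  then have nw: "sroot a \<notin> Inv w" using w by (auto simp: wle_def)
  have base: "nonneg (act (inv (a \<otimes> y)) b)" if "b \<in> set B" for b
    using use.prems(4)[of "reflect a b"] that use.prems(3) a by (simp add: S_closed S_inv inv_mult_group act_right)
  have "nonneg (act (inv (a \<otimes> y)) (sroot a))"
    by (rule run_back[OF use.hyps(2) a(2) _ nw a(3) base]) (use use in auto)
  then have "sroot a \<notin> Inv (a \<otimes> y)" by (simp add: Inv_def)
  then have "sroot a \<in> Inv y" using Inv_left_sroot use.prems a by blast
  moreover have "run (C @ [a]) (a \<otimes> y) w B"
    by (rule use.IH) (use a base use.prems in auto)
  ultimately show ?case by (rule run.use)
next
  case (skip a x C w B)
  then have "sroot a \<notin> Inv y" by (simp add: Inv_def)
  moreover have "run C y w B" using skip by simp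
  ultimately show ?case by (rule run.skip)
qed

lemma nonneg_reflect: assumes "is_root r" "nonneg r" "s \<in> S" "r \<noteq> sroot s" shows "nonneg (reflect s r)"
  using pos_reflect[of r s] assms by (simp add: pos_def)

lemma act_inv_right: "w \<in> carrier G \<Longrightarrow> s \<in> S \<Longrightarrow> act (inv (w \<otimes> s)) v = reflect s (act (inv w) v)"
  by (simp add: S_closed S_inv inv_mult_group act_mult act_S)

text \<open>If this root were not a wall, crossing it would stay in the cone, so
  \<open>w \<otimes> s\<close> would project to \<open>w\<close> and lie above it.\<close>

lemma run_cover: assumes "run C w w B" "w \<in> carrier G" "wd C" "s \<in> Des w"
  shows "act w (sroot s) \<in> set B"
proof (rule ccontr)
  assume n: "act w (sroot s) \<notin> set B"
  have s: "s \<in> S" using assms D_S by simp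
  have "run C (w \<otimes> s) w B"
  proof (rule run_fibre[OF assms(1-3)])
    fix b assume b: "b \<in> set B"
    then have bb: "is_root b" "nonneg (act (inv w) b)" using run_base[OF assms(1-3)] by auto
    have "act (inv w) b \<noteq> sroot s" using n b act_inv_cancel[OF assms(2)] by metis
    then show "nonneg (act (inv (w \<otimes> s)) b)"
      using nonneg_reflect[of "act (inv w) b" s] bb root_act assms s by (simp add: act_inv_right)
  qed (use assms s S_closed in auto)
  then have "wle w (w \<otimes> s)" using run_le assms s S_closed by simp
  then have "croot w s \<in> Inv (w \<otimes> s)" using croot_Inv assms by (auto simp: wle_def)
  then show False using Inv_right assms by simp
qed

text \<open>At the moment of skipping, \<open>a\<close> is initial, so its pairing with a later root
  is the coordinate there at \<open>a\<close>, which is 0 once the letter is deleted. Rotation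
  preserves the pairings.\<close>

lemma run_tri: "run C x w B \<Longrightarrow> x \<in> carrier G \<Longrightarrow> wd C \<Longrightarrow> sorted_wrt (\<lambda>b b'. euler C b b' = 0) B"
proof (induction rule: run.induct)
  case (nil x)
  show ?case by simp
next
  case (use a x C w B)
  have a: "a \<in> S" "a \<otimes> x \<in> carrier G" "wd (C @ [a])" using use S_closed by auto
  have supp: "supp (set (a # C)) b" if "b \<in> set B" for b using run_base[OF use.hyps(2) a(2,3) that] by simp
  have s: "sorted_wrt (\<lambda>b b'. euler (C @ [a]) b b' = 0) B" using use.IH a by blast
  have e: "euler (a # C) (reflect a b) (reflect a b') = 0" if "b \<in> set B" "b' \<in> set B" "euler (C @ [a]) b b' = 0" for b b'
    using euler_rot[OF use.prems(2), of "reflect a b" "reflect a b'"] supp_reflect[OF supp] that a(1) by (simp add: reflect_reflect)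
  show ?case unfolding sorted_wrt_map by (rule sorted_wrt_mono_rel[OF _ s]) (rule e)
next
  case (skip a x C w B)
  have z: "b a = 0" if "b \<in> set B" for b
    using run_base[OF skip.hyps(2) _ _ that] skip.prems by (simp add: supp_def)
  have s: "sorted_wrt (\<lambda>b b'. euler C b b' = 0) B" using skip by auto
  have "sorted_wrt (\<lambda>b b'. euler (a # C) b b' = 0) B"
    by (rule sorted_wrt_mono_rel[OF _ s]) (simp add: z euler_zero)
  moreover have "\<forall>b\<in>set B. euler (a # C) (sroot a) b = 0" unfolding euler_front[OF skip.prems(2)] using z by blast
  ultimately show ?case by simp
qed

section \<open>Sortable elements and their cover roots\<close>

definition sortable :: "'a list \<Rightarrow> 'a \<Rightarrow> bool" where "sortable C w \<longleftrightarrow> w \<in> carrier G \<and> (\<exists>B. run C w w B)"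

lemma run_sortable: "run C x w B \<Longrightarrow> x \<in> carrier G \<Longrightarrow> wd C \<Longrightarrow> sortable C w"
  unfolding sortable_def using run_self run_closed by blast

lemma sortable_supp: "sortable C w \<Longrightarrow> wd C \<Longrightarrow> r \<in> Inv w \<Longrightarrow> supp (set C) r"
  unfolding sortable_def using run_supp by blast

text \<open>With \<open>sortable_skip\<close> this is the recursive characterisation of sortable
  elements, on initial letters, that drives the later inductions.\<close>

lemma sortable_use: assumes "sroot a \<in> Inv w" "wd (a # C)" "w \<in> carrier G"
  shows "sortable (a # C) w \<longleftrightarrow> sortable (C @ [a]) (a \<otimes> w)"
proof
  assume "sortable (a # C) w"
  then obtain B where "run (a # C) w w B" unfolding sortable_def by blast
  then obtain w' B' where w': "w = a \<otimes> w'" "run (C @ [a]) (a \<otimes> w) w' B'" using assms by (auto elim: run_ConsE)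
  have "w' \<in> carrier G" using run_closed[OF w'(2)] assms S_closed by auto
  then show "sortable (C @ [a]) (a \<otimes> w)" using w' run_sortable[OF w'(2)] assms S_closed by auto
next
  assume "sortable (C @ [a]) (a \<otimes> w)"
  then show "sortable (a # C) w" unfolding sortable_def using run.use[OF assms(1), of C "a \<otimes> w"] assms by fastforce
qed

lemma sortable_skip: assumes "sroot a \<notin> Inv w" "wd (a # C)" shows "sortable (a # C) w \<longleftrightarrow> sortable C w"
  unfolding sortable_def using assms by (auto elim: run_ConsE intro: run.skip)

lemma sortable_Nil: "sortable [] w \<longleftrightarrow> w = \<one>"
  unfolding sortable_def by (auto elim: run_NilE intro: run.nil)

lemma croot_swap: "croot w s = v \<Longrightarrow> act w (sroot s) = (\<lambda>x. - v x)"
  by (auto simp: croot_def)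

lemma form_croot: assumes "w \<in> carrier G" "s \<in> Des w" "t \<in> Des w"
  shows "form (croot w s) (croot w t) = bil s t"
  using assms D_S by (simp add: croot_def form_neg_l form_neg_r act_form form_sroot_sroot)

lemma croot_inj: assumes "w \<in> carrier G" "s \<in> Des w" "t \<in> Des w" "croot w s = croot w t" shows "s = t"
proof -
  have "act w (sroot s) = act w (sroot t)" using croot_swap[OF assms(4)] by (simp add: croot_def)
  then have "sroot s = sroot t" using act_inv_cancel[OF assms(1)] by metis
  then show ?thesis by (metis sroot_def zero_neq_one)
qed

text \<open>Cover roots are among the skipped roots, and so is \<open>sroot a\<close>, read in the rotated word.
  Triangularity then kills the coordinate at \<open>a\<close> of the others, up to reflection.\<close>
lemma cover_coord: assumes "sortable (a # C) w" "wd (a # C)" "s \<in> Des w" "croot w s = sroot a" "t \<in> Des w" "t \<noteq> s"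
  shows "croot w t a = 0"
proof -
  obtain B where run: "run (a # C) w w B" and w: "w \<in> carrier G" using assms by (auto simp: sortable_def)
  have "sroot a \<in> Inv w" using croot_Inv[OF w assms(3)] assms by simp
  then obtain w' B' where w': "B = map (reflect a) B'" "run (C @ [a]) (a \<otimes> w) w' B'"
    using run by (auto elim: run_ConsE)
  have a: "a \<in> S" "a \<otimes> w \<in> carrier G" "wd (C @ [a])" using assms w S_closed by auto
  have tri: "sorted_wrt (\<lambda>b b'. euler (C @ [a]) b b' = 0) B'" using run_tri[OF w'(2)] a by simp
  have in1: "reflect a (act w (sroot u)) \<in> set B'" if "u \<in> Des w" for u
    using run_cover[OF run w assms(2) that] a(1) reflect_reflect unfolding w'(1) by auto
  have "act w (sroot s) = (\<lambda>x. - sroot a x)" using croot_swap[OF assms(4)] .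
  then have "reflect a (act w (sroot s)) = sroot a" using act_neg[of a "sroot a"] a reflect_sroot by (simp add: act_S S_closed)
  then have sa: "sroot a \<in> set B'" using in1[OF assms(3)] by simp
  define d where "d = reflect a (act w (sroot t))"
  have d: "d \<in> set B'" using in1 assms d_def by simp
  have nd: "reflect a d = (\<lambda>x. - croot w t x)" using a reflect_reflect by (simp add: d_def croot_def)
  have p: "pos (croot w t)" using croot_pos w assms by simp
  have ne: "croot w t \<noteq> sroot a" using croot_inj[OF w assms(3,5)] assms by metis
  have rp: "pos (reflect a (croot w t))" using pos_reflect[OF p a(1) ne] .
  have dn: "d = (\<lambda>x. - reflect a (croot w t) x)"
    using a act_neg[of a "croot w t"] nd reflect_reflect[OF a(1), of d] by (simp add: act_S S_closed)
  have dsa: "d \<noteq> sroot a" using rp dn pos_neg[of "sroot a"] pos_sroot[OF a(1)] root_sroot[OF a(1)]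
    by (metis (no_types, lifting) ext minus_minus pos_def)
  have dsp: "supp (set (a # C)) d" using run_base[OF w'(2) a(2,3) d] by simp
  \<comment> \<open>The order of the two roots in the list is not known, so triangularity yields
    only one of the two pairings.\<close>
  have "euler (C @ [a]) d (sroot a) = 0 \<or> euler (C @ [a]) (sroot a) d = 0"
  proof -
    obtain i j where ij: "i < length B'" "j < length B'" "B' ! i = d" "B' ! j = sroot a"
      using d sa by (metis in_set_conv_nth)
    then have "i \<noteq> j" using dsa by auto
    then consider "i < j" | "j < i" by linarith
    then show ?thesis
      using sorted_wrt_nth_less[OF tri, of i j] sorted_wrt_nth_less[OF tri, of j i] ij by cases simp_all
  qed
  then show ?thesis
  proof
    \<comment> \<open>In this order the coordinate of the cover root equals
      \<open>2 * bil s t\<close>, which is not positive, while a positive root has no negative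
      coordinate.\<close>
    assume "euler (C @ [a]) d (sroot a) = 0"
    then have "d a = 0" using euler_back_r[OF assms(2)] by simp
    then have "croot w t a = - (2 * form (sroot a) d * - 1)"
      using fun_cong[OF nd, of a] by (simp add: reflect_self)
    moreover have "form (sroot a) d = - form (sroot a) (reflect a (croot w t))" unfolding dn form_neg_r ..
    moreover have "\<dots> = form (sroot a) (croot w t)" using form_reflect_sroot[OF a(1)] by simp
    moreover have "form (sroot a) (croot w t) = bil s t" using form_croot[OF w assms(3,5)] assms(4) by simp
    moreover have "bil s t \<le> 0" using bil_nonpos assms D_S by metis
    moreover have "croot w t a \<ge> 0" using p by (simp add: pos_def nonneg_def)
    ultimately show ?thesis by linarith
  next
    assume "euler (C @ [a]) (sroot a) d = 0"
    then have "reflect a d a = 0" using euler_back[OF assms(2) dsp] by simp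
    then show ?thesis using fun_cong[OF nd, of a] by simp
  qed
qed

text \<open>Peeling left descents writes \<open>w\<close> as a product of simple reflections;
  orthogonality to the inversions says that each of them fixes \<open>v\<close>.\<close>

lemma act_fix: "w \<in> carrier G \<Longrightarrow> (\<And>z. z \<in> Inv w \<Longrightarrow> form z v = 0) \<Longrightarrow> act (inv w) v = v"
proof (induction "len w" arbitrary: w)
  case 0
  then have "w = \<one>" using len_0 by simp
  then show ?case by simp
next
  case (Suc n)
  then obtain a where a: "a \<in> S" "sroot a \<in> Inv w" using left_des_ex[of w] by fastforce
  have fa: "reflect a v = v" using Suc.prems(2)[OF a(2)] by (simp add: reflect_def)
  have aw: "a \<otimes> w \<in> carrier G" using a Suc.prems S_closed by simp
  have "act (inv (a \<otimes> w)) v = v"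
  proof (rule Suc.hyps(1)[OF _ aw])
    show "n = len (a \<otimes> w)" using len_left_Suc Suc a by auto
    fix z assume z: "z \<in> Inv (a \<otimes> w)"
    have "z \<noteq> sroot a" using z Inv_left_sroot Suc.prems a by blast
    then have "reflect a z \<in> Inv w" using Inv_left[OF Suc.prems(1) a(1) Inv_pos[OF z]] z by blast
    then have "form (reflect a z) (reflect a v) = 0" using Suc.prems fa by simp
    then show "form z v = 0" using reflect_form a by simp
  qed
  then show ?case using fa Suc.prems a by (simp add: S_closed S_inv inv_mult_group act_right)
qed

text \<open>A criterion for a skipped root to be an upper wall of \<open>w\<close>. When the letter
  of \<open>b\<close> is skipped, the inversions still to come have coordinate 0 there, hence pair
  nonpositively with \<open>b\<close>; the hypothesis forces orthogonality, and
  \<open>act_fix\<close> applies.\<close>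

lemma run_simple: "run C x w B \<Longrightarrow> x \<in> carrier G \<Longrightarrow> wd C \<Longrightarrow> b \<in> set B \<Longrightarrow>
   (\<And>z. z \<in> Inv w \<Longrightarrow> euler C b z = 0 \<Longrightarrow> form b z \<ge> 0) \<Longrightarrow> \<exists>s\<in>S. act (inv w) b = sroot s"
proof (induction arbitrary: b rule: run.induct)
  case (nil x)
  then show ?case by simp
next
  case (use a x C w B)
  have a: "a \<in> S" "a \<otimes> x \<in> carrier G" "wd (C @ [a])" using use S_closed by auto
  have w: "w \<in> carrier G" "wle w (a \<otimes> x)" using run_closed[OF use.hyps(2)] run_le[OF use.hyps(2)] a by auto
  have "sroot a \<notin> Inv (a \<otimes> x)" using Inv_left_sroot use a by blast
  then have nw: "sroot a \<notin> Inv w" using w by (auto simp: wle_def)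
  obtain b' where b': "b' \<in> set B" "b = reflect a b'" using use.prems by auto
  have bs: "supp (set (a # C)) b'" using run_base[OF use.hyps(2) a(2,3) b'(1)] by simp
  have "\<exists>s\<in>S. act (inv w) b' = sroot s"
  proof (rule use.IH[OF a(2,3) b'(1)])
    fix z assume z: "z \<in> Inv w" "euler (C @ [a]) b' z = 0"
    have "z \<noteq> sroot a" using z nw by auto
    then have 1: "reflect a z \<in> Inv (a \<otimes> w)" using Inv_left'[OF w(1) a(1) Inv_pos[OF z(1)]] z by simp
    have "supp (set (a # C)) z" using run_supp[OF use.hyps(2) a(2,3) z(1)] by simp
    then have "euler (a # C) b (reflect a z) = 0"
      using euler_rot[OF use.prems(2) supp_reflect[OF bs] supp_reflect, of a z a] z b' a by (simp add: reflect_reflect)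
    then have "form b (reflect a z) \<ge> 0" using use.prems(4) 1 by blast
    then show "form b' z \<ge> 0" using b' reflect_form a by simp
  qed
  then show ?case using b' w a by (simp add: S_closed S_inv inv_mult_group act_right reflect_reflect)
next
  case (skip a x C w B)
  have a: "a \<in> S" using skip by simp
  have za: "z a = 0" if "z \<in> Inv w" for z
    using run_supp[OF skip.hyps(2) _ _ that] skip.prems by (simp add: supp_def)
  have w: "w \<in> carrier G" using run_closed[OF skip.hyps(2)] skip.prems by simp
  show ?case
  proof (cases "b = sroot a")
    case True
    have "form z (sroot a) = 0" if z: "z \<in> Inv w" for z
    proof -
      have "form (sroot a) z \<le> 0" using form_nonpos[OF a] za[OF z] Inv_pos[OF z] by (simp add: pos_def)
      moreover have "form (sroot a) z \<ge> 0" using skip.prems(4)[OF z] True euler_front[OF skip.prems(2)] za[OF z] by simp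
      ultimately show ?thesis using form_sym[of z] by simp
    qed
    then show ?thesis using act_fix[OF w] True a by blast
  next
    case False
    then have "b \<in> set B" using skip.prems by simp
    then show ?thesis using skip.IH[of b] skip.prems za by (simp add: euler_zero)
  qed
qed

text \<open>Euler orthogonality to the last letter makes the reflected coordinate vanish, so twice
  the pairing with \<open>sroot a\<close> is the coordinate at \<open>a\<close>, which is
  nonnegative.\<close>

lemma run_simple_back: assumes "run (C @ [a]) x w B" "x \<in> carrier G" "wd (a # C)" "sroot a \<in> set B" "sroot a \<notin> Inv w"
  shows "\<exists>s\<in>S. act (inv w) (sroot a) = sroot s"
proof (rule run_simple[OF assms(1,2) _ assms(4)])
  show "wd (C @ [a])" using assms by auto
  fix z assume z: "z \<in> Inv w" "euler (C @ [a]) (sroot a) z = 0"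
  have "supp (set (a # C)) z" using run_supp[OF assms(1,2) _ z(1)] assms by auto
  then have "reflect a z a = 0" using euler_back[OF assms(3)] z by simp
  moreover have "z a \<ge> 0" using Inv_pos[OF z(1)] by (simp add: pos_def nonneg_def)
  ultimately show "form (sroot a) z \<ge> 0" by (simp add: reflect_self)
qed

text \<open>A letter outside the support is skipped whenever it comes up, so its place in the word
  is immaterial.\<close>

lemma sortable_insert: "wd (C1 @ [a] @ C2) \<Longrightarrow> u \<in> carrier G \<Longrightarrow> (\<And>r. r \<in> Inv u \<Longrightarrow> r a = 0) \<Longrightarrow>
   sortable (C1 @ [a] @ C2) u \<longleftrightarrow> sortable (C1 @ C2) u"
proof (induction "len u + length C1" arbitrary: u C1 C2 rule: less_induct)
  case less
  show ?case
  proof (cases C1)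
    case Nil
    have "sroot a \<notin> Inv u" using less.prems(3)[of "sroot a"] by (auto simp: sroot_def)
    then show ?thesis using Nil sortable_skip[of a u C2] less.prems by simp
  next
    case (Cons b C)
    have b: "b \<in> S" "b \<noteq> a" using Cons less.prems by auto
    show ?thesis
    proof (cases "sroot b \<in> Inv u")
      case True
      have l: "len u = Suc (len (b \<otimes> u))" using len_left_Suc True b less.prems by simp
      have z: "r a = 0" if r: "r \<in> Inv (b \<otimes> u)" for r
      proof (cases "r = sroot b")
        case False
        then have "reflect b r \<in> Inv u" using Inv_left[OF less.prems(2) b(1) Inv_pos[OF r]] r by blast
        then show ?thesis using less.prems(3) b reflect_other[of a b r] by fastforce
      qed (use b in \<open>auto simp: sroot_def\<close>)
      have "sortable (C @ [a] @ (C2 @ [b])) (b \<otimes> u) \<longleftrightarrow> sortable (C @ (C2 @ [b])) (b \<otimes> u)"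
        by (rule less.hyps) (use l z Cons less.prems b S_closed in auto)
      then show ?thesis using Cons sortable_use[of b u "C @ [a] @ C2"] sortable_use[of b u "C @ C2"] True less.prems by simp
    next
      case False
      have "sortable (C @ [a] @ C2) u \<longleftrightarrow> sortable (C @ C2) u"
        by (rule less.hyps) (use Cons less.prems in auto)
      then show ?thesis using Cons sortable_skip[of b u "C @ [a] @ C2"] sortable_skip[of b u "C @ C2"] False less.prems by simp
    qed
  qed
qed

section \<open>Conjugates of simple reflections and monotonicity of the projection\<close>

lemma act_faithful: assumes "g \<in> carrier G" "h \<in> carrier G" "\<And>v. act g v = act h v" shows "g = h"
proof (rule Inv_inj[OF assms(1,2)])
  have "act (inv g) v = act (inv h) v" for v
    using assms(3)[of "act (inv h) v"] act_inv_cancel[OF assms(1)] act_inv_cancel[OF assms(2)] by metis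
  then show "Inv g = Inv h" by (simp add: Inv_def)
qed

text \<open>The conjugate of \<open>s\<close> by \<open>w\<close> is the reflection in the image
  root, whatever its sign. The factor \<open>e\<close> is \<open>-1\<close> for cover roots and
  \<open>1\<close> for upper walls.\<close>

lemma conj_simple: assumes "w \<in> carrier G" "s \<in> S" "a \<in> S" "act w (sroot s) = (\<lambda>x. e * sroot a x)" "e * e = 1"
  shows "a \<otimes> w = w \<otimes> s"
proof (rule act_faithful)
  fix v
  have f: "form (sroot s) v = e * form (sroot a) (act w v)"
    using act_form[OF assms(1), of "sroot s" v] form_lin_l[of e "sroot a" 0 "sroot a" "act w v"] assms(4) by simp
  have "act (w \<otimes> s) v = act w (reflect s v)" using assms by (simp add: act_right)
  also have "\<dots> = (\<lambda>x. 1 * act w v x + (- 2 * form (sroot s) v) * act w (sroot s) x)"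
    unfolding reflect_alt[of s v] by (rule act_lin[OF assms(1)])
  also have "\<dots> = reflect a (act w v)"
    unfolding reflect_alt[of a] f assms(4) using assms(5) by (auto simp: algebra_simps)
  finally show "act (a \<otimes> w) v = act (w \<otimes> s) v" using assms by (simp add: act_mult S_closed act_S)
qed (use assms S_closed in auto)

lemma wle_up: assumes "z \<in> carrier G" "s \<in> S" "nonneg (act z (sroot s))" shows "wle z (z \<otimes> s)"
proof -
  have "s \<in> Des (z \<otimes> s)" using D_right assms by (simp add: Des_def)
  then have "wle (z \<otimes> s \<otimes> s) (z \<otimes> s)" using wle_right[of "z \<otimes> s" s] assms S_closed by blast
  then show ?thesis using assms by simp
qed

text \<open>By \<open>wlt_des\<close> it is enough to compare \<open>x'\<close> with its coatoms.
  The runs part only if the initial letter is a left descent of \<open>x'\<close> but not of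
  \<open>x' \<otimes> s\<close>; then \<open>a \<otimes> x' = x' \<otimes> s\<close>, and both go on
  from this one element, with words that differ by a final \<open>a\<close>.\<close>

lemma run_mono: "wle x x' \<Longrightarrow> wd C \<Longrightarrow> run C x w B \<Longrightarrow> run C x' w' B' \<Longrightarrow> wle w w'"
proof (induction "len x' + length C" arbitrary: x x' C w B w' B' rule: less_induct)
  case less
  have c: "x \<in> carrier G" "x' \<in> carrier G" using less.prems by (auto simp: wle_def)
  have cover: "wle v w'" if s: "s \<in> Des x'" and v: "run C (x' \<otimes> s) v Bv" for s v Bv
  proof -
    have sS: "s \<in> S" using s D_S by simp
    let ?y = "x' \<otimes> s"
    have yc: "?y \<in> carrier G" and yle: "wle ?y x'" using wle_right c s sS S_closed by auto
    show ?thesis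
    proof (cases C)
      case Nil
      then show ?thesis using v less.prems by (auto elim!: run_NilE simp: wle_def)
    next
      case (Cons a C0)
      have a: "a \<in> S" and wda: "wd (a # C0)" using less.prems Cons by auto
      show ?thesis
      proof (cases "sroot a \<in> Inv x'")
        case False
        then have "sroot a \<notin> Inv ?y" using yle by (auto simp: wle_def)
        with v Cons obtain B1 where 1: "run C0 ?y v B1" by (auto elim: run_ConsE)
        obtain B2 where 2: "run C0 x' w' B2" using less.prems(4) Cons False by (auto elim: run_ConsE)
        show ?thesis by (rule less.hyps[OF _ yle _ 1 2]) (use Cons less.prems in auto)
      next
        case in': True
        have l: "len x' = Suc (len (a \<otimes> x'))" using len_left_Suc c a in' by simp
        obtain w1 B1 where w1: "w' = a \<otimes> w1" "B' = map (reflect a) B1" "run (C0 @ [a]) (a \<otimes> x') w1 B1"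
          using less.prems(4) Cons in' by (auto elim: run_ConsE)
        have axc: "a \<otimes> x' \<in> carrier G" using a c S_closed by simp
        have w1c: "w1 \<in> carrier G" using run_closed[OF w1(3) axc] wda by auto
        have "sroot a \<notin> Inv (a \<otimes> x')" using Inv_left_sroot[OF c(2) a] in' by simp
        then have w1a: "sroot a \<notin> Inv w1" using run_le[OF w1(3) axc] wda by (auto simp: wle_def)
        show ?thesis
        proof (cases "sroot a \<in> Inv ?y")
          case True
          obtain v1 B2 where v1: "v = a \<otimes> v1" "run (C0 @ [a]) (a \<otimes> ?y) v1 B2"
            using v Cons True by (auto elim: run_ConsE)
          have ayc: "a \<otimes> ?y \<in> carrier G" using a yc S_closed by simp
          have v1c: "v1 \<in> carrier G" using run_closed[OF v1(2) ayc] wda by auto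
          have "sroot a \<notin> Inv (a \<otimes> ?y)" using Inv_left_sroot[OF yc a] True by simp
          then have v1a: "sroot a \<notin> Inv v1" using run_le[OF v1(2) ayc] wda by (auto simp: wle_def)
          have "wle (a \<otimes> ?y) (a \<otimes> x')"
            using Inv_sub_left[OF yc c(2) a] True in' yle axc ayc by (auto simp: wle_def)
          then have "wle v1 w1" by (rule less.hyps[OF _ _ _ v1(2) w1(3), rotated 1]) (use l Cons wda in auto)
          then show ?thesis using Inv_sub_left[OF v1c w1c a] v1a w1a v1 w1 a v1c w1c S_closed by (auto simp: wle_def)
        next
          case False
          \<comment> \<open>Here \<open>a\<close> is an initial cover reflection of \<open>x'\<close>; if it were not a wall of the
            cone of \<open>w'\<close>, both sides would have the same projection.\<close>
          then have cva: "croot x' s = sroot a" using Inv_right[OF c(2) s] in' by auto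
          then have xs: "act x' (sroot s) = (\<lambda>i. (-1) * sroot a i)" using croot_swap by simp
          have ax: "a \<otimes> x' = ?y" by (rule conj_simple[OF c(2) sS a xs]) simp
          have run': "run (a # C0) x' w' B'" using less.prems Cons by simp
          have inB: "sroot a \<in> set B1"
          proof (rule ccontr)
            assume n: "sroot a \<notin> set B1"
            have "run (a # C0) ?y w' B'"
            proof (rule run_fibre[OF run' c(2) wda yc])
              fix b assume b: "b \<in> set B'"
              have bb: "is_root b" "nonneg (act (inv x') b)" using run_base[OF run' c(2) wda b] by auto
              have "act (inv x') b \<noteq> sroot s"
              proof
                assume "act (inv x') b = sroot s"
                then have "b = act x' (sroot s)" using act_inv_cancel[OF c(2)] by metis
                then have "b = reflect a (sroot a)" using xs reflect_sroot a by simp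
                then have "reflect a b = sroot a" using reflect_reflect a by simp
                then show False using b w1(2) n reflect_reflect[OF a] by auto
              qed
              then show "nonneg (act (inv ?y) b)"
                using nonneg_reflect[of "act (inv x') b" s] bb root_act c sS by (simp add: act_inv_right)
            qed
            then have "wle w' ?y" using run_le yc wda by blast
            moreover have "sroot a \<in> Inv w'" using Inv_left_sroot[OF w1c a] w1 w1a by simp
            ultimately show False using False by (auto simp: wle_def)
          qed
          \<comment> \<open>As an upper wall, \<open>sroot a\<close> is the image of a simple root
            under \<open>w1\<close>, so \<open>w'\<close> is \<open>w1\<close> times a simple
            reflection and lies above it.\<close>
          obtain s' where s': "s' \<in> S" "act (inv w1) (sroot a) = sroot s'"
            using run_simple_back[OF w1(3) axc wda inB w1a] by blast
          then have "act w1 (sroot s') = sroot a" using act_inv_cancel[OF w1c] by metis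
          then have "a \<otimes> w1 = w1 \<otimes> s'" "wle w1 (w1 \<otimes> s')"
            using conj_simple[OF w1c s'(1) a, of 1] wle_up[OF w1c s'(1)] nonneg_sroot by auto
          then have up: "wle w1 w'" using w1 by simp
          obtain B2 where v2: "run C0 ?y v B2" using v Cons False by (auto elim: run_ConsE)
          have vs: "sortable C0 v" using run_sortable[OF v2 yc] wda by simp
          \<comment> \<open>\<open>v\<close> avoids \<open>a\<close>, so it can be read over the
            same word as \<open>w1\<close>, and the induction hypothesis compares the two.\<close>
          have "sortable (C0 @ [a] @ []) v \<longleftrightarrow> sortable (C0 @ []) v"
          proof (rule sortable_insert)
            show "v \<in> carrier G" using vs by (simp add: sortable_def)
            fix r assume "r \<in> Inv v"
            then show "r a = 0" using sortable_supp[OF vs] wda by (auto simp: supp_def)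
          qed (use wda in auto)
          then obtain B3 where B3: "run (C0 @ [a]) v v B3" using vs by (auto simp: sortable_def)
          have "wle v ?y" using run_le[OF v2 yc] wda by simp
          then have "wle v w1"
            by (rule less.hyps[OF _ _ _ B3 w1(3)[unfolded ax], rotated 1]) (use l ax Cons wda in auto)
          then show ?thesis using up wle_trans by blast
        qed
      qed
    qed
  qed
  show ?case
  proof (cases "x = x'")
    case True
    then show ?thesis using run_det less.prems run_closed[OF less.prems(3) c(1)] wle_refl by metis
  next
    case False
    then obtain s where s: "s \<in> Des x'" "wle x (x' \<otimes> s)" using wlt_des less.prems by blast
    have sS: "s \<in> S" using s D_S by simp
    have yc: "x' \<otimes> s \<in> carrier G" using c sS S_closed by simp
    obtain v Bv where v: "run C (x' \<otimes> s) v Bv" using run_total[OF yc less.prems(2)] by blast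
    have "len (x' \<otimes> s) < len x'" using len_des[OF c(2) sS] s by (simp add: Des_def)
    then have "wle w v" using less.hyps[OF _ s(2) less.prems(2,3) v] by simp
    then show ?thesis using cover[OF s(1) v] wle_trans by blast
  qed
qed

subsection \<open>Aligned elements\<close>

lemma pos_single: assumes "pos r" "a \<in> S" "supp {a} r" shows "r = sroot a"
proof (rule ccontr)
  assume "r \<noteq> sroot a"
  then have p: "pos (reflect a r)" using pos_reflect assms by simp
  have e: "r = (\<lambda>x. r a * sroot a x + 0 * sroot a x)" using assms(3) by (intro ext) (auto simp: supp_def sroot_def)
  have "form (sroot a) (\<lambda>x. r a * sroot a x + 0 * sroot a x) = r a"
    unfolding form_lin_r form_self[OF assms(2)] by simp
  then have "form (sroot a) r = r a" unfolding e[symmetric] .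
  then have "reflect a r = (\<lambda>x. - r x)"
    using assms(3) by (intro ext) (auto simp: reflect_def sroot_def supp_def)
  then show False using p pos_neg[of r] assms by (simp add: pos_def)
qed

lemma form_le: assumes "wd (a # C)" "supp (set (a # C)) v" "nonneg v" shows "form (sroot a) v \<le> v a"
proof -
  have "(\<Sum>j\<in>set C. v j * bil a j) \<le> 0"
  proof (rule sum_nonpos)
    fix j assume "j \<in> set C"
    then show "v j * bil a j \<le> 0"
      using bil_nonpos[of a j] assms by (auto simp: nonneg_def subset_iff intro!: mult_nonneg_nonpos)
  qed
  then show ?thesis using form_split[OF assms(1,2)] by simp
qed

text \<open>\<open>bil j a \<noteq> 0\<close> says that \<open>j\<close> is a neighbour of
  \<open>a\<close> in the Coxeter graph; one nonzero coordinate at a neighbour makes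
  \<open>form_le\<close> strict.\<close>

lemma form_less: assumes "wd (a # C)" "supp (set (a # C)) v" "nonneg v" "j \<in> set C" "bil j a \<noteq> 0" "v j \<noteq> 0"
  shows "form (sroot a) v < v a"
proof -
  have np: "v i * bil a i \<le> 0" if "i \<in> set C" for i
    using bil_nonpos[of a i] that assms by (auto simp: nonneg_def subset_iff intro!: mult_nonneg_nonpos)
  have j: "a \<in> S" "j \<in> S" "a \<noteq> j" using assms by auto
  have "v j > 0" "bil a j < 0"
    using bil_nonpos[OF j] assms(3,5,6) bil_sym[OF j(1,2)] by (simp_all add: nonneg_def less_le)
  then have "v j * bil a j < 0" by (rule mult_pos_neg)
  moreover have "(\<Sum>i\<in>set C - {j}. v i * bil a i) \<le> 0" by (rule sum_nonpos) (use np in auto)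
  moreover have "(\<Sum>i\<in>set C. v i * bil a i) = v j * bil a j + (\<Sum>i\<in>set C - {j}. v i * bil a i)"
    using assms(4) by (simp add: sum.remove)
  ultimately show ?thesis using form_split[OF assms(1,2)] by simp
qed

text \<open>Reading's notion of a \<open>c\<close>-aligned element: inside a rank-two subsystem, the inversion set
  respects the orientation given by the antisymmetrisation of \<open>euler\<close>.\<close>
definition aligned :: "'a list \<Rightarrow> 'a \<Rightarrow> bool" where
  "aligned C w \<longleftrightarrow> (\<forall>u v p q. pos u \<and> pos v \<and> supp (set C) u \<and> supp (set C) v \<and> 0 < p \<and> 0 < q \<and>
     euler C v u < euler C u v \<and> (\<lambda>x. p * u x + q * v x) \<in> Inv w \<longrightarrow> u \<in> Inv w)"

lemma alignedD: "aligned C w \<Longrightarrow> pos u \<Longrightarrow> pos v \<Longrightarrow> supp (set C) u \<Longrightarrow> supp (set C) v \<Longrightarrow> 0 < p \<Longrightarrow> 0 < q \<Longrightarrow>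
     euler C v u < euler C u v \<Longrightarrow> (\<lambda>x. p * u x + q * v x) \<in> Inv w \<Longrightarrow> u \<in> Inv w"
  unfolding aligned_def by blast

lemma comb_zero: "nonneg u \<Longrightarrow> nonneg v \<Longrightarrow> 0 < p \<Longrightarrow> 0 < q \<Longrightarrow> p * u i + q * v i = 0 \<Longrightarrow> u i = 0 \<and> v i = (0::real)"
  unfolding nonneg_def by (metis add_nonneg_eq_0_iff less_eq_real_def mult_eq_0_iff mult_nonneg_nonneg less_irrefl)

lemma comb_ne_sroot: assumes "pos u" "pos v" "a \<in> S" "0 < p" "0 < q" "euler C v u < euler C u v"
  shows "(\<lambda>x. p * u x + q * v x) \<noteq> sroot a"
proof
  assume e: "(\<lambda>x. p * u x + q * v x) = sroot a"
  have z: "u i = 0 \<and> v i = 0" if "i \<noteq> a" for i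
    using fun_cong[OF e, of i] comb_zero[of u v p q i] assms that by (simp add: pos_def sroot_def)
  have "u = sroot a" by (rule pos_single) (use assms z in \<open>auto simp: supp_def\<close>)
  moreover have "v = sroot a" by (rule pos_single) (use assms z in \<open>auto simp: supp_def\<close>)
  ultimately show False using assms by simp
qed

text \<open>The orientation runs from initial to final letters: the initial simple root is never the
  second member of an oriented pair and, by \<open>back_not\<close>, the final one never the
  first.\<close>

lemma front_not: assumes "wd (a # C)" "supp (set (a # C)) v" "nonneg v"
  shows "\<not> euler (a # C) (sroot a) v < euler (a # C) v (sroot a)"
  using form_le[OF assms] euler_front[OF assms(1)] euler_front_r[OF assms(1,2)] by (simp add: reflect_self)

lemma back_not: assumes "wd (a # C)" "supp (set (a # C)) v" "nonneg v"
  shows "\<not> euler (C @ [a]) v (sroot a) < euler (C @ [a]) (sroot a) v"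
  using form_le[OF assms] euler_back[OF assms(1,2)] euler_back_r[OF assms(1)] by (simp add: reflect_self)

lemma aligned_use: assumes "sroot a \<in> Inv w" "wd (a # C)" "w \<in> carrier G" "aligned (C @ [a]) (a \<otimes> w)"
  shows "aligned (a # C) w"
  unfolding aligned_def
proof (intro allI impI, elim conjE)
  fix u v p q
  assume h: "pos u" "pos v" "supp (set (a # C)) u" "supp (set (a # C)) v" "(0::real) < p" "(0::real) < q"
    "euler (a # C) v u < euler (a # C) u v" "(\<lambda>x. p * u x + q * v x) \<in> Inv w"
  have a: "a \<in> S" using assms by simp
  show "u \<in> Inv w"
  proof (cases "u = sroot a")
    case False
    have vne: "v \<noteq> sroot a" using front_not[OF assms(2) h(3)] h by (auto simp: pos_def)
    let ?b = "\<lambda>x. p * u x + q * v x"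
    have bne: "?b \<noteq> sroot a" using comb_ne_sroot[OF h(1,2) a h(5,6,7)] .
    have "reflect a ?b \<in> Inv (a \<otimes> w)" using Inv_left'[OF assms(3) a Inv_pos[OF h(8)] bne] h(8) by simp
    then have 1: "(\<lambda>x. p * reflect a u x + q * reflect a v x) \<in> Inv (a \<otimes> w)" by (simp add: reflect_lin)
    have "reflect a u \<in> Inv (a \<otimes> w)"
    proof (rule alignedD[OF assms(4) _ _ _ _ h(5,6) _ 1])
      show "pos (reflect a u)" "pos (reflect a v)" using pos_reflect h a False vne by auto
      show "supp (set (C @ [a])) (reflect a u)" "supp (set (C @ [a])) (reflect a v)"
        using supp_reflect[OF h(3)] supp_reflect[OF h(4)] by auto
      show "euler (C @ [a]) (reflect a v) (reflect a u) < euler (C @ [a]) (reflect a u) (reflect a v)"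
        using h(7) euler_rot[OF assms(2) h(3,4)] euler_rot[OF assms(2) h(4,3)] by simp
    qed
    then show ?thesis using Inv_left'[OF assms(3) a h(1) False] by simp
  qed (use assms in simp)
qed

lemma aligned_fire: assumes "sroot a \<in> Inv w" "wd (a # C)" "w \<in> carrier G" "aligned (a # C) w"
  shows "aligned (C @ [a]) (a \<otimes> w)"
  unfolding aligned_def
proof (intro allI impI, elim conjE)
  fix u v p q
  assume h: "pos u" "pos v" "supp (set (C @ [a])) u" "supp (set (C @ [a])) v" "(0::real) < p" "(0::real) < q"
    "euler (C @ [a]) v u < euler (C @ [a]) u v" "(\<lambda>x. p * u x + q * v x) \<in> Inv (a \<otimes> w)"
  have a: "a \<in> S" using assms by simp
  have sps: "supp (set (a # C)) u" "supp (set (a # C)) v" using h by auto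
  have une: "u \<noteq> sroot a" using back_not[OF assms(2) sps(2)] h by (auto simp: pos_def)
  let ?b = "\<lambda>x. p * u x + q * v x"
  have bne: "?b \<noteq> sroot a" using comb_ne_sroot[OF h(1,2) a h(5,6,7)] .
  have "reflect a ?b \<in> Inv w" using Inv_left[OF assms(3) a Inv_pos[OF h(8)] bne] h(8) by simp
  then have 1: "(\<lambda>x. p * reflect a u x + q * reflect a v x) \<in> Inv w" by (simp add: reflect_lin)
  have "reflect a u \<in> Inv w"
  proof (cases "v = sroot a")
    case False
    show ?thesis
    proof (rule alignedD[OF assms(4) _ _ _ _ h(5,6) _ 1])
      show "pos (reflect a u)" "pos (reflect a v)" using pos_reflect h a False une by auto
      show sp2: "supp (set (a # C)) (reflect a u)" "supp (set (a # C)) (reflect a v)"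
        using supp_reflect[OF sps(1)] supp_reflect[OF sps(2)] by auto
      show "euler (a # C) (reflect a v) (reflect a u) < euler (a # C) (reflect a u) (reflect a v)"
        using h(7) euler_rot[OF assms(2) sp2] euler_rot[OF assms(2) sp2(2,1)] by (simp add: reflect_reflect a)
    qed
  next
    \<comment> \<open>Reflection turns this partner negative, so alignment is silent. But
      \<open>inv w\<close> makes \<open>sroot a\<close> negative, and if \<open>reflect a u\<close>
      were no inversion, the combination would be sent to a nonnegative vector.\<close>
    case True
    have iw: "inv w \<in> carrier G" using assms by simp
    show ?thesis
    proof (rule ccontr)
      assume n: "reflect a u \<notin> Inv w"
      then have n1: "nonneg (act (inv w) (reflect a u))" using pos_reflect[OF h(1) a une] by (simp add: Inv_def)
      have "\<not> nonneg (act (inv w) (sroot a))" using assms(1) by (simp add: Inv_def)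
      then have n2: "nonneg (\<lambda>x. - act (inv w) (sroot a) x)" using root_sign root_act[OF iw root_sroot[OF a]] by blast
      have "act (inv w) (reflect a v) = (\<lambda>x. - act (inv w) (sroot a) x)" using True a reflect_sroot act_neg iw by simp
      then have "nonneg (act (inv w) (\<lambda>x. p * reflect a u x + q * reflect a v x))"
        unfolding act_lin[OF iw] using nonneg_comb[OF n1 n2] h(5,6) by simp
      then show False using 1 by (simp add: Inv_def)
    qed
  qed
  then show "u \<in> Inv (a \<otimes> w)" using Inv_left[OF assms(3) a h(1) une] by simp
qed

lemma aligned_skip: assumes "aligned (a # C) w" "wd (a # C)" shows "aligned C w"
  unfolding aligned_def
proof (intro allI impI, elim conjE)
  fix u v p q
  assume h: "pos u" "pos v" "supp (set C) u" "supp (set C) v" "(0::real) < p" "(0::real) < q"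
    "euler C v u < euler C u v" "(\<lambda>x. p * u x + q * v x) \<in> Inv w"
  have s: "supp (set (a # C)) u" "supp (set (a # C)) v" using h by (auto simp: supp_def)
  have "u a = 0" "v a = 0" using h assms by (auto simp: supp_def)
  then have "euler (a # C) v u < euler (a # C) u v" using h by (simp add: euler_zero)
  then show "u \<in> Inv w" using alignedD[OF assms(1) h(1,2) s h(5,6) _ h(8)] by simp
qed

text \<open>Skipping a letter is harmless: a positive combination without \<open>a\<close> has both
  members without \<open>a\<close>. Using a letter reflects the whole rank-two
  configuration.\<close>

lemma sortable_aligned: "sortable C w \<Longrightarrow> wd C \<Longrightarrow> aligned C w"
proof (induction "len w + length C" arbitrary: w C rule: less_induct)
  case less
  have w: "w \<in> carrier G" using less.prems by (simp add: sortable_def)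
  show ?case
  proof (cases C)
    case Nil
    then have "w = \<one>" using less sortable_Nil by simp
    then show ?thesis by (simp add: aligned_def)
  next
    case (Cons a C')
    have a: "a \<in> S" and wda: "wd (a # C')" using less Cons by auto
    show ?thesis
    proof (cases "sroot a \<in> Inv w")
      case True
      have "aligned (C' @ [a]) (a \<otimes> w)"
        by (rule less.hyps) (use len_left_Suc[OF w a True] sortable_use[OF True wda w] Cons less.prems wda in auto)
      then show ?thesis using aligned_use[OF True wda w] Cons by simp
    next
      case False
      then have s: "sortable C' w" using sortable_skip[OF False wda] less.prems Cons by simp
      have al: "aligned C' w" by (rule less.hyps) (use s Cons wda in auto)
      show ?thesis unfolding aligned_def
      proof (intro allI impI, elim conjE)
        fix u v p q
        assume h: "pos u" "pos v" "supp (set C) u" "supp (set C) v" "(0::real) < p" "(0::real) < q"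
          "euler C v u < euler C u v" "(\<lambda>x. p * u x + q * v x) \<in> Inv w"
        have "p * u a + q * v a = 0" using sortable_supp[OF s _ h(8)] wda by (auto simp: supp_def)
        then have z: "u a = 0" "v a = 0" using comb_zero[of u v p q a] h by (auto simp: pos_def)
        then have s2: "supp (set C') u" "supp (set C') v" using h Cons by (auto simp: supp_def)
        have "euler C' v u < euler C' u v" using h(7) Cons z by (simp add: euler_zero)
        then show "u \<in> Inv w" using alignedD[OF al h(1,2) s2 h(5,6) _ h(8)] by simp
      qed
    qed
  qed
qed

text \<open>Such an \<open>x\<close> lies in the parabolic subgroup omitting \<open>y\<close>, and
  reflections in other letters leave that coordinate alone.\<close>

lemma act_outside: "x \<in> carrier G \<Longrightarrow> \<forall>r\<in>Inv x. r y = 0 \<Longrightarrow> act x v y = v y"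
proof (induction "len x" arbitrary: x)
  case 0
  then have "x = \<one>" using len_0 by simp
  then show ?case by simp
next
  case (Suc n)
  then obtain a where a: "a \<in> S" "sroot a \<in> Inv x" using left_des_ex[of x] by fastforce
  have ya: "y \<noteq> a" using Suc.prems(2) a(2) by (auto simp: sroot_def)
  have ax: "a \<otimes> x \<in> carrier G" using a Suc.prems S_closed by simp
  have "act (a \<otimes> x) v y = v y"
  proof (rule Suc.hyps(1)[OF _ ax])
    show "n = len (a \<otimes> x)" using len_left_Suc Suc a by auto
    show "\<forall>r\<in>Inv (a \<otimes> x). r y = 0"
    proof
      fix r assume r: "r \<in> Inv (a \<otimes> x)"
      have "r \<noteq> sroot a" using r Inv_left_sroot Suc.prems a by blast
      then have "reflect a r \<in> Inv x" using Inv_left[OF Suc.prems(1) a(1) Inv_pos[OF r]] r by blast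
      then show "r y = 0" using Suc.prems(2) reflect_other[OF ya, of r] by fastforce
    qed
  qed
  moreover have "act x v = reflect a (act (a \<otimes> x) v)"
    using a Suc.prems reflect_reflect by (simp add: act_mult S_closed act_S)
  ultimately show ?case using reflect_other[OF ya] by simp
qed

lemma act_outside_inv: assumes "x \<in> carrier G" "\<forall>r\<in>Inv x. r y = 0"
  shows "act (inv x) v y = v y"
  using act_outside[OF assms, where v="act (inv x) v"] act_inv_cancel[OF assms(1)] by simp

lemma D_coord: assumes "x \<in> carrier G" "\<forall>r\<in>Inv x. r y = 0" shows "y \<notin> Des x"
proof
  assume d: "y \<in> Des x"
  have "croot x y y = - 1" using act_outside[OF assms, where v="sroot y"] by (simp add: croot_def sroot_def)
  moreover have "croot x y y \<ge> 0" using croot_pos[OF assms(1) d] by (simp add: pos_def nonneg_def)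
  ultimately show False by simp
qed

lemma right_step: assumes "x \<in> carrier G" "j \<in> Des x" "a \<in> S"
  shows "act x (sroot a) = (\<lambda>i. 1 * act (x \<otimes> j) (sroot a) i + (- 2 * bil j a) * croot x j i)"
    "croot x j = act (x \<otimes> j) (sroot j)"
proof -
  have j: "j \<in> S" using assms D_S by simp
  show 2: "croot x j = act (x \<otimes> j) (sroot j)" using assms j by (simp add: act_right_sroot croot_def)
  have "act x (sroot a) = act (x \<otimes> j) (reflect j (sroot a))"
    using act_right[of "x \<otimes> j" j "sroot a"] assms j S_closed by simp
  also have "\<dots> = (\<lambda>i. 1 * act (x \<otimes> j) (sroot a) i + (- 2 * form (sroot j) (sroot a)) * act (x \<otimes> j) (sroot j) i)"
    unfolding reflect_alt[of j] by (rule act_lin) (use assms j S_closed in simp)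
  finally show "act x (sroot a) = (\<lambda>i. 1 * act (x \<otimes> j) (sroot a) i + (- 2 * bil j a) * croot x j i)"
    using form_sroot_sroot[OF j assms(3)] 2 by simp
qed

text \<open>Letter by letter, \<open>sroot a\<close> receives nonnegative multiples of inversions of
  \<open>x\<close>; if the linear function \<open>f\<close> grows in total, it is positive on one of
  them.\<close>

lemma telescope: "x \<in> carrier G \<Longrightarrow> a \<in> S \<Longrightarrow> \<forall>r\<in>Inv x. r a = 0 \<Longrightarrow>
  (\<And>p u q v. f (\<lambda>i. p * u i + q * v i) = p * f u + q * (f v :: real)) \<Longrightarrow>
  f (sroot a) < f (act x (sroot a)) \<Longrightarrow> \<exists>d\<in>Inv x. 0 < f d"
proof (induction "len x" arbitrary: x)
  case 0
  then have "x = \<one>" using len_0 by simp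
  then show ?case using 0 by simp
next
  case (Suc n)
  then obtain j where j: "j \<in> S" "j \<in> Des x" using right_des_ex[of x] by fastforce
  have ja: "j \<noteq> a" using D_coord[OF Suc.prems(1,3)] j by blast
  have xj: "x \<otimes> j \<in> carrier G" using Suc.prems j S_closed by simp
  have I: "Inv (x \<otimes> j) = Inv x - {croot x j}" using Inv_right Suc.prems j by simp
  have f: "f (act x (sroot a)) = f (act (x \<otimes> j) (sroot a)) + (- 2 * bil j a) * f (croot x j)"
    unfolding right_step(1)[OF Suc.prems(1) j(2) Suc.prems(2)] Suc.prems(4) by simp
  have k: "- 2 * bil j a \<ge> 0" using bil_nonpos j ja Suc.prems by simp
  show ?case
  proof (cases "f (sroot a) < f (act (x \<otimes> j) (sroot a))")
    case True
    have "\<exists>d\<in>Inv (x \<otimes> j). 0 < f d"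
      by (rule Suc.hyps(1)[OF _ xj]) (use len_right[OF Suc.prems(1) j(1)] len_des[OF Suc.prems(1) j(1)] j Suc I True in \<open>auto simp: Des_def\<close>)
    then show ?thesis using I by auto
  next
    case False
    then have "(- 2 * bil j a) * f (croot x j) > 0" using f Suc.prems by simp
    then have "f (croot x j) > 0" using k unfolding zero_less_mult_iff by linarith
    then show ?thesis using croot_Inv Suc.prems j by blast
  qed
qed

lemma root_coord_pos: assumes "is_root r" "r a > 0" shows "pos r"
proof -
  have "\<not> nonneg (\<lambda>x. - r x)" using assms(2) by (auto simp: nonneg_def not_le intro!: exI[of _ a])
  then show ?thesis using root_sign assms(1) by (simp add: pos_def)
qed

text \<open>All terms added to \<open>sroot a\<close> along \<open>x\<close> are nonnegative, so a
  contribution at a neighbour of \<open>a\<close> cannot cancel and would remain visible in the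
  image.\<close>

lemma nbr_zero: "x \<in> carrier G \<Longrightarrow> a \<in> S \<Longrightarrow> \<forall>r\<in>Inv x. r a = 0 \<Longrightarrow>
  (\<And>n. n \<in> S \<Longrightarrow> n \<noteq> a \<Longrightarrow> bil n a \<noteq> 0 \<Longrightarrow> act x (sroot a) n = 0) \<Longrightarrow>
  r \<in> Inv x \<Longrightarrow> n \<in> S \<Longrightarrow> n \<noteq> a \<Longrightarrow> bil n a \<noteq> 0 \<Longrightarrow> r n = 0"
proof (induction "len x" arbitrary: x r n)
  case 0
  then have "x = \<one>" using len_0 by simp
  then show ?case using 0 by simp
next
  case (Suc m)
  then obtain j where j: "j \<in> S" "j \<in> Des x" using right_des_ex[of x] by fastforce
  have ja: "j \<noteq> a" using D_coord[OF Suc.prems(1,3)] j by blast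
  have xj: "x \<otimes> j \<in> carrier G" using Suc.prems j S_closed by simp
  have I: "Inv (x \<otimes> j) = Inv x - {croot x j}" using Inv_right Suc.prems j by simp
  have k: "- 2 * bil j a \<ge> 0" using bil_nonpos j ja Suc.prems by simp
  have Ha: "\<forall>r\<in>Inv (x \<otimes> j). r a = 0" using I Suc.prems(3) by auto
  have "act (x \<otimes> j) (sroot a) a = 1" using act_outside[OF xj Ha, where v="sroot a"] by (simp add: sroot_def)
  then have p1: "nonneg (act (x \<otimes> j) (sroot a))"
    using root_coord_pos[of "act (x \<otimes> j) (sroot a)" a] root_act[OF xj root_sroot] Suc.prems(2) by (simp add: pos_def)
  have pd: "nonneg (croot x j)" using croot_pos Suc.prems j by (simp add: pos_def)
  have z: "act (x \<otimes> j) (sroot a) n = 0 \<and> (- 2 * bil j a) * croot x j n = 0" if n: "n \<in> S" "n \<noteq> a" "bil n a \<noteq> 0" for n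
  proof -
    have "act (x \<otimes> j) (sroot a) n + (- 2 * bil j a) * croot x j n = 0"
      using Suc.prems(4)[OF n] right_step(1)[OF Suc.prems(1) j(2) Suc.prems(2)] by simp
    moreover have "act (x \<otimes> j) (sroot a) n \<ge> 0" using p1 by (simp add: nonneg_def)
    moreover have "(- 2 * bil j a) * croot x j n \<ge> 0" by (rule mult_nonneg_nonneg[OF k]) (use pd in \<open>simp add: nonneg_def\<close>)
    ultimately show ?thesis by linarith
  qed
  have IH: "r n = 0" if "r \<in> Inv (x \<otimes> j)" "n \<in> S" "n \<noteq> a" "bil n a \<noteq> 0" for r n
    by (rule Suc.hyps(1)[OF _ xj Suc.prems(2) Ha _ that])
      (use len_right[OF Suc.prems(1) j(1)] len_des[OF Suc.prems(1) j(1)] j Suc z in \<open>auto simp: Des_def\<close>)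
  \<comment> \<open>A neighbour \<open>j\<close> used for the first time would enter with
    coefficient 1 at itself.\<close>
  have b0: "bil j a = 0"
  proof (rule ccontr)
    assume b: "bil j a \<noteq> 0"
    have "croot x j j = 1"
      unfolding right_step(2)[OF Suc.prems(1) j(2) Suc.prems(2)]
      using act_outside[OF xj, of j "sroot j"] IH[OF _ j(1) ja b] by (simp add: sroot_def)
    then show False using z[OF j(1) ja b] b by simp
  qed
  show ?case
  proof (cases "r = croot x j")
    case True
    have "n \<noteq> j" using b0 Suc.prems by auto
    then show ?thesis unfolding True right_step(2)[OF Suc.prems(1) j(2) Suc.prems(2)]
      using act_outside[OF xj, of n "sroot j"] IH[OF _ Suc.prems(6-8)] by (simp add: sroot_def)
  next
    case False
    then show ?thesis using IH I Suc.prems by blast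
  qed
qed

text \<open>Strong exchange: \<open>y\<close> is the product of the reflection in \<open>d\<close> with \<open>x\<close>.\<close>
lemma exchange: "x \<in> carrier G \<Longrightarrow> d \<in> Inv x \<Longrightarrow> \<exists>y\<in>carrier G. len y < len x \<and>
   (\<forall>v. act y v = (\<lambda>i. 1 * act x v i + (- 2 * form d (act x v)) * d i)) \<and>
   (\<forall>n. (\<forall>r\<in>Inv x. r n = 0) \<longrightarrow> (\<forall>r\<in>Inv y. r n = 0))"
proof (induction "len x" arbitrary: x d)
  case 0
  then have "x = \<one>" using len_0 by simp
  then show ?case using 0 by simp
next
  case (Suc m)
  then obtain a where a: "a \<in> S" "sroot a \<in> Inv x" using left_des_ex[of x] by fastforce
  have ax: "a \<otimes> x \<in> carrier G" using a Suc.prems S_closed by simp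
  have l: "len x = Suc (len (a \<otimes> x))" using len_left_Suc Suc a by auto
  have axn: "sroot a \<notin> Inv (a \<otimes> x)" using Inv_left_sroot Suc.prems a by blast
  have tr: "\<forall>r\<in>Inv (a \<otimes> x). r n = 0" if n: "\<forall>r\<in>Inv x. r n = 0" for n
  proof
    fix r assume r: "r \<in> Inv (a \<otimes> x)"
    have na: "n \<noteq> a" using n a by (auto simp: sroot_def)
    have "reflect a r \<in> Inv x" using Inv_left[OF Suc.prems(1) a(1) Inv_pos[OF r]] r axn by blast
    then show "r n = 0" using n reflect_other[OF na, of r] by fastforce
  qed
  show ?case
  proof (cases "d = sroot a")
    case True
    have "act (a \<otimes> x) v = (\<lambda>i. 1 * act x v i + (- 2 * form d (act x v)) * d i)" for v
      using True Suc.prems a by (simp add: act_mult S_closed act_S reflect_def)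
    then show ?thesis using ax l tr by (intro bexI[of _ "a \<otimes> x"]) auto
  next
    case False
    have dp: "pos d" using Inv_pos Suc.prems by blast
    have m: "m = len (a \<otimes> x)" using l Suc.hyps(2) by simp
    have "reflect a d \<in> Inv (a \<otimes> x)" using Inv_left'[OF Suc.prems(1) a(1) dp False] Suc.prems by simp
    then obtain y where y: "y \<in> carrier G" "len y < len (a \<otimes> x)"
      "\<And>v. act y v = (\<lambda>i. 1 * act (a \<otimes> x) v i + (- 2 * form (reflect a d) (act (a \<otimes> x) v)) * reflect a d i)"
      "\<And>n. (\<forall>r\<in>Inv (a \<otimes> x). r n = 0) \<Longrightarrow> (\<forall>r\<in>Inv y. r n = 0)"
      using Suc.hyps(1)[OF m ax] by blast
    have "act (a \<otimes> y) v = (\<lambda>i. 1 * act x v i + (- 2 * form d (act x v)) * d i)" for v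
    proof -
      have "act (a \<otimes> y) v = reflect a (act y v)" using a y by (simp add: act_mult S_closed act_S)
      also have "\<dots> = (\<lambda>i. 1 * reflect a (act (a \<otimes> x) v) i + (- 2 * form (reflect a d) (act (a \<otimes> x) v)) * reflect a (reflect a d) i)"
        unfolding y(3) by (rule reflect_lin)
      also have "act (a \<otimes> x) v = reflect a (act x v)" using a Suc.prems by (simp add: act_mult S_closed act_S)
      finally show ?thesis using a reflect_reflect reflect_form by simp
    qed
    moreover have "len (a \<otimes> y) < len x"
      using len_mult_ev[of "inv y" "[a]"] len_inv[of "a \<otimes> y"] len_inv[of y] y l a
      by (simp add: inv_mult_group S_closed S_inv)
    moreover have "\<forall>r\<in>Inv (a \<otimes> y). r n = 0" if n: "\<forall>r\<in>Inv x. r n = 0" for n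
    proof
      fix r assume r: "r \<in> Inv (a \<otimes> y)"
      have na: "n \<noteq> a" using n a by (auto simp: sroot_def)
      show "r n = 0"
      proof (cases "r = sroot a")
        case False
        then have "reflect a r \<in> Inv y" using Inv_left[OF y(1) a(1) Inv_pos[OF r]] r by blast
        then show ?thesis using y(4)[OF tr[OF n]] reflect_other[OF na, of r] by fastforce
      qed (use na in \<open>simp add: sroot_def\<close>)
    qed
    ultimately show ?thesis using y(1) a S_closed by (intro bexI[of _ "a \<otimes> y"]) auto
  qed
qed

text \<open>The root \<open>h = act x (sroot a)\<close> splits as a root \<open>h'\<close> of the
  same kind for a shorter \<open>y\<close>, plus a positive multiple of some
  \<open>d \<in> Inv x\<close>. If \<open>h'\<close> comes first in the orientation, alignment
  passes the inversion from \<open>h\<close> to \<open>h'\<close>, and so on down to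
  \<open>sroot a\<close>. The work lies in finding such a \<open>d\<close>.\<close>

lemma aligned_chain: "x \<in> carrier G \<Longrightarrow> (\<And>r. r \<in> Inv x \<Longrightarrow> supp (set C) r) \<Longrightarrow> wd (a # C) \<Longrightarrow>
  w \<in> carrier G \<Longrightarrow> aligned (a # C) w \<Longrightarrow> act x (sroot a) \<in> Inv w \<Longrightarrow> sroot a \<in> Inv w"
proof (induction "len x" arbitrary: x rule: less_induct)
  case less
  note xc = less.prems(1) and wda = less.prems(3) and wc = less.prems(4)
  have a: "a \<in> S" using wda by simp
  have out: "\<forall>r\<in>Inv x. r n = 0" if "n \<notin> set C" for n
    using less.prems(2) that by (simp add: supp_def)
  have DC: "j \<in> set C" if "j \<in> Des x" for j using D_coord[OF xc out] that by blast
  define h where "h = act x (sroot a)"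
  have ha: "h a = 1" unfolding h_def using act_outside[OF xc out, where y=a and v="sroot a"] wda by (simp add: sroot_def)
  have hs: "supp (set (a # C)) h" unfolding supp_def h_def
    using act_outside[OF xc out, where v="sroot a"] by (auto simp: sroot_def)
  have hr: "is_root h" unfolding h_def using root_act[OF xc root_sroot[OF a]] .
  have hn: "nonneg h" using root_coord_pos[OF hr, of a] ha by (simp add: pos_def)
  show ?case
  proof (cases "\<exists>j\<in>Des x. bil j a = 0")
    case True
    then obtain j where j: "j \<in> Des x" "bil j a = 0" by blast
    have jS: "j \<in> S" using j D_S by simp
    have jc: "x \<otimes> j \<in> carrier G" using jS S_closed xc by simp
    have "act (x \<otimes> j) (sroot a) = act x (sroot a)" using right_step(1)[OF xc j(1) a] j by simp
    then show ?thesis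
      using less.hyps[OF _ jc _ wda wc less.prems(5)] len_des[OF xc jS] j Inv_right[OF xc j(1)] less.prems(2,6)
      by (auto simp: Des_def)
  next
    case nodes: False
    show ?thesis
    proof (cases "x = \<one>")
      case True
      then show ?thesis using less.prems by simp
    next
      case False
      then obtain j where j: "j \<in> S" "j \<in> Des x" using right_des_ex xc by blast
      have jC: "j \<in> set C" "bil j a \<noteq> 0" "j \<noteq> a" using DC j nodes wda by auto
      obtain n where n: "n \<in> S" "n \<noteq> a" "bil n a \<noteq> 0" "h n \<noteq> 0"
      proof (rule ccontr)
        assume "\<not> thesis"
        then have z: "\<And>n. n \<in> S \<Longrightarrow> n \<noteq> a \<Longrightarrow> bil n a \<noteq> 0 \<Longrightarrow> act x (sroot a) n = 0" using that h_def by blast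
        have "\<forall>r\<in>Inv x. r j = 0"
          using nbr_zero[OF xc a _ z _ j(1) jC(3,2)] out wda by simp
        then show False using D_coord[OF xc] j by blast
      qed
      have nC: "n \<in> set C" using n hs by (auto simp: supp_def)
      have lt: "form (sroot a) h < h a" by (rule form_less[OF wda hs hn nC n(3,4)])
      \<comment> \<open>The antisymmetrised Euler pairing with \<open>h\<close>: it is 0 at
        \<open>h\<close> and negative at \<open>sroot a\<close>, so \<open>telescope\<close> finds
        an inversion with the right orientation.\<close>
      define f where "f v = euler (a # C) h v - euler (a # C) v h" for v
      have fl: "f (\<lambda>i. p * u i + q * v i) = p * f u + q * f v" for p u q v
        unfolding f_def euler_lin_l euler_lin_r by (simp add: algebra_simps)
      have fneg: "f (sroot a) < 0" unfolding f_def euler_front[OF wda] euler_front_r[OF wda hs] using lt by (simp add: reflect_self)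
      have "\<exists>d\<in>Inv x. 0 < f d"
      proof (rule telescope[where f = f])
        show "f (sroot a) < f (act x (sroot a))" using fneg unfolding h_def[symmetric] by (simp add: f_def)
      qed (use xc a out wda fl in auto)
      then obtain d where d: "d \<in> Inv x" "f d > 0" by blast
      have dp: "pos d" using Inv_pos d by blast
      have ds: "supp (set C) d" using less.prems(2) d by blast
      have ixc: "inv x \<in> carrier G" using xc by simp
      \<comment> \<open>A nonnegative vector with \<open>d = act x (- g)\<close>. It must touch a
        neighbour of \<open>a\<close>: all descents of \<open>x\<close> are neighbours, so otherwise
        \<open>x\<close> would keep \<open>g\<close> nonnegative. Hence \<open>d\<close> pairs
        strictly positively with \<open>h\<close>.\<close>
      define g where "g = (\<lambda>i. - act (inv x) d i)"
      have gn: "nonneg g" unfolding g_def using d root_sign[of "act (inv x) d"] root_act[OF ixc] dp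
        by (simp add: Inv_def pos_def)
      have gs: "supp (set C) g" unfolding g_def supp_def
        using act_outside_inv[OF xc out] ds by (auto simp: supp_def)
      have gs2: "supp (set (a # C)) g" and ga: "g a = 0" using gs wda by (auto simp: supp_def)
      have "form (sroot a) g < 0"
      proof -
        have "\<exists>m\<in>set C. bil m a \<noteq> 0 \<and> g m \<noteq> 0"
        proof (rule ccontr)
          assume "\<not> ?thesis"
          then have s0: "\<forall>i. i \<notin> {m \<in> set C. bil m a = 0} \<longrightarrow> g i = 0" using gs by (auto simp: supp_def)
          have "nonneg (act x g)"
          proof (rule nonneg_act[OF xc _ s0 gn])
            show "{m \<in> set C. bil m a = 0} \<subseteq> S" using wda by auto
            fix m assume "m \<in> {m \<in> set C. bil m a = 0}"
            then show "nonneg (act x (sroot m))" using nodes wda by (auto simp: Des_def)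
          qed
          moreover have "act x g = (\<lambda>i. - d i)" unfolding g_def using act_neg act_inv_cancel xc by simp
          ultimately show False using root_not_both[of d] dp by (simp add: pos_def)
        qed
        then show ?thesis using form_less[OF wda gs2 gn] ga by fastforce
      qed
      moreover have "form d h = form (act x (\<lambda>i. - g i)) (act x (sroot a))"
        unfolding g_def h_def using act_inv_cancel[OF xc] by simp
      ultimately have q: "2 * form d h > 0"
        using act_form[OF xc] form_neg_l form_sym[of g] by simp
      obtain y where y: "y \<in> carrier G" "len y < len x"
        "\<And>v. act y v = (\<lambda>i. 1 * act x v i + (- 2 * form d (act x v)) * d i)"
        "\<And>n. (\<forall>r\<in>Inv x. r n = 0) \<Longrightarrow> (\<forall>r\<in>Inv y. r n = 0)"
        using exchange[OF xc d(1)] by blast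
      define h' where "h' = act y (sroot a)"
      have h': "h' = (\<lambda>i. 1 * h i + (- 2 * form d h) * d i)" unfolding h'_def y(3) h_def ..
      have h'a: "h' a = 1" using h' ha ds wda by (auto simp: supp_def)
      have h'p: "pos h'" by (rule root_coord_pos[of _ a]) (use h'a root_act[OF y(1) root_sroot[OF a]] h'_def in auto)
      have "h' \<in> Inv w"
      proof (rule alignedD[OF less.prems(5) h'p dp])
        show "supp (set (a # C)) h'" "supp (set (a # C)) d" using hs ds h' by (auto simp: supp_def)
        show "0 < (1::real)" "0 < 2 * form d h" using q by auto
        have "euler (a # C) h' d - euler (a # C) d h' = f d"
          unfolding h' euler_lin_l euler_lin_r f_def by (simp add: algebra_simps)
        then show "euler (a # C) d h' < euler (a # C) h' d" using d(2) by simp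
        have "(\<lambda>i. 1 * h' i + 2 * form d h * d i) = h" unfolding h' by auto
        then show "(\<lambda>i. 1 * h' i + 2 * form d h * d i) \<in> Inv w" using less.prems(6) h_def by simp
      qed
      then show ?thesis
        using less.hyps[OF y(2,1) _ wda wc less.prems(5)] y(4) out unfolding h'_def supp_def by blast
    qed
  qed
qed

text \<open>A lost inversion at a skipped letter yields a simple root \<open>sroot j\<close> with
  \<open>act x (sroot j)\<close> in \<open>Inv w\<close> but not in \<open>Inv x\<close>. For
  \<open>j \<noteq> a\<close> the induction excludes this; for \<open>j = a\<close> alignment would
  make the skipped \<open>a\<close> a left descent of \<open>w\<close>.\<close>

lemma aligned_run: "run C w x B \<Longrightarrow> w \<in> carrier G \<Longrightarrow> wd C \<Longrightarrow> aligned C w \<Longrightarrow> r \<in> Inv w \<Longrightarrow> supp (set C) r \<Longrightarrow>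
   r \<in> Inv x"
proof (induction arbitrary: r rule: run.induct)
  case (nil w)
  then have "r = (\<lambda>x. 0)" by (auto simp: supp_def)
  then have "form r r = 0" by simp
  then show ?case using nil root_form[of r] by (simp add: Inv_def pos_def)
next
  case (use a w C x B)
  have a: "a \<in> S" "a \<otimes> w \<in> carrier G" "wd (C @ [a])" using use S_closed by auto
  have x: "x \<in> carrier G" "wle x (a \<otimes> w)" using run_closed[OF use.hyps(2)] run_le[OF use.hyps(2)] a by auto
  have nx: "sroot a \<notin> Inv x" using x Inv_left_sroot[OF use.prems(1) a(1)] use.hyps by (auto simp: wle_def)
  show ?case
  proof (cases "r = sroot a")
    case True
    then show ?thesis using Inv_left_sroot x a nx by blast
  next
    case False
    have rp: "pos r" using use.prems Inv_pos by blast
    have "reflect a r \<in> Inv (a \<otimes> w)" using Inv_left'[OF use.prems(1) a(1) rp False] use.prems by simp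
    moreover have "supp (set (C @ [a])) (reflect a r)" using supp_reflect[OF use.prems(5)] by simp
    ultimately have "reflect a r \<in> Inv x"
      using use.IH[OF a(2,3)] aligned_fire[OF use.hyps(1) use.prems(2,1,3)] by blast
    then show ?thesis using Inv_left[OF x(1) a(1) rp False] by simp
  qed
next
  case (skip a w C x B)
  have wdC: "wd C" and a: "a \<in> S" using skip.prems by auto
  have x: "x \<in> carrier G" "wle x w" using run_closed[OF skip.hyps(2)] run_le[OF skip.hyps(2)] skip.prems by auto
  have IH: "r \<in> Inv x" if "r \<in> Inv w" "supp (set C) r" for r
    using skip.IH[OF skip.prems(1) wdC aligned_skip[OF skip.prems(3,2)]] that by blast
  have xs: "supp (set C) r" if "r \<in> Inv x" for r using run_supp[OF skip.hyps(2) skip.prems(1) wdC that] .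
  have xs2: "\<forall>r\<in>Inv x. r n = 0" if "n \<notin> set C" for n using xs that by (simp add: supp_def)
  show ?case
  proof (rule ccontr)
    assume n: "r \<notin> Inv x"
    have rp: "pos r" using skip.prems Inv_pos by blast
    let ?y = "inv x \<otimes> w" and ?r = "act (inv x) r"
    have yc: "inv ?y \<in> carrier G" using x skip.prems by simp
    have rn: "nonneg ?r" using n rp by (simp add: Inv_def)
    have rs: "\<forall>i. i \<notin> set (a # C) \<longrightarrow> ?r i = 0"
      using act_outside_inv[OF x(1) xs2, where v=r] skip.prems(5) by (auto simp: supp_def)
    have neg: "\<not> nonneg (act (inv ?y) ?r)"
      using skip.prems x act_inv_cancel[OF x(1)] by (simp add: Inv_def inv_mult_group act_mult)
    have "\<exists>j\<in>set (a # C). \<not> nonneg (act (inv ?y) (sroot j))"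
      using nonneg_act[OF yc _ rs rn] neg skip.prems(2) by blast
    then obtain j where j: "j \<in> set (a # C)" "\<not> nonneg (act (inv ?y) (sroot j))" by blast
    have jS: "j \<in> S" using j skip.prems by auto
    have "sroot j \<in> Inv ?y" using j pos_sroot[OF jS] by (simp add: Inv_def)
    then have jw: "act x (sroot j) \<in> Inv w - Inv x" using Inv_decomp[OF x(2)] by blast
    have "j = a"
    proof (rule ccontr)
      assume "j \<noteq> a"
      then have "supp (set C) (act x (sroot j))" unfolding supp_def
        using act_outside[OF x(1) xs2, where v="sroot j"] j by (auto simp: sroot_def)
      then show False using IH jw by blast
    qed
    then have "sroot a \<in> Inv w"
      using aligned_chain[OF x(1) xs skip.prems(2,1,3)] jw by blast
    then show False using skip.hyps by blast
  qed
qed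

subsection \<open>Meets, commuting descents and covers\<close>

text \<open>The parabolic factor of \<open>x\<close>: strip left descents in \<open>J\<close>; once
  none is left, no inversion is supported on \<open>J\<close>.\<close>

lemma left_proj: "x \<in> carrier G \<Longrightarrow> J \<subseteq> S \<Longrightarrow> \<exists>u\<in>carrier G. Inv u = {r \<in> Inv x. supp J r}"
proof (induction "len x" arbitrary: x rule: less_induct)
  case less
  show ?case
  proof (cases "\<exists>j\<in>J. sroot j \<in> Inv x")
    case False
    have "r \<notin> Inv x" if "supp J r" for r
    proof
      assume r: "r \<in> Inv x"
      have "nonneg (act (inv x) r)"
      proof (rule nonneg_act[OF _ less.prems(2)])
        show "\<forall>i. i \<notin> J \<longrightarrow> r i = 0" using that by (simp add: supp_def)
        show "nonneg r" using Inv_pos[OF r] by (simp add: pos_def)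
        fix j assume "j \<in> J"
        then show "nonneg (act (inv x) (sroot j))" using False less.prems pos_sroot by (auto simp: Inv_def)
      qed (use less.prems in simp)
      then show False using r by (simp add: Inv_def)
    qed
    then show ?thesis by (intro bexI[of _ \<one>]) auto
  next
    case True
    then obtain j where j: "j \<in> J" "sroot j \<in> Inv x" by blast
    have jS: "j \<in> S" using j less.prems by auto
    have jx: "j \<otimes> x \<in> carrier G" using jS S_closed less.prems by simp
    obtain u where u: "u \<in> carrier G" "Inv u = {r \<in> Inv (j \<otimes> x). supp J r}"
      using less.hyps[OF _ jx less.prems(2)] len_left_Suc[OF less.prems(1) jS j(2)] by auto
    have nu: "sroot j \<notin> Inv u" using u Inv_left_sroot[OF less.prems(1) jS] j by simp
    have "r \<in> Inv (j \<otimes> u) \<longleftrightarrow> r \<in> Inv x \<and> supp J r" if r: "pos r" for r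
    proof (cases "r = sroot j")
      case True
      then show ?thesis using Inv_left_sroot[OF u(1) jS] nu j supp_sroot by simp
    next
      case False
      have "supp J (reflect j r) \<longleftrightarrow> supp J r" using supp_reflect[OF _ j(1)] reflect_reflect[OF jS] by metis
      then show ?thesis
        using Inv_left[OF u(1) jS r False] Inv_left'[OF less.prems(1) jS r False] u(2) by simp
    qed
    then have "Inv (j \<otimes> u) = {r \<in> Inv x. supp J r}" using Inv_pos by blast
    then show ?thesis using u jS S_closed by (intro bexI[of _ "j \<otimes> u"]) auto
  qed
qed

text \<open>If the parabolic factor of \<open>w\<close> were proper, it would lie below a coatom and
  miss that cover root.\<close>

lemma cover_supp: assumes "w \<in> carrier G" "J \<subseteq> S" "\<And>s. s \<in> Des w \<Longrightarrow> supp J (croot w s)" "r \<in> Inv w"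
  shows "supp J r"
proof -
  obtain u where u: "u \<in> carrier G" "Inv u = {r \<in> Inv w. supp J r}" using left_proj assms by blast
  have le: "wle u w" using u assms by (auto simp: wle_def)
  have "u = w"
  proof (rule ccontr)
    assume "u \<noteq> w"
    then obtain s where s: "s \<in> Des w" "wle u (w \<otimes> s)" using wlt_des le by blast
    have "croot w s \<in> Inv u" using u assms s croot_Inv by simp
    then have "croot w s \<in> Inv (w \<otimes> s)" using s by (auto simp: wle_def)
    then show False using Inv_right assms s by simp
  qed
  then show ?thesis using u assms by blast
qed

lemma wle_left: assumes "wle u v" "a \<in> S" "sroot a \<in> Inv u" shows "wle (a \<otimes> u) (a \<otimes> v)"
  using Inv_sub_left[of u v a] assms S_closed by (auto simp: wle_def)

lemma wle_left': assumes "wle u v" "a \<in> S" "sroot a \<notin> Inv v" shows "wle (a \<otimes> u) (a \<otimes> v)"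
  using Inv_sub_left[of u v a] assms S_closed by (auto simp: wle_def)

text \<open>Two simple reflections below \<open>x\<close> have an upper bound below \<open>x\<close> that does not depend
  on \<open>x\<close>: the projection of \<open>x\<close> to the parabolic subgroup they generate.\<close>
lemma pair_bound: assumes "x \<in> carrier G" "y \<in> carrier G" "a \<in> S" "b \<in> S"
  "sroot a \<in> Inv x" "sroot b \<in> Inv x" "sroot a \<in> Inv y" "sroot b \<in> Inv y"
  shows "\<exists>d. wle d x \<and> wle d y \<and> sroot a \<in> Inv d \<and> sroot b \<in> Inv d"
proof -
  have *: "r \<in> Inv x" if x: "x \<in> carrier G" "sroot a \<in> Inv x" "sroot b \<in> Inv x" and r: "pos r" "supp {a, b} r" for x r
  proof (rule ccontr)
    assume "r \<notin> Inv x"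
    then have n: "nonneg (act (inv x) r)" using r by (simp add: Inv_def)
    have xc: "inv x \<in> carrier G" using x by simp
    have neg: "nonneg (\<lambda>i. - act (inv x) (sroot c) i)" if "c \<in> {a, b}" for c
      using root_sign[of "act (inv x) (sroot c)"] root_act[OF xc root_sroot] that assms x by (auto simp: Inv_def)
    have e: "act (inv x) r = (\<lambda>i. \<Sum>c\<in>{a, b}. r c * act (inv x) (sroot c) i)"
      by (rule act_expand[OF xc]) (use assms r in \<open>auto simp: supp_def\<close>)
    have "nonneg (\<lambda>i. - act (inv x) r i)"
      unfolding e nonneg_def
    proof
      fix i
      have "(\<Sum>c\<in>{a, b}. r c * act (inv x) (sroot c) i) \<le> 0"
      proof (rule sum_nonpos)
        fix c assume "c \<in> {a, b}"
        then have "act (inv x) (sroot c) i \<le> 0" using neg[of c] by (simp add: nonneg_def)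
        moreover have "r c \<ge> 0" using r by (simp add: pos_def nonneg_def)
        ultimately show "r c * act (inv x) (sroot c) i \<le> 0" by (simp add: mult_nonneg_nonpos)
      qed
      then show "0 \<le> - (\<Sum>c\<in>{a, b}. r c * act (inv x) (sroot c) i)" by simp
    qed
    then show False using root_not_both[OF _ n] root_act[OF xc] r by (simp add: pos_def)
  qed
  obtain d where d: "d \<in> carrier G" "Inv d = {r \<in> Inv x. supp {a, b} r}"
    using left_proj[of x "{a, b}"] assms by auto
  have "Inv d \<subseteq> Inv y" using d *[OF assms(2,7,8)] Inv_pos by blast
  then have "wle d y" using assms d by (simp add: wle_def)
  moreover have "wle d x" using assms d by (auto simp: wle_def)
  moreover have "sroot a \<in> Inv d" "sroot b \<in> Inv d" using d assms by (simp_all add: supp_sroot)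
  ultimately show ?thesis by blast
qed

definition wmeet :: "'a \<Rightarrow> 'a \<Rightarrow> 'a \<Rightarrow> bool" where
  "wmeet x y z \<longleftrightarrow> wle z x \<and> wle z y \<and> (\<forall>u. wle u x \<and> wle u y \<longrightarrow> wle u z)"

text \<open>Among the lower bounds with a fixed common left descent a largest one comes from the
  induction. The candidates for two descents are comparable both ways, because
  \<open>pair_bound\<close> provides a lower bound that has both.\<close>

lemma meet_ex: "x \<in> carrier G \<Longrightarrow> y \<in> carrier G \<Longrightarrow> \<exists>z. wmeet x y z"
proof (induction "len x" arbitrary: x y rule: less_induct)
  case less
  show ?case
  proof (cases "\<exists>a\<in>S. sroot a \<in> Inv x \<and> sroot a \<in> Inv y")
    case False
    have "u = \<one>" if "wle u x" "wle u y" for u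
      using left_des_ex[of u] that False by (auto simp: wle_def)
    moreover have "wle \<one> x" "wle \<one> y" "wle \<one> \<one>" using less.prems by (auto simp: wle_def)
    ultimately have "wmeet x y \<one>" unfolding wmeet_def by blast
    then show ?thesis by blast
  next
    case True
    have step: "\<exists>z. wle z x \<and> wle z y \<and> sroot a \<in> Inv z \<and> (\<forall>u. wle u x \<and> wle u y \<and> sroot a \<in> Inv u \<longrightarrow> wle u z)"
      if a: "a \<in> S" "sroot a \<in> Inv x" "sroot a \<in> Inv y" for a
    proof -
      have c: "a \<otimes> x \<in> carrier G" "a \<otimes> y \<in> carrier G" using a S_closed less.prems by auto
      have nx: "sroot a \<notin> Inv (a \<otimes> x)" "sroot a \<notin> Inv (a \<otimes> y)"
        using Inv_left_sroot[OF less.prems(1) a(1)] Inv_left_sroot[OF less.prems(2) a(1)] a by auto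
      obtain z where z: "wmeet (a \<otimes> x) (a \<otimes> y) z"
        using less.hyps[OF _ c] len_left_Suc[OF less.prems(1) a(1,2)] by auto
      then have zc: "z \<in> carrier G" and nz: "sroot a \<notin> Inv z" using nx by (auto simp: wmeet_def wle_def)
      have "wle (a \<otimes> z) x" "wle (a \<otimes> z) y"
        using wle_left'[OF _ a(1) nx(1), of z] wle_left'[OF _ a(1) nx(2), of z] z a less.prems
        by (auto simp: wmeet_def)
      moreover have "sroot a \<in> Inv (a \<otimes> z)" using Inv_left_sroot zc a nz by blast
      moreover have "wle u (a \<otimes> z)" if u: "wle u x" "wle u y" "sroot a \<in> Inv u" for u
      proof -
        have uc: "u \<in> carrier G" using u by (simp add: wle_def)
        have "wle (a \<otimes> u) z" using z wle_left[OF u(1) a(1) u(3)] wle_left[OF u(2) a(1) u(3)] by (simp add: wmeet_def)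
        then have "wle (a \<otimes> (a \<otimes> u)) (a \<otimes> z)" by (rule wle_left'[OF _ a(1) nz])
        then show ?thesis using a uc by simp
      qed
      ultimately show ?thesis by blast
    qed
    then obtain a z where a: "a \<in> S" "sroot a \<in> Inv x" "sroot a \<in> Inv y"
      and z: "wle z x" "wle z y" "sroot a \<in> Inv z" "\<And>u. wle u x \<Longrightarrow> wle u y \<Longrightarrow> sroot a \<in> Inv u \<Longrightarrow> wle u z"
      using True by metis
    have "wle u z" if u: "wle u x" "wle u y" for u
    proof (cases "u = \<one>")
      case True
      then show ?thesis using z by (auto simp: wle_def)
    next
      case False
      have "u \<in> carrier G" using u by (simp add: wle_def)
      then obtain b where b: "b \<in> S" "sroot b \<in> Inv u" using left_des_ex[of u] False by blast
      then have bxy: "sroot b \<in> Inv x" "sroot b \<in> Inv y" using u by (auto simp: wle_def)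
      obtain z' where z': "wle z' x" "wle z' y" "\<And>u. wle u x \<Longrightarrow> wle u y \<Longrightarrow> sroot b \<in> Inv u \<Longrightarrow> wle u z'"
        using step[OF b(1) bxy] by blast
      obtain d where d: "wle d x" "wle d y" "sroot a \<in> Inv d" "sroot b \<in> Inv d"
        using pair_bound[OF less.prems a(1) b(1) a(2) bxy(1) a(3) bxy(2)] by blast
      have "sroot a \<in> Inv z'" using z'(3)[OF d(1,2,4)] d by (auto simp: wle_def)
      then have "wle z' z" using z z' by blast
      moreover have "wle u z'" using z' u b by blast
      ultimately show ?thesis using wle_trans by blast
    qed
    then have "wmeet x y z" using z unfolding wmeet_def by blast
    then show ?thesis by blast
  qed
qed

lemma meet_set_ex: "finite A \<Longrightarrow> A \<noteq> {} \<Longrightarrow> A \<subseteq> carrier G \<Longrightarrow>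
  \<exists>z. (\<forall>x\<in>A. wle z x) \<and> (\<forall>u. (\<forall>x\<in>A. wle u x) \<longrightarrow> wle u z)"
proof (induction A rule: finite_ne_induct)
  case (singleton x)
  then show ?case using wle_refl by (intro exI[of _ x]) auto
next
  case (insert x A)
  then obtain z where z: "\<forall>y\<in>A. wle z y" "\<And>u. \<forall>y\<in>A. wle u y \<Longrightarrow> wle u z" by auto
  have "z \<in> carrier G" using z(1) insert by (auto simp: wle_def)
  moreover have "x \<in> carrier G" using insert.prems by simp
  ultimately obtain m where m: "wle m x" "wle m z" "\<And>u. wle u x \<Longrightarrow> wle u z \<Longrightarrow> wle u m"
    using meet_ex[of x z] unfolding wmeet_def by metis
  have "wle m y" if "y \<in> A" for y using wle_trans[OF m(2)] z(1) that by simp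
  then show ?case using m z(2) by (intro exI[of _ m]) simp
qed

section \<open>The projection as a function\<close>

definition proj :: "'a list \<Rightarrow> 'a \<Rightarrow> 'a" where "proj C x = (THE w. \<exists>B. run C x w B)"

lemma proj_eq: "run C x w B \<Longrightarrow> proj C x = w"
  unfolding proj_def using run_det by blast

lemma proj_run: "x \<in> carrier G \<Longrightarrow> wd C \<Longrightarrow> \<exists>B. run C x (proj C x) B"
  using run_total proj_eq by metis

lemma proj_le: "x \<in> carrier G \<Longrightarrow> wd C \<Longrightarrow> wle (proj C x) x"
  using proj_run run_le by blast

lemma proj_closed: "x \<in> carrier G \<Longrightarrow> wd C \<Longrightarrow> proj C x \<in> carrier G"
  using proj_le by (simp add: wle_def)

lemma proj_sortable: "x \<in> carrier G \<Longrightarrow> wd C \<Longrightarrow> sortable C (proj C x)"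
  using proj_run run_sortable by blast

lemma proj_mono: "wle x y \<Longrightarrow> wd C \<Longrightarrow> wle (proj C x) (proj C y)"
  using run_mono proj_run unfolding wle_def by metis

lemma proj_sortable_id: "sortable C u \<Longrightarrow> proj C u = u"
  unfolding sortable_def using proj_eq by blast

lemma proj_max: "sortable C u \<Longrightarrow> wle u x \<Longrightarrow> wd C \<Longrightarrow> wle u (proj C x)"
  using proj_mono proj_sortable_id by metis

lemma proj_use: "sroot a \<in> Inv x \<Longrightarrow> x \<in> carrier G \<Longrightarrow> wd (a # C) \<Longrightarrow> proj (a # C) x = a \<otimes> proj (C @ [a]) (a \<otimes> x)"
  using proj_run[of "a \<otimes> x" "C @ [a]"] proj_eq run.use S_closed by fastforce

lemma proj_skip: "sroot a \<notin> Inv x \<Longrightarrow> x \<in> carrier G \<Longrightarrow> wd (a # C) \<Longrightarrow> proj (a # C) x = proj C x"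
  using proj_run[of x C] proj_eq run.skip by fastforce

lemma proj_front: assumes "sroot a \<in> Inv x" "x \<in> carrier G" "wd (a # C)" shows "sroot a \<in> Inv (proj (a # C) x)"
proof -
  have a: "a \<in> S" "a \<otimes> x \<in> carrier G" "wd (C @ [a])" using assms S_closed by auto
  have "sroot a \<notin> Inv (proj (C @ [a]) (a \<otimes> x))"
    using proj_le[OF a(2,3)] Inv_left_sroot[OF assms(2) a(1)] assms by (auto simp: wle_def)
  then show ?thesis using Inv_left_sroot proj_closed[OF a(2,3)] a assms by (simp add: proj_use)
qed

lemma D_left: assumes "w \<in> carrier G" "a \<in> S" "sroot a \<in> Inv w" "t \<in> Des (a \<otimes> w)" shows "t \<in> Des w"
proof (rule ccontr)
  assume n: "t \<notin> Des w"
  have t: "t \<in> S" using assms D_S by simp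
  have nt: "nonneg (act w (sroot t))" using n t by (simp add: Des_def)
  have "\<not> nonneg (reflect a (act w (sroot t)))" using assms by (simp add: Des_def act_mult S_closed act_S)
  then have "act w (sroot t) = sroot a" using nonneg_reflect root_act[OF assms(1) root_sroot[OF t]] nt assms(2) by blast
  then have "act (inv w) (sroot a) = sroot t" using act_inv_cancel[OF assms(1)] by metis
  then show False using assms nonneg_sroot by (simp add: Inv_def)
qed

lemma D_left': assumes "w \<in> carrier G" "a \<in> S" "t \<in> Des w" "croot w t \<noteq> sroot a"
  shows "t \<in> Des (a \<otimes> w)" "croot (a \<otimes> w) t = reflect a (croot w t)"
proof -
  show e: "croot (a \<otimes> w) t = reflect a (croot w t)"
    using assms act_neg[of a "act w (sroot t)"] by (simp add: croot_def act_mult S_closed act_S)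
  have p: "pos (reflect a (croot w t))" using pos_reflect croot_pos assms by simp
  have "act (a \<otimes> w) (sroot t) = (\<lambda>i. - reflect a (croot w t) i)" using croot_swap[OF e] .
  then have "\<not> nonneg (act (a \<otimes> w) (sroot t))" using p root_not_both[of "reflect a (croot w t)"] by (auto simp: pos_def)
  then show "t \<in> Des (a \<otimes> w)" using D_S[OF assms(3)] by (simp add: Des_def)
qed

lemma cover_conj: assumes "w \<in> carrier G" "a \<in> S" "s \<in> Des w" "croot w s = sroot a"
  shows "a \<otimes> w = w \<otimes> s"
  by (rule conj_simple[OF assms(1) D_S[OF assms(3)] assms(2), of "-1"]) (use croot_swap[OF assms(4)] in simp_all)

section \<open>Cover roots under projection and removal\<close>

lemma commute_cover: assumes "w \<in> carrier G" "s \<in> Des w" "t \<in> Des w" "s \<otimes> t = t \<otimes> s" "s \<noteq> t"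
  shows "bil s t = 0"
  using bil_zero_iff assms D_S by blast

lemma sortable_front_drop: assumes "sortable (C @ [a]) w" "wd (a # C)" "\<And>r. r \<in> Inv w \<Longrightarrow> r a = 0"
  shows "sortable C w"
  using sortable_insert[of C a "[]" w] assms by (auto simp: sortable_def)

lemma sortable_back_add: assumes "sortable C w" "wd (a # C)" shows "sortable (C @ [a]) w"
proof -
  have "r a = 0" if "r \<in> Inv w" for r using sortable_supp[OF assms(1) _ that] assms by (auto simp: supp_def)
  then show ?thesis using sortable_insert[of C a "[]" w] assms by (auto simp: sortable_def)
qed

text \<open>The delicate case removes the initial root \<open>sroot a\<close>, then a cover root of
  \<open>w\<close>. The other cover roots avoid \<open>a\<close> by \<open>cover_coord\<close> and
  are fixed by \<open>a\<close> by orthogonality, so all of \<open>a \<otimes> w\<close> avoids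
  \<open>a\<close> and is sortable for the shorter word.\<close>

lemma commuting_sortable: "sortable C w \<Longrightarrow> wd C \<Longrightarrow> (\<forall>s\<in>Des w. \<forall>t\<in>Des w. s \<otimes> t = t \<otimes> s) \<Longrightarrow> wle u w \<Longrightarrow>
  Inv w - Inv u \<subseteq> croot w ` Des w \<Longrightarrow> sortable C u"
proof (induction "len w + length C" arbitrary: C w u rule: less_induct)
  case less
  have c: "w \<in> carrier G" "u \<in> carrier G" using less.prems by (auto simp: wle_def)
  show ?case
  proof (cases C)
    case Nil
    then have "w = \<one>" using less.prems sortable_Nil by simp
    then have "u = \<one>" using wle_antisym less.prems c by (auto simp: wle_def)
    then show ?thesis using Nil sortable_Nil by simp
  next
    case (Cons a C')
    have a: "a \<in> S" and wda: "wd (a # C')" "wd (C' @ [a])" "wd C'" using less.prems Cons by auto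
    show ?thesis
    proof (cases "sroot a \<in> Inv w")
      case False
      then have fu: "sroot a \<notin> Inv u" using less.prems by (auto simp: wle_def)
      have s: "sortable C' w" using sortable_skip[OF False wda(1)] less.prems Cons by simp
      have "sortable C' u" by (rule less.hyps[OF _ s wda(3) less.prems(3-5)]) (use Cons in simp)
      then show ?thesis using sortable_skip[OF fu wda(1)] Cons by simp
    next
      case True
      have l: "len w = Suc (len (a \<otimes> w))" using len_left_Suc c a True by simp
      have s: "sortable (C' @ [a]) (a \<otimes> w)" using sortable_use[OF True wda(1) c(1)] less.prems Cons by simp
      have aw: "a \<otimes> w \<in> carrier G" using a S_closed c by simp
      have comm: "\<forall>s\<in>Des (a \<otimes> w). \<forall>t\<in>Des (a \<otimes> w). s \<otimes> t = t \<otimes> s"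
        using D_left[OF c(1) a True] less.prems(3) by blast
      show ?thesis
      proof (cases "sroot a \<in> Inv u")
        case au: True
        have le: "wle (a \<otimes> u) (a \<otimes> w)" using wle_left[OF less.prems(4) a au] .
        have sub: "Inv (a \<otimes> w) - Inv (a \<otimes> u) \<subseteq> croot (a \<otimes> w) ` Des (a \<otimes> w)"
        proof
          fix r assume r: "r \<in> Inv (a \<otimes> w) - Inv (a \<otimes> u)"
          then have rp: "pos r" and rn: "r \<noteq> sroot a" using Inv_pos Inv_left_sroot[OF c(1) a] True by auto
          then have "reflect a r \<in> Inv w - Inv u" using r Inv_left[OF c(1) a rp rn] Inv_left[OF c(2) a rp rn] by blast
          then obtain t where t: "t \<in> Des w" "reflect a r = croot w t" using less.prems(5) by blast
          have "croot w t \<noteq> sroot a" using \<open>reflect a r \<in> Inv w - Inv u\<close> t au by auto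
          moreover have "r = reflect a (croot w t)" using t(2) reflect_reflect[OF a] by metis
          ultimately have "t \<in> Des (a \<otimes> w)" "r = croot (a \<otimes> w) t" using D_left'[OF c(1) a t(1)] by auto
          then show "r \<in> croot (a \<otimes> w) ` Des (a \<otimes> w)" by blast
        qed
        have "sortable (C' @ [a]) (a \<otimes> u)" by (rule less.hyps[OF _ s wda(2) comm le sub]) (use l Cons in simp)
        then show ?thesis using sortable_use[OF au wda(1) c(2)] Cons by simp
      next
        case au: False
        then obtain s1 where s1: "s1 \<in> Des w" "croot w s1 = sroot a" using True less.prems(5) by (metis DiffI imageE subsetD)
        have s1S: "s1 \<in> S" using s1 D_S by simp
        have ws: "a \<otimes> w = w \<otimes> s1" using cover_conj c a s1 by blast
        have Iw: "Inv (a \<otimes> w) = Inv w - {sroot a}" using Inv_right[OF c(1) s1(1)] ws s1 by simp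
        have cov: "croot (a \<otimes> w) t = croot w t \<and> supp (set C') (croot w t)" if t: "t \<in> Des w" "t \<noteq> s1" for t
        proof -
          have z: "croot w t a = 0" using cover_coord[OF _ wda(1) s1 t] less.prems Cons by simp
          have "bil s1 t = 0" using commute_cover[OF c(1) s1(1) t(1)] less.prems(3) s1 t by auto
          then have "form (sroot a) (croot w t) = 0" using form_croot[OF c(1) s1(1) t(1)] s1 by simp
          then have "reflect a (croot w t) = croot w t" by (simp add: reflect_def)
          moreover have "croot w t \<noteq> sroot a" using z by (auto simp: sroot_def)
          ultimately have "croot (a \<otimes> w) t = croot w t" using D_left'[OF c(1) a t(1)] by simp
          moreover have "supp (set (a # C')) (croot w t)" using sortable_supp[OF _ _ croot_Inv[OF c(1) t(1)]] less.prems Cons by blast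
          then have "supp (set C') (croot w t)" using z by (auto simp: supp_def)
          ultimately show ?thesis by blast
        qed
        have Dne: "t \<noteq> s1" if "t \<in> Des (a \<otimes> w)" for t
          using D_right[OF c(1) s1S] that s1 ws by auto
        have supp: "supp (set C') r" if "r \<in> Inv (a \<otimes> w)" for r
        proof (rule cover_supp[OF aw _ _ that])
          show "set C' \<subseteq> S" using wda by simp
          fix t assume "t \<in> Des (a \<otimes> w)"
          then show "supp (set C') (croot (a \<otimes> w) t)" using cov D_left[OF c(1) a True] Dne by simp
        qed
        have s': "sortable C' (a \<otimes> w)"
          by (rule sortable_front_drop[OF s wda(1)]) (use supp wda in \<open>auto simp: supp_def\<close>)
        have le: "wle u (a \<otimes> w)" using less.prems(4) au Iw c aw by (auto simp: wle_def)
        have sub: "Inv (a \<otimes> w) - Inv u \<subseteq> croot (a \<otimes> w) ` Des (a \<otimes> w)"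
        proof
          fix r assume "r \<in> Inv (a \<otimes> w) - Inv u"
          then have r: "r \<in> Inv w - Inv u" "r \<noteq> sroot a" using Iw by auto
          then obtain t where t: "t \<in> Des w" "r = croot w t" using less.prems(5) by blast
          have "t \<noteq> s1" using t r s1 by auto
          then show "r \<in> croot (a \<otimes> w) ` Des (a \<otimes> w)"
            using cov[OF t(1)] D_left'(1)[OF c(1) a t(1)] t r by (metis image_eqI)
        qed
        have "sortable C' u" by (rule less.hyps[OF _ s' wda(3) comm le sub]) (use l Cons in simp)
        then show ?thesis using sortable_skip[OF au wda(1)] Cons by simp
      qed
    qed
  qed
qed

text \<open>Since the cover roots are orthogonal, descending along one leaves the others in place as
  cover roots.\<close>

lemma commuting_remove: assumes "w \<in> carrier G" "\<forall>s\<in>Des w. \<forall>t\<in>Des w. s \<otimes> t = t \<otimes> s" "E \<subseteq> Des w"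
  shows "\<exists>u\<in>carrier G. Inv u = Inv w - croot w ` E \<and> (\<forall>t\<in>Des w - E. t \<in> Des u \<and> croot u t = croot w t)"
proof -
  have "finite E" using assms(3) finite_S D_S by (meson finite_subset subsetD subsetI)
  then show ?thesis using assms(3)
  proof (induction E rule: finite_induct)
    case empty
    then show ?case using assms by auto
  next
    case (insert s E)
    then obtain u where u: "u \<in> carrier G" "Inv u = Inv w - croot w ` E"
      "\<And>t. t \<in> Des w - E \<Longrightarrow> t \<in> Des u \<and> croot u t = croot w t" by auto
    have s: "s \<in> Des u" "croot u s = croot w s" "s \<in> Des w" "s \<in> S" using u(3)[of s] insert D_S by auto
    have us: "u \<otimes> s \<in> carrier G" using u s S_closed by simp
    have I: "Inv (u \<otimes> s) = Inv w - croot w ` insert s E" using Inv_right[OF u(1) s(1)] u(2) s(2) by auto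
    have "t \<in> Des (u \<otimes> s) \<and> croot (u \<otimes> s) t = croot w t" if t: "t \<in> Des w - insert s E" for t
    proof -
      have tS: "t \<in> S" using t D_S by auto
      have tu: "t \<in> Des u" "croot u t = croot w t" using u(3)[of t] t by auto
      have "bil s t = 0" using commute_cover[OF assms(1) s(3), of t] t assms(2) s(3) by auto
      then have "reflect s (sroot t) = sroot t" using form_sroot_sroot[OF s(4) tS] by (simp add: reflect_def)
      then have "act (u \<otimes> s) (sroot t) = act u (sroot t)" using act_right[OF u(1) s(4)] by simp
      then show ?thesis using tu by (simp add: Des_def croot_def)
    qed
    then show ?case using us I by blast
  qed
qed

text \<open>The use of alignment: the cover root avoids \<open>a\<close>, and the projection for the
  shorter word keeps such inversions.\<close>

lemma initial_cover_proj: assumes "sortable (a # C) w" "wd (a # C)" "s \<in> Des w" "croot w s = sroot a" "t \<in> Des w" "t \<noteq> s"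
  shows "croot w t \<in> Inv (proj C w)"
proof -
  have w: "w \<in> carrier G" using assms by (simp add: sortable_def)
  have wdC: "wd C" using assms by simp
  obtain B where B: "run C w (proj C w) B" using proj_run[OF w wdC] by blast
  have "supp (set (a # C)) (croot w t)" using sortable_supp[OF assms(1,2) croot_Inv[OF w assms(5)]] .
  then have "supp (set C) (croot w t)" using cover_coord[OF assms] by (auto simp: supp_def)
  then show ?thesis
    using aligned_run[OF B w wdC aligned_skip[OF sortable_aligned[OF assms(1,2)] assms(2)]] croot_Inv[OF w assms(5)] by blast
qed

lemma proj_no_front: assumes "wd (a # C)" "x \<in> carrier G" shows "sroot a \<notin> Inv (proj C x)"
proof
  assume "sroot a \<in> Inv (proj C x)"
  then have "supp (set C) (sroot a)" using sortable_supp[OF proj_sortable] assms by auto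
  then have "sroot a a = 0" using assms unfolding supp_def by simp
  then show False by (simp add: sroot_def)
qed

text \<open>This makes the projected coatoms the lower covers among sortable elements. In the
  critical case \<open>croot w s = sroot a\<close>, the element \<open>proj C' w\<close> is
  sortable, lies below \<open>w \<otimes> s\<close> and already has the root.\<close>

lemma cover_proj: "sortable C w \<Longrightarrow> wd C \<Longrightarrow> s \<in> Des w \<Longrightarrow> r \<in> Des w \<Longrightarrow> s \<noteq> r \<Longrightarrow> croot w r \<in> Inv (proj C (w \<otimes> s))"
proof (induction "len w + length C" arbitrary: C w rule: less_induct)
  case less
  have w: "w \<in> carrier G" using less.prems by (simp add: sortable_def)
  have sS: "s \<in> S" using less.prems D_S by simp
  have ws: "w \<otimes> s \<in> carrier G" using w sS S_closed by simp
  have Iws: "Inv (w \<otimes> s) = Inv w - {croot w s}" using Inv_right w less.prems by simp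
  show ?case
  proof (cases C)
    case Nil
    then show ?thesis using less.prems sortable_Nil croot_Inv by fastforce
  next
    case (Cons a C')
    have a: "a \<in> S" and wda: "wd (a # C')" "wd (C' @ [a])" "wd C'" using less.prems Cons by auto
    show ?thesis
    proof (cases "sroot a \<in> Inv w")
      case False
      then have s: "sortable C' w" using sortable_skip[OF False wda(1)] less.prems Cons by simp
      have "croot w r \<in> Inv (proj C' (w \<otimes> s))"
        by (rule less.hyps[OF _ s wda(3) less.prems(3-5)]) (use Cons in simp)
      then show ?thesis using proj_skip[OF _ ws wda(1)] False Iws Cons by auto
    next
      case True
      show ?thesis
      proof (cases "croot w s = sroot a")
        case cs: True
        let ?x = "proj C' w"
        have d: "croot w r \<in> Inv ?x"
          using initial_cover_proj[OF _ wda(1) less.prems(3) cs less.prems(4)] less.prems Cons by auto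
        have nx: "sroot a \<notin> Inv ?x" using proj_no_front wda w by blast
        have "wle ?x (w \<otimes> s)"
          using proj_le[OF w wda(3)] nx Iws cs ws by (auto simp: wle_def)
        moreover have "sortable (a # C') ?x" using sortable_skip[OF nx wda(1)] proj_sortable[OF w wda(3)] by simp
        ultimately have "wle ?x (proj (a # C') (w \<otimes> s))" using proj_max wda by blast
        then show ?thesis using d Cons by (auto simp: wle_def)
      next
        case cs: False
        have in': "sroot a \<in> Inv (w \<otimes> s)" using Iws True cs by auto
        show ?thesis
        proof (cases "croot w r = sroot a")
          case True
          then show ?thesis using proj_front[OF in' ws wda(1)] Cons by simp
        next
          case cr: False
          have aw: "a \<otimes> w \<in> carrier G" using a w S_closed by simp
          have s': "sortable (C' @ [a]) (a \<otimes> w)" using sortable_use[OF True wda(1) w] less.prems Cons by simp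
          have "croot (a \<otimes> w) r \<in> Inv (proj (C' @ [a]) (a \<otimes> w \<otimes> s))"
            by (rule less.hyps[OF _ s' wda(2) D_left'(1)[OF w a less.prems(3) cs] D_left'(1)[OF w a less.prems(4) cr] less.prems(5)])
              (use len_left_Suc[OF w a True] Cons in simp)
          then have "reflect a (croot w r) \<in> Inv (proj (C' @ [a]) (a \<otimes> (w \<otimes> s)))"
            using D_left'(2)[OF w a less.prems(4) cr] a w sS S_closed by (simp add: m_assoc)
          moreover have "proj (C' @ [a]) (a \<otimes> (w \<otimes> s)) \<in> carrier G"
            using proj_closed[of "a \<otimes> (w \<otimes> s)" "C' @ [a]"] wda(2) ws a S_closed by blast
          ultimately show ?thesis
            using Inv_left[OF _ a croot_pos[OF w less.prems(4)] cr] proj_use[OF in' ws wda(1)] Cons by simp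
        qed
      qed
    qed
  qed
qed

text \<open>When \<open>croot w s\<close> is the initial root, sortability of
  \<open>w \<otimes> s\<close> means that its inversions avoid \<open>a\<close>; without commutation
  its cover root for \<open>t\<close> would have coordinate at least \<open>- 2 * bil s t\<close> at
  \<open>a\<close>.\<close>

lemma sortable_commute: "sortable C w \<Longrightarrow> sortable C (w \<otimes> s) \<Longrightarrow> sortable C (w \<otimes> t) \<Longrightarrow> wd C \<Longrightarrow> s \<in> Des w \<Longrightarrow> t \<in> Des w \<Longrightarrow> s \<noteq> t \<Longrightarrow>
  bil s t = 0"
proof (induction "len w + length C" arbitrary: C w rule: less_induct)
  case less
  have w: "w \<in> carrier G" using less.prems by (simp add: sortable_def)
  have st: "s \<in> S" "t \<in> S" using less.prems D_S by auto
  have I: "Inv (w \<otimes> s) = Inv w - {croot w s}" "Inv (w \<otimes> t) = Inv w - {croot w t}" using Inv_right w less.prems by auto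
  show ?case
  proof (cases C)
    case Nil
    then show ?thesis using less.prems sortable_Nil croot_Inv[OF w, of s] by fastforce
  next
    case (Cons a C')
    have a: "a \<in> S" and wda: "wd (a # C')" "wd (C' @ [a])" "wd C'" using less.prems Cons by auto
    have base: "bil s t = 0" if "s \<in> Des w" "t \<in> Des w" "s \<noteq> t" "croot w s = sroot a" "sortable C (w \<otimes> s)" for s t
    proof (rule ccontr)
      assume n: "bil s t \<noteq> 0"
      have st: "s \<in> S" "t \<in> S" using that D_S by auto
      have b: "bil s t < 0" using bil_nonpos[OF st that(3)] n by simp
      have wsc: "w \<otimes> s \<in> carrier G" using w st S_closed by simp
      have "sroot a \<notin> Inv (w \<otimes> s)" using Inv_right[OF w that(1)] that by simp
      then have "sortable C' (w \<otimes> s)" using sortable_skip wda that Cons by blast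
      then have sup: "r a = 0" if "r \<in> Inv (w \<otimes> s)" for r using sortable_supp[OF _ wda(3) that] wda by (auto simp: supp_def)
      have "act (w \<otimes> s) (sroot t) = act w (\<lambda>i. 1 * sroot t i + (- 2 * bil s t) * sroot s i)"
        using act_right[OF w st(1)] form_sroot_sroot[OF st] reflect_alt[of s "sroot t"] by simp
      also have "\<dots> = (\<lambda>i. 1 * act w (sroot t) i + (- 2 * bil s t) * act w (sroot s) i)" by (rule act_lin[OF w])
      finally have e: "croot (w \<otimes> s) t = (\<lambda>i. croot w t i + (- 2 * bil s t) * croot w s i)"
        by (auto simp: croot_def)
      have p: "nonneg (croot w t)" using croot_pos[OF w that(2)] by (simp add: pos_def)
      have "croot (w \<otimes> s) t a \<ge> - 2 * bil s t" using p that(4) unfolding e by (simp add: nonneg_def sroot_def)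
      then have pa: "croot (w \<otimes> s) t a > 0" using b by linarith
      then have "\<not> nonneg (act (w \<otimes> s) (sroot t))" by (auto simp: nonneg_def croot_def not_le intro!: exI[of _ a])
      then have "t \<in> Des (w \<otimes> s)" using st by (simp add: Des_def)
      then show False using sup[OF croot_Inv[OF wsc]] pa by fastforce
    qed
    show ?thesis
    proof (cases "croot w s = sroot a \<or> croot w t = sroot a")
      case True
      then show ?thesis using base[of s t] base[of t s] less.prems bil_sym[OF st] by auto
    next
      case ne: False
      show ?thesis
      proof (cases "sroot a \<in> Inv w")
        case False
        then have "sroot a \<notin> Inv (w \<otimes> s)" "sroot a \<notin> Inv (w \<otimes> t)" using I by auto
        then have "sortable C' w" "sortable C' (w \<otimes> s)" "sortable C' (w \<otimes> t)"
          using sortable_skip[OF _ wda(1)] False less.prems(1-3) Cons by blast+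
        then show ?thesis
          by (rule less.hyps[OF _ _ _ _ wda(3) less.prems(5-7), rotated 1]) (use Cons in simp)
      next
        case True
        have in': "sroot a \<in> Inv (w \<otimes> s)" "sroot a \<in> Inv (w \<otimes> t)" unfolding I using True ne by fastforce+
        have 1: "sortable (C' @ [a]) (a \<otimes> w)" using sortable_use[OF True wda(1) w] less.prems Cons by simp
        have 2: "sortable (C' @ [a]) (a \<otimes> w \<otimes> s)" using sortable_use[OF in'(1) wda(1)] less.prems(2) Cons w st a S_closed by (simp add: m_assoc)
        have 3: "sortable (C' @ [a]) (a \<otimes> w \<otimes> t)" using sortable_use[OF in'(2) wda(1)] less.prems(3) Cons w st a S_closed by (simp add: m_assoc)
        show ?thesis
        proof (rule less.hyps[OF _ 1 2 3 wda(2) _ _ less.prems(7)])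
          show "len (a \<otimes> w) + length (C' @ [a]) < len w + length C"
            using len_left_Suc[OF w a True] Cons by simp
          show "s \<in> Des (a \<otimes> w)" "t \<in> Des (a \<otimes> w)" using D_left'(1)[OF w a] less.prems(5,6) ne by metis+
        qed
      qed
    qed
  qed
qed

subsection \<open>Gaps below non-commuting descents\<close>

definition in_span :: "('a \<Rightarrow> real) \<Rightarrow> ('a \<Rightarrow> real) \<Rightarrow> ('a \<Rightarrow> real) \<Rightarrow> bool" where
  "in_span u v r \<longleftrightarrow> (\<exists>p q. r = (\<lambda>i. p * u i + q * v i))"

lemma in_span_trans: assumes "in_span u v r" "in_span a b u" "in_span a b v" shows "in_span a b r"
proof -
  obtain p q where 1: "r = (\<lambda>i. p * u i + q * v i)" using assms by (auto simp: in_span_def)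
  obtain p1 q1 where 2: "u = (\<lambda>i. p1 * a i + q1 * b i)" using assms by (auto simp: in_span_def)
  obtain p2 q2 where 3: "v = (\<lambda>i. p2 * a i + q2 * b i)" using assms by (auto simp: in_span_def)
  have "r = (\<lambda>i. (p * p1 + q * p2) * a i + (p * q1 + q * q2) * b i)"
    unfolding 1 2 3 by (auto simp: algebra_simps)
  then show ?thesis unfolding in_span_def by blast
qed

lemma in_span_l: "in_span u v u" and in_span_r: "in_span u v v"
  unfolding in_span_def by (rule exI[of _ 1], rule exI[of _ 0], simp) (rule exI[of _ 0], rule exI[of _ 1], simp)

lemma in_span_neg: "in_span u v r \<Longrightarrow> in_span u v (\<lambda>i. - r i)"
  unfolding in_span_def by (elim exE, rule_tac x="-p" in exI, rule_tac x="-q" in exI) auto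

lemma act_step: assumes "w \<in> carrier G" "j \<in> S" "i \<in> S"
  shows "act (w \<otimes> j) (sroot i) = (\<lambda>x. 1 * act w (sroot i) x + (- 2 * bil j i) * act w (sroot j) x)"
proof -
  have "act (w \<otimes> j) (sroot i) = act w (\<lambda>x. 1 * sroot i x + (- 2 * form (sroot j) (sroot i)) * sroot j x)"
    using act_right[OF assms(1,2)] reflect_alt[of j "sroot i"] by simp
  then show ?thesis using act_lin[OF assms(1), of 1 "sroot i" "- 2 * form (sroot j) (sroot i)" "sroot j"] form_sroot_sroot assms by simp
qed

lemma in_span_step: assumes "w \<in> carrier G" "s \<in> S" "t \<in> S" "j \<in> {s, t}" "i \<in> {s, t}"
  shows "in_span (act w (sroot s)) (act w (sroot t)) (act (w \<otimes> j) (sroot i))"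
proof -
  have "j \<in> S" "i \<in> S" using assms by auto
  then have "in_span (act w (sroot i)) (act w (sroot j)) (act (w \<otimes> j) (sroot i))"
    using act_step[OF assms(1)] unfolding in_span_def by blast
  then show ?thesis using in_span_trans in_span_l in_span_r assms(4,5) by blast
qed

text \<open>The minimal representative of the coset of \<open>w\<close> modulo the subgroup generated by \<open>s\<close>
  and \<open>t\<close>.\<close>
lemma coset_min: "w \<in> carrier G \<Longrightarrow> s \<in> S \<Longrightarrow> t \<in> S \<Longrightarrow> \<exists>q. wle q w \<and> s \<notin> Des q \<and> t \<notin> Des q \<and>
   (\<forall>r\<in>Inv w - Inv q. in_span (act w (sroot s)) (act w (sroot t)) r) \<and>
   in_span (act q (sroot s)) (act q (sroot t)) (act w (sroot s)) \<and> in_span (act q (sroot s)) (act q (sroot t)) (act w (sroot t))"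
proof (induction "len w" arbitrary: w rule: less_induct)
  case less
  show ?case
  proof (cases "s \<in> Des w \<or> t \<in> Des w")
    case False
    then show ?thesis using wle_refl less.prems in_span_l in_span_r by (intro exI[of _ w]) auto
  next
    case True
    then obtain j where j: "j \<in> {s, t}" "j \<in> Des w" by blast
    have jS: "j \<in> S" using j less.prems by auto
    have wj: "w \<otimes> j \<in> carrier G" using jS S_closed less.prems by simp
    have l: "len (w \<otimes> j) < len w" using len_des[OF less.prems(1) jS] j by (simp add: Des_def)
    obtain q where q: "wle q (w \<otimes> j)" "s \<notin> Des q" "t \<notin> Des q"
      "\<And>r. r \<in> Inv (w \<otimes> j) - Inv q \<Longrightarrow> in_span (act (w \<otimes> j) (sroot s)) (act (w \<otimes> j) (sroot t)) r"
      "in_span (act q (sroot s)) (act q (sroot t)) (act (w \<otimes> j) (sroot s))"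
      "in_span (act q (sroot s)) (act q (sroot t)) (act (w \<otimes> j) (sroot t))"
      using less.hyps[OF l wj less.prems(2,3)] by blast
    have st1: "in_span (act w (sroot s)) (act w (sroot t)) (act (w \<otimes> j) (sroot i))" if "i \<in> {s, t}" for i
      using in_span_step[OF less.prems j(1) that] .
    have st2: "in_span (act (w \<otimes> j) (sroot s)) (act (w \<otimes> j) (sroot t)) (act w (sroot i))" if "i \<in> {s, t}" for i
      using in_span_step[OF wj less.prems(2,3) j(1) that] less.prems jS by simp
    have 1: "wle q w" using wle_trans[OF q(1) wle_right[OF less.prems(1) j(2)]] .
    have 2: "in_span (act w (sroot s)) (act w (sroot t)) r" if r: "r \<in> Inv w - Inv q" for r
    proof (cases "r = croot w j")
      case True
      have "in_span (act w (sroot s)) (act w (sroot t)) (act w (sroot j))" using j(1) in_span_l in_span_r by blast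
      then show ?thesis unfolding True croot_def by (rule in_span_neg)
    next
      case False
      then have "r \<in> Inv (w \<otimes> j) - Inv q" using r Inv_right[OF less.prems(1) j(2)] by blast
      then show ?thesis using in_span_trans[OF q(4)] st1 by blast
    qed
    have 3: "in_span (act q (sroot s)) (act q (sroot t)) (act w (sroot i))" if "i \<in> {s, t}" for i
      using in_span_trans[OF st2[OF that] q(5,6)] .
    show ?thesis using 1 2 3 q by (intro exI[of _ q]) blast
  qed
qed

lemma nonneg_two: assumes "s \<noteq> t" "nonneg (\<lambda>i. p * sroot s i + q * sroot t i)" shows "0 \<le> p" "0 \<le> q"
  using assms(2)[unfolded nonneg_def, rule_format, of s] assms(2)[unfolded nonneg_def, rule_format, of t] assms(1)
  by (simp_all add: sroot_def)

text \<open>Pulled back by \<open>inv q\<close>, the root lies in the plane of \<open>s\<close> and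
  \<open>t\<close>, so its coefficients agree in sign; a negative sign would carry over to the root
  itself.\<close>

lemma span_coef: assumes "q \<in> carrier G" "s \<in> S" "t \<in> S" "s \<noteq> t" "nonneg (act q (sroot s))" "nonneg (act q (sroot t))"
  "pos (\<lambda>i. p * act q (sroot s) i + p' * act q (sroot t) i)"
  shows "0 \<le> p" "0 \<le> p'"
proof -
  let ?r = "\<lambda>i. p * act q (sroot s) i + p' * act q (sroot t) i"
  have qc: "inv q \<in> carrier G" using assms by simp
  have e: "act (inv q) ?r = (\<lambda>i. p * sroot s i + p' * sroot t i)"
    using act_lin[OF qc] act_inv_cancel[OF assms(1)] by simp
  have rt: "is_root (act (inv q) ?r)" using root_act[OF qc] assms(7) by (simp add: pos_def)
  have "nonneg (act (inv q) ?r)"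
  proof (rule ccontr)
    assume "\<not> ?thesis"
    then have n: "nonneg (\<lambda>i. - act (inv q) ?r i)" using root_sign rt by blast
    then have "nonneg (\<lambda>i. (- p) * sroot s i + (- p') * sroot t i)" unfolding e by (simp add: algebra_simps)
    then have "p \<le> 0" "p' \<le> 0" using nonneg_two[OF assms(4)] by fastforce+
    then have "nonneg (\<lambda>i. (- p) * act q (sroot s) i + (- p') * act q (sroot t) i)" by (intro nonneg_comb[OF assms(5,6)]) auto
    then have "nonneg (\<lambda>i. - ?r i)" by (simp add: algebra_simps)
    then show False using root_not_both[of ?r] assms(7) by (simp add: pos_def)
  qed
  then show "0 \<le> p" "0 \<le> p'" using nonneg_two[OF assms(4)] unfolding e by blast+
qed

lemma span_croot: "in_span (act w (sroot s)) (act w (sroot t)) r \<longleftrightarrow> in_span (croot w s) (croot w t) r"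
proof -
  have "in_span (croot w s) (croot w t) (act w (sroot s))" "in_span (croot w s) (croot w t) (act w (sroot t))"
    using in_span_neg[OF in_span_l[of "croot w s" "croot w t"]] in_span_neg[OF in_span_r[of "croot w s" "croot w t"]] by (simp_all add: croot_def)
  moreover have "in_span (act w (sroot s)) (act w (sroot t)) (croot w s)" "in_span (act w (sroot s)) (act w (sroot t)) (croot w t)"
    using in_span_neg[OF in_span_l] in_span_neg[OF in_span_r] by (simp_all add: croot_def)
  ultimately show ?thesis using in_span_trans by blast
qed

text \<open>An inversion of \<open>w\<close> in this plane is a nonnegative combination of the two
  cover roots. If \<open>inv g\<close> keeps both nonnegative, it keeps the combination nonnegative
  as well.\<close>

lemma low_span: assumes "wle g w" "s \<in> Des w" "t \<in> Des w" "s \<noteq> t" "croot w s \<notin> Inv g" "croot w t \<notin> Inv g" "r \<in> Inv g"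
  shows "\<not> in_span (croot w s) (croot w t) r"
proof
  assume "in_span (croot w s) (croot w t) r"
  then obtain p q where r: "r = (\<lambda>i. p * croot w s i + q * croot w t i)" by (auto simp: in_span_def)
  have c: "w \<in> carrier G" "inv w \<in> carrier G" "inv g \<in> carrier G" using assms by (auto simp: wle_def)
  have rw: "r \<in> Inv w" using assms by (auto simp: wle_def)
  have e: "act (inv w) (croot w u) = (\<lambda>i. - sroot u i)" for u using c act_inv_cancel by (simp add: croot_def act_neg)
  have ew: "act (inv w) r = (\<lambda>i. p * - sroot s i + q * - sroot t i)" unfolding r act_lin[OF c(2)] e ..
  have "nonneg (\<lambda>i. - act (inv w) r i)"
    using rw root_sign[of "act (inv w) r"] root_act[OF c(2)] by (simp add: Inv_def pos_def)
  then have "nonneg (\<lambda>i. p * sroot s i + q * sroot t i)" unfolding ew by (simp add: algebra_simps)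
  then have pq: "0 \<le> p" "0 \<le> q" using nonneg_two[OF assms(4)] by blast+
  have "nonneg (act (inv g) (croot w s))" "nonneg (act (inv g) (croot w t))"
    using assms croot_pos c by (auto simp: Inv_def)
  then have "nonneg (act (inv g) r)" unfolding r act_lin[OF c(3)] using nonneg_comb pq by blast
  then show False using assms(7) by (simp add: Inv_def)
qed

lemma cover_next: assumes "w \<in> carrier G" "s \<in> Des w" "t \<in> Des w" "s \<noteq> t"
  shows "s \<in> Des (w \<otimes> t)" "croot (w \<otimes> t) s = (\<lambda>i. 1 * croot w s i + (- 2 * bil t s) * croot w t i)"
proof -
  have st: "s \<in> S" "t \<in> S" using assms D_S by blast+
  show e: "croot (w \<otimes> t) s = (\<lambda>i. 1 * croot w s i + (- 2 * bil t s) * croot w t i)"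
    using act_step[OF assms(1) st(2,1)] by (auto simp: croot_def algebra_simps)
  have "nonneg (croot (w \<otimes> t) s)" unfolding e
    by (rule nonneg_comb) (use croot_pos[OF assms(1)] assms bil_nonpos[OF st(2,1)] in \<open>auto simp: pos_def\<close>)
  moreover have "w \<otimes> t \<in> carrier G" using assms st S_closed by simp
  then have "is_root (act (w \<otimes> t) (sroot s))" using root_act root_sroot st by blast
  ultimately show "s \<in> Des (w \<otimes> t)" using root_not_both st by (auto simp: Des_def croot_def)
qed

text \<open>For non-commuting descents \<open>s\<close> and \<open>t\<close>, a gap element is an element of the chain from the
  bottom of the polygon below \<open>w\<close> to \<open>w \<otimes> t\<close> on which the projection to sortable elements is not
  constant.\<close>
definition gap :: "'a list \<Rightarrow> 'a \<Rightarrow> 'a \<Rightarrow> 'a \<Rightarrow> 'a \<Rightarrow> bool" where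
  "gap C w s t y \<longleftrightarrow> wle y (w \<otimes> t) \<and> (\<forall>r\<in>Inv w. \<not> in_span (croot w s) (croot w t) r \<longrightarrow> r \<in> Inv y) \<and>
     croot w s \<in> Inv (proj C y) \<and> (\<exists>r\<in>Inv (proj C (w \<otimes> t)). r \<notin> Inv y)"

text \<open>The witness is one step above the bottom \<open>q\<close> of the polygon, on the side
  where \<open>sroot a\<close> is gained first. Its projection has \<open>sroot a\<close> by
  \<open>proj_front\<close>, while the projection of \<open>w \<otimes> t\<close> has a further root
  of the plane.\<close>

lemma gap_base: assumes "sortable (a # C) w" "wd (a # C)" "s \<in> Des w" "t \<in> Des w" "s \<noteq> t" "bil s t \<noteq> 0" "croot w s = sroot a"
  shows "\<exists>y. gap (a # C) w s t y"
proof -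
  have w: "w \<in> carrier G" using assms by (simp add: sortable_def)
  have st: "s \<in> S" "t \<in> S" and a: "a \<in> S" using assms D_S by auto
  have wdr: "wd (C @ [a])" "wd C" using assms by auto
  obtain q where q: "wle q w" "s \<notin> Des q" "t \<notin> Des q"
    "\<And>r. r \<in> Inv w - Inv q \<Longrightarrow> in_span (act w (sroot s)) (act w (sroot t)) r"
    "in_span (act q (sroot s)) (act q (sroot t)) (act w (sroot s))" "in_span (act q (sroot s)) (act q (sroot t)) (act w (sroot t))"
    using coset_min[OF w st] by blast
  have qc: "q \<in> carrier G" "inv q \<in> carrier G" using q by (auto simp: wle_def)
  have n: "nonneg (act q (sroot s))" "nonneg (act q (sroot t))" using q st by (auto simp: Des_def)
  have rts: "is_root (act q (sroot s))" "is_root (act q (sroot t))" using root_act[OF qc(1)] root_sroot st by auto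
  have notin: "croot w u \<notin> Inv q" if "u \<in> {s, t}" for u
  proof -
    have "in_span (act q (sroot s)) (act q (sroot t)) (croot w u)" unfolding croot_def by (rule in_span_neg) (use q that in blast)
    then obtain p p' where e: "croot w u = (\<lambda>i. p * act q (sroot s) i + p' * act q (sroot t) i)" by (auto simp: in_span_def)
    have "u \<in> Des w" using that assms by auto
    then have "pos (\<lambda>i. p * act q (sroot s) i + p' * act q (sroot t) i)" using croot_pos[OF w] unfolding e[symmetric] by blast
    then have "0 \<le> p" "0 \<le> p'" using span_coef[OF qc(1) st assms(5) n] by blast+
    then have "nonneg (act (inv q) (croot w u))"
      unfolding e act_lin[OF qc(2)] using act_inv_cancel[OF qc(1)] nonneg_sroot nonneg_comb by simp
    then show ?thesis by (simp add: Inv_def)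
  qed
  \<comment> \<open>A simple root that is a nonnegative combination of the two lowest roots of the
    polygon must be one of them.\<close>
  have "\<exists>s'\<in>{s, t}. act q (sroot s') = sroot a"
  proof -
    have "in_span (act q (sroot s)) (act q (sroot t)) (sroot a)" unfolding assms(7)[symmetric] croot_def by (rule in_span_neg) (rule q(5))
    then obtain p p' where e: "sroot a = (\<lambda>i. p * act q (sroot s) i + p' * act q (sroot t) i)" by (auto simp: in_span_def)
    have "pos (\<lambda>i. p * act q (sroot s) i + p' * act q (sroot t) i)" using pos_sroot[OF a] unfolding e .
    then have pp: "0 \<le> p" "0 \<le> p'" using span_coef[OF qc(1) st assms(5) n] by blast+
    have z: "p * act q (sroot s) i = 0 \<and> p' * act q (sroot t) i = 0" if "i \<noteq> a" for i
    proof -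
      have "p * act q (sroot s) i + p' * act q (sroot t) i = 0" using fun_cong[OF e, of i] that by (simp add: sroot_def)
      moreover have "p * act q (sroot s) i \<ge> 0" "p' * act q (sroot t) i \<ge> 0"
        using pp n by (auto simp: nonneg_def intro: mult_nonneg_nonneg)
      ultimately show ?thesis by linarith
    qed
    show ?thesis
    proof (cases "p = 0")
      case False
      have "act q (sroot s) = sroot a"
        by (rule pos_single) (use z False rts n a in \<open>auto simp: pos_def supp_def\<close>)
      then show ?thesis by blast
    next
      case True
      have "p' \<noteq> 0" using fun_cong[OF e, of a] True by (auto simp: sroot_def)
      have "act q (sroot t) = sroot a"
        by (rule pos_single) (use z \<open>p' \<noteq> 0\<close> rts n a in \<open>auto simp: pos_def supp_def\<close>)
      then show ?thesis by blast
    qed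
  qed
  then obtain s' where s': "s' \<in> {s, t}" "act q (sroot s') = sroot a" by blast
  have s'S: "s' \<in> S" using s' st by auto
  define y where "y = q \<otimes> s'"
  have yc: "y \<in> carrier G" using qc s'S S_closed by (simp add: y_def)
  have s'Des: "s' \<in> Des y" using D_right[OF qc(1) s'S] s' q by (auto simp: y_def)
  have "Inv (y \<otimes> s') = Inv y - {croot y s'}" by (rule Inv_right[OF yc s'Des])
  moreover have "y \<otimes> s' = q" using qc s'S by (simp add: y_def)
  moreover have cy: "croot y s' = sroot a" using act_right_sroot[OF qc(1) s'S] s' by (simp add: y_def croot_def)
  ultimately have Iy: "Inv y = insert (sroot a) (Inv q)" using croot_Inv[OF yc s'Des] by auto
  have It: "Inv (w \<otimes> t) = Inv w - {croot w t}" using Inv_right w assms by simp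
  have wt: "w \<otimes> t \<in> carrier G" using w st S_closed by simp
  have ts: "croot w t \<noteq> sroot a" using croot_inj[OF w assms(3,4)] assms by metis
  have aw: "sroot a \<in> Inv w" using croot_Inv[OF w assms(3)] assms by simp
  have 1: "wle y (w \<otimes> t)" using Iy It yc wt q(1) notin ts aw by (auto simp: wle_def)
  have 2: "r \<in> Inv y" if "r \<in> Inv w" "\<not> in_span (croot w s) (croot w t) r" for r
    using q(4)[of r] that Iy unfolding span_croot by blast
  have 3: "croot w s \<in> Inv (proj (a # C) y)" using proj_front[OF _ yc assms(2)] Iy assms by simp
  \<comment> \<open>\<open>a \<otimes> ?x\<close> is a sortable element below
    \<open>w \<otimes> t\<close> with the inversion \<open>?d\<close>, and \<open>?d\<close> is a
    root of the plane that \<open>y\<close> lacks.\<close>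
  let ?x = "proj C w" and ?d = "reflect a (croot w t)"
  have x: "?x \<in> carrier G" using proj_closed w wdr by blast
  have nx: "sroot a \<notin> Inv ?x" using proj_no_front[OF assms(2) w] .
  have dx: "croot w t \<in> Inv ?x" using initial_cover_proj[OF assms(1,2,3,7,4)] assms by auto
  have axI: "sroot a \<in> Inv (a \<otimes> ?x)" using Inv_left_sroot x a nx by blast
  have axc: "a \<otimes> ?x \<in> carrier G" using a x S_closed by simp
  have "sortable (C @ [a]) ?x" using sortable_back_add[OF proj_sortable[OF w wdr(2)] assms(2)] .
  then have sax: "sortable (a # C) (a \<otimes> ?x)" using sortable_use[OF axI assms(2) axc] a x by simp
  have tp: "pos (croot w t)" using croot_pos w assms by simp
  have dax: "?d \<in> Inv (a \<otimes> ?x)" using Inv_left'[OF x a tp ts] dx by simp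
  have ta: "croot w t a = 0" using cover_coord[OF assms(1,2,3,7,4)] assms by auto
  have "form (sroot a) (croot w t) = bil s t" using form_croot[OF w assms(3,4)] assms by simp
  then have da: "?d a = - 2 * bil s t" using ta by (simp add: reflect_self)
  have Iaw: "Inv (a \<otimes> w) = Inv w - {sroot a}" using Inv_right[OF w assms(3)] cover_conj[OF w a assms(3,7)] assms by simp
  have "Inv (a \<otimes> ?x) \<subseteq> Inv (w \<otimes> t)"
  proof
    fix r assume r: "r \<in> Inv (a \<otimes> ?x)"
    have rp: "pos r" using Inv_pos[OF r] .
    show "r \<in> Inv (w \<otimes> t)"
    proof (cases "r = sroot a")
      case True
      then show ?thesis using It aw ts by auto
    next
      case False
      then have rx: "reflect a r \<in> Inv ?x" using Inv_left[OF x a rp False] r by simp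
      then have "reflect a r \<in> Inv w" "reflect a r \<noteq> sroot a" using proj_le[OF w wdr(2)] nx by (auto simp: wle_def)
      then have "reflect a r \<in> Inv (a \<otimes> w)" using Iaw by simp
      then have rw: "r \<in> Inv w" using Inv_left'[OF w a rp False] by simp
      \<comment> \<open>This excludes \<open>croot w t\<close>, whose reflection has the nonzero
        coordinate \<open>- 2 * bil s t\<close> at \<open>a\<close>.\<close>
      have "supp (set C) (reflect a r)" using sortable_supp[OF proj_sortable[OF w wdr(2)] wdr(2) rx] .
      then have "reflect a r a = 0" using assms(2) by (auto simp: supp_def)
      then have "r \<noteq> croot w t" using da assms(6) by auto
      then show ?thesis using rw It by simp
    qed
  qed
  then have "wle (a \<otimes> ?x) (w \<otimes> t)" using axc wt by (simp add: wle_def)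
  then have "wle (a \<otimes> ?x) (proj (a # C) (w \<otimes> t))" using proj_max[OF sax _ assms(2)] by simp
  then have 4: "?d \<in> Inv (proj (a # C) (w \<otimes> t))" using dax by (auto simp: wle_def)
  have "?d \<notin> Inv y"
  proof
    assume h: "?d \<in> Inv y"
    have "?d \<noteq> sroot a" using reflect_reflect[OF a, of "croot w t"] reflect_sroot[OF a] tp pos_neg[OF root_sroot[OF a]] pos_sroot[OF a] by metis
    then have dq: "?d \<in> Inv q" using h Iy by simp
    have "?d = (\<lambda>i. (- 2 * bil s t) * croot w s i + 1 * croot w t i)"
      using \<open>form (sroot a) (croot w t) = bil s t\<close> reflect_alt[of a "croot w t"] assms(7) by (simp add: add.commute)
    then have "in_span (croot w s) (croot w t) ?d" unfolding in_span_def by blast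
    then show False using low_span[OF q(1) assms(3,4,5) _ _ dq] notin by blast
  qed
  then have "gap (a # C) w s t y" unfolding gap_def using 1 2 3 4 by blast
  then show ?thesis by blast
qed

lemma in_span_reflect: assumes "a \<in> S" "in_span u v r" shows "in_span (reflect a u) (reflect a v) (reflect a r)"
  using assms reflect_lin unfolding in_span_def by blast

text \<open>All clauses of \<open>gap\<close> survive a skipped letter and are reflected along a
  used one, until the initial root is one of the two cover roots. Which one is not known in advance,
  hence the disjunction.\<close>

lemma gap_ex: "sortable C w \<Longrightarrow> wd C \<Longrightarrow> s \<in> Des w \<Longrightarrow> t \<in> Des w \<Longrightarrow> s \<noteq> t \<Longrightarrow> bil s t \<noteq> 0 \<Longrightarrow>
  (\<exists>y. gap C w s t y) \<or> (\<exists>y. gap C w t s y)"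
proof (induction "len w + length C" arbitrary: C w rule: less_induct)
  case less
  have w: "w \<in> carrier G" using less.prems by (simp add: sortable_def)
  have st: "s \<in> S" "t \<in> S" using less.prems D_S by blast+
  have I: "Inv (w \<otimes> u) = Inv w - {croot w u}" if "u \<in> Des w" for u using Inv_right[OF w that] .
  show ?case
  proof (cases C)
    case Nil
    then have "w = \<one>" using less.prems sortable_Nil by simp
    then show ?thesis using croot_Inv[OF w less.prems(3)] by simp
  next
    case (Cons a C')
    have a: "a \<in> S" and wda: "wd (a # C')" "wd (C' @ [a])" "wd C'" using less.prems Cons by auto
    show ?thesis
    proof (cases "sroot a \<in> Inv w")
      case False
      have *: "gap C w s t y" if g: "gap C' w s t y" and st: "s \<in> Des w" "t \<in> Des w" for s t y
      proof -
        have "t \<in> S" using D_S st by blast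
        then have wt: "w \<otimes> t \<in> carrier G" using w S_closed by simp
        have yc: "y \<in> carrier G" using g by (auto simp: gap_def wle_def)
        have "sroot a \<notin> Inv (w \<otimes> t)" using I st False by auto
        moreover then have "sroot a \<notin> Inv y" using g by (auto simp: gap_def wle_def)
        ultimately show ?thesis using g proj_skip[OF _ _ wda(1)] wt yc Cons unfolding gap_def by simp
      qed
      have "sortable C' w" using sortable_skip[OF False wda(1)] less.prems Cons by simp
      then have "(\<exists>y. gap C' w s t y) \<or> (\<exists>y. gap C' w t s y)"
        by (rule less.hyps[rotated 1, OF _ wda(3) less.prems(3-6)]) (use Cons in simp)
      then show ?thesis using * less.prems by blast
    next
      case True
      show ?thesis
      proof (cases "croot w s = sroot a \<or> croot w t = sroot a")
        case c: True
        then show ?thesis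
        proof
          assume "croot w s = sroot a"
          then show ?thesis using gap_base[OF _ wda(1) less.prems(3-6)] less.prems(1) Cons by blast
        next
          assume "croot w t = sroot a"
          then show ?thesis
            using gap_base[OF _ wda(1) less.prems(4,3)] less.prems(1,5,6) bil_sym[OF st] Cons by simp
        qed
      next
        case ne: False
        have aw: "a \<otimes> w \<in> carrier G" using a w S_closed by simp
        have *: "gap C w s t (a \<otimes> y)" if g: "gap (C' @ [a]) (a \<otimes> w) s t y"
          and st: "s \<in> Des w" "t \<in> Des w" and ne: "croot w s \<noteq> sroot a" "croot w t \<noteq> sroot a" for s t y
        proof -
          have tS: "t \<in> S" using D_S st by blast
          have wt: "w \<otimes> t \<in> carrier G" using w tS S_closed by simp
          have assoc: "a \<otimes> w \<otimes> t = a \<otimes> (w \<otimes> t)" using a w tS S_closed by (simp add: m_assoc)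
          have yc: "y \<in> carrier G" using g by (auto simp: gap_def wle_def)
          have le: "wle y (a \<otimes> (w \<otimes> t))" using g assoc by (simp add: gap_def)
          have ain: "sroot a \<in> Inv (w \<otimes> t)" using I[OF st(2)] True ne by auto
          then have nin: "sroot a \<notin> Inv (a \<otimes> (w \<otimes> t))" using Inv_left_sroot[OF wt a] by simp
          then have ny: "sroot a \<notin> Inv y" using le by (auto simp: wle_def)
          have ayc: "a \<otimes> y \<in> carrier G" using a yc S_closed by simp
          have ay: "sroot a \<in> Inv (a \<otimes> y)" using Inv_left_sroot[OF yc a] ny by simp
          have 1: "wle (a \<otimes> y) (w \<otimes> t)" using wle_left'[OF le a nin] a wt by simp
          have cvs: "croot (a \<otimes> w) s = reflect a (croot w s)" "croot (a \<otimes> w) t = reflect a (croot w t)"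
            using D_left'(2)[OF w a] st ne by auto
          have 2: "r \<in> Inv (a \<otimes> y)" if r: "r \<in> Inv w" "\<not> in_span (croot w s) (croot w t) r" for r
          proof (cases "r = sroot a")
            case False
            have rp: "pos r" using Inv_pos[OF r(1)] .
            have "reflect a r \<in> Inv (a \<otimes> w)" using Inv_left'[OF w a rp False] r by simp
            moreover have "\<not> in_span (croot (a \<otimes> w) s) (croot (a \<otimes> w) t) (reflect a r)"
              using in_span_reflect[OF a, of "croot (a \<otimes> w) s" "croot (a \<otimes> w) t" "reflect a r"] r(2) reflect_reflect[OF a] cvs by metis
            ultimately have "reflect a r \<in> Inv y" using g unfolding gap_def by blast
            then show ?thesis using Inv_left[OF yc a rp False] by simp
          qed (use ay in simp)
          have p1: "proj (C' @ [a]) y \<in> carrier G" using proj_closed[OF yc wda(2)] .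
          have "proj C (a \<otimes> y) = a \<otimes> proj (C' @ [a]) y"
            using proj_use[OF ay ayc wda(1)] a yc Cons by simp
          moreover have "reflect a (croot w s) \<in> Inv (proj (C' @ [a]) y)" using g cvs by (simp add: gap_def)
          ultimately have 3: "croot w s \<in> Inv (proj C (a \<otimes> y))"
            using Inv_left[OF p1 a croot_pos[OF w st(1)] ne(1)] by simp
          obtain r where r: "r \<in> Inv (proj (C' @ [a]) (a \<otimes> (w \<otimes> t)))" "r \<notin> Inv y"
            using g assoc unfolding gap_def by auto
          have awt: "a \<otimes> (w \<otimes> t) \<in> carrier G" using a wt S_closed by simp
          have p2: "proj (C' @ [a]) (a \<otimes> (w \<otimes> t)) \<in> carrier G" using proj_closed[OF awt wda(2)] .
          have rp: "pos r" using Inv_pos[OF r(1)] .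
          have rn: "r \<noteq> sroot a" using proj_le[OF awt wda(2)] nin r(1) by (auto simp: wle_def)
          have "reflect a r \<in> Inv (proj C (w \<otimes> t))"
            using proj_use[OF ain wt wda(1)] Cons Inv_left'[OF p2 a rp rn] r by simp
          moreover have "reflect a r \<notin> Inv (a \<otimes> y)" using Inv_left'[OF yc a rp rn] r by simp
          ultimately show ?thesis unfolding gap_def using 1 2 3 by blast
        qed
        have s': "sortable (C' @ [a]) (a \<otimes> w)" using sortable_use[OF True wda(1) w] less.prems Cons by simp
        have "s \<in> Des (a \<otimes> w)" "t \<in> Des (a \<otimes> w)" using D_left'(1)[OF w a] less.prems(3,4) ne by blast+
        then have "(\<exists>y. gap (C' @ [a]) (a \<otimes> w) s t y) \<or> (\<exists>y. gap (C' @ [a]) (a \<otimes> w) t s y)"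
          by (rule less.hyps[rotated 1, OF s' wda(2) _ _ less.prems(5,6)]) (use len_left_Suc[OF w a True] Cons in simp)
        then show ?thesis using * less.prems ne by blast
      qed
    qed
  qed
qed

end

subsection \<open>Finite lattices\<close>

lemma glb_unique: "is_lattice_on L r \<Longrightarrow> is_glb L r A z \<Longrightarrow> is_glb L r A z' \<Longrightarrow> z = z'"
  unfolding is_lattice_on_def is_glb_def by blast

lemma lub_unique: "is_lattice_on L r \<Longrightarrow> is_lub L r A z \<Longrightarrow> is_lub L r A z' \<Longrightarrow> z = z'"
  unfolding is_lattice_on_def is_lub_def by blast

lemma meet2_glb: assumes "is_lattice_on L r" "x \<in> L" "y \<in> L" shows "is_glb L r {x, y} (meet2 L r x y)"
proof -
  obtain z where z: "is_glb L r {x, y} z" using assms unfolding is_lattice_on_def by blast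
  show ?thesis unfolding meet2_def by (rule theI[where a = z]) (rule z, rule glb_unique[OF assms(1) _ z])
qed

lemma join2_lub: assumes "is_lattice_on L r" "x \<in> L" "y \<in> L" shows "is_lub L r {x, y} (join2 L r x y)"
proof -
  obtain z where z: "is_lub L r {x, y} z" using assms unfolding is_lattice_on_def by blast
  show ?thesis unfolding join2_def by (rule theI[where a = z]) (rule z, rule lub_unique[OF assms(1) _ z])
qed

text \<open>Distribute \<open>y\<close> over the join of \<open>x\<close> and \<open>z\<close>,
  which is \<open>t\<close>: then \<open>y\<close> is the join of two elements below
  \<open>z\<close>. Meets and joins enter only through common bounds, so none has to be computed for
  the intervals.\<close>

lemma distrib_modular:
  assumes "distrib_lattice_on L r" "x \<in> L" "y \<in> L" "z \<in> L" "t \<in> L" "r y t"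
    "\<And>u. u \<in> L \<Longrightarrow> r x u \<Longrightarrow> r z u \<Longrightarrow> u = t"
    "\<And>u. u \<in> L \<Longrightarrow> r u x \<Longrightarrow> r u y \<Longrightarrow> r u z"
  shows "r y z"
proof -
  have lat: "is_lattice_on L r" and dist: "meet2 L r y (join2 L r x z) = join2 L r (meet2 L r y x) (meet2 L r y z)"
    using assms by (auto simp: distrib_lattice_on_def)
  have "join2 L r x z = t" using join2_lub[OF lat assms(2,4)] assms(7) by (auto simp: is_lub_def)
  moreover have "meet2 L r y t = y"
  proof (rule glb_unique[OF lat meet2_glb[OF lat assms(3,5)]])
    have "r y y" using lat assms(3) unfolding is_lattice_on_def by blast
    then show "is_glb L r {y, t} y" using assms(3,6) unfolding is_glb_def by simp
  qed
  ultimately have e: "y = join2 L r (meet2 L r y x) (meet2 L r y z)" using dist by simp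
  have m1: "is_glb L r {y, x} (meet2 L r y x)" "is_glb L r {y, z} (meet2 L r y z)"
    using meet2_glb[OF lat assms(3,2)] meet2_glb[OF lat assms(3,4)] by auto
  then have mm: "meet2 L r y x \<in> L" "meet2 L r y z \<in> L" "r (meet2 L r y x) z" "r (meet2 L r y z) z"
    using assms(8) unfolding is_glb_def by auto
  then have "r (join2 L r (meet2 L r y x) (meet2 L r y z)) z"
    using join2_lub[OF lat mm(1,2)] assms(4) unfolding is_lub_def by simp
  then show ?thesis using e by simp
qed

lemma boolean_of_sets:
  assumes r: "\<And>x y. x \<in> L \<Longrightarrow> y \<in> L \<Longrightarrow> r x y \<longleftrightarrow> f x \<subseteq> f y"
    and inj: "inj_on f L" and im: "f ` L = {A. lo \<subseteq> A \<and> A \<subseteq> hi}" and le: "lo \<subseteq> hi"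
  shows "boolean_lattice_on L r"
proof -
  have ex: "\<exists>x\<in>L. f x = A" if "lo \<subseteq> A" "A \<subseteq> hi" for A
    using im that by (metis (mono_tags, lifting) imageE mem_Collect_eq)
  have bd: "lo \<subseteq> f x" "f x \<subseteq> hi" if "x \<in> L" for x using im that by auto
  have glb: "\<exists>z. is_glb L r {x, y} z \<and> f z = f x \<inter> f y" if x: "x \<in> L" and y: "y \<in> L" for x y
  proof -
    have "lo \<subseteq> f x \<inter> f y" "f x \<inter> f y \<subseteq> hi" using bd[OF x] bd[OF y] by auto
    then obtain z where z: "z \<in> L" "f z = f x \<inter> f y" using ex by blast
    have "is_glb L r {x, y} z" unfolding is_glb_def using z x y by (auto simp: r)
    then show ?thesis using z by blast
  qed
  have lub: "\<exists>z. is_lub L r {x, y} z \<and> f z = f x \<union> f y" if x: "x \<in> L" and y: "y \<in> L" for x y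
  proof -
    have "lo \<subseteq> f x \<union> f y" "f x \<union> f y \<subseteq> hi" using bd[OF x] bd[OF y] by auto
    then obtain z where z: "z \<in> L" "f z = f x \<union> f y" using ex by blast
    have "is_lub L r {x, y} z" unfolding is_lub_def using z x y by (auto simp: r)
    then show ?thesis using z by blast
  qed
  have eq: "x = y" if "x \<in> L" "y \<in> L" "f x = f y" for x y using inj that by (auto dest: inj_onD)
  have lat: "is_lattice_on L r"
    unfolding is_lattice_on_def
  proof (intro conjI ballI impI)
    fix x y assume "x \<in> L" "y \<in> L"
    then show "\<exists>z. is_glb L r {x, y} z" "\<exists>z. is_lub L r {x, y} z" using glb lub by blast+
  next
    fix x y assume "x \<in> L" "y \<in> L" "r x y \<and> r y x"
    then show "x = y" by (intro eq) (auto simp: r)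
  next
    fix x y z assume "x \<in> L" "y \<in> L" "z \<in> L" "r x y \<and> r y z"
    then show "r x z" by (auto simp: r)
  qed (simp add: r)
  have m: "meet2 L r x y \<in> L \<and> f (meet2 L r x y) = f x \<inter> f y" if "x \<in> L" "y \<in> L" for x y
    using glb[OF that] meet2_glb[OF lat that] glb_unique[OF lat] by (metis is_glb_def)
  have j: "join2 L r x y \<in> L \<and> f (join2 L r x y) = f x \<union> f y" if "x \<in> L" "y \<in> L" for x y
    using lub[OF that] join2_lub[OF lat that] lub_unique[OF lat] by (metis is_lub_def)
  have d: "distrib_lattice_on L r"
    unfolding distrib_lattice_on_def using lat by (auto intro!: eq simp: m j)
  obtain b where b: "b \<in> L" "f b = lo" using ex[of lo] le by blast
  obtain t where t: "t \<in> L" "f t = hi" using ex[of hi] le by blast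
  have "\<exists>y\<in>L. meet2 L r x y = b \<and> join2 L r x y = t" if x: "x \<in> L" for x
  proof -
    \<comment> \<open>The complement relative to the bounds \<open>lo\<close> and
      \<open>hi\<close>.\<close>
    obtain y where y: "y \<in> L" "f y = lo \<union> (hi - f x)" using ex[of "lo \<union> (hi - f x)"] le by blast
    have "meet2 L r x y = b" by (rule eq) (use m[OF x y(1)] b y bd[OF x] in auto)
    moreover have "join2 L r x y = t" by (rule eq) (use j[OF x y(1)] t y bd[OF x] in auto)
    ultimately show ?thesis using y by blast
  qed
  moreover have "\<forall>x\<in>L. r b x \<and> r x t" using r b t bd by simp
  ultimately show ?thesis unfolding boolean_lattice_on_def using d b t by blast
qed

context coxeter
begin

subsection \<open>The two intervals\<close>

lemma pop_down_eq: assumes "is_glb X wle (insert w {y. covby X wle y w}) z" shows "pop_down X wle w = z"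
  unfolding pop_down_def meet_set_def
proof (rule the_equality[where P = "is_glb X wle (insert w {y. covby X wle y w})", OF assms])
  fix z' assume "is_glb X wle (insert w {y. covby X wle y w}) z'"
  then show "z' = z" using assms wle_antisym unfolding is_glb_def by blast
qed

lemma wle_right_ne: assumes "w \<in> carrier G" "s \<in> Des w" shows "wle (w \<otimes> s) w" "w \<otimes> s \<noteq> w"
proof -
  show "wle (w \<otimes> s) w" using wle_right assms by blast
  have "croot w s \<notin> Inv (w \<otimes> s)" unfolding Inv_right[OF assms] by blast
  then show "w \<otimes> s \<noteq> w" using croot_Inv[OF assms] by metis
qed

lemma wle_right_iff: assumes "w \<in> carrier G" "s \<in> Des w" "wle u w"
  shows "wle u (w \<otimes> s) \<longleftrightarrow> croot w s \<notin> Inv u"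
proof -
  have "w \<otimes> s \<in> carrier G" using assms D_S S_closed by blast
  then show ?thesis using assms Inv_right[OF assms(1,2)] by (auto simp: wle_def)
qed

lemma weak_cover: assumes "w \<in> carrier G"
  shows "covby (carrier G) wle y w \<longleftrightarrow> (\<exists>s\<in>Des w. y = w \<otimes> s)"
proof
  assume c: "covby (carrier G) wle y w"
  then obtain s where s: "s \<in> Des w" "wle y (w \<otimes> s)" using wlt_des unfolding covby_def by blast
  then show "\<exists>s\<in>Des w. y = w \<otimes> s"
    using c wle_right_ne[OF assms s(1)] unfolding covby_def wle_def by metis
next
  assume "\<exists>s\<in>Des w. y = w \<otimes> s"
  then obtain s where s: "s \<in> Des w" "y = w \<otimes> s" by blast
  have yc: "y \<in> carrier G" using s assms D_S S_closed by blast
  have "z = y \<or> z = w" if z: "z \<in> carrier G" "wle y z" "wle z w" for z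
  proof (cases "croot w s \<in> Inv z")
    case True
    then have "Inv z = Inv w" using z Inv_right[OF assms s(1)] s(2) by (auto simp: wle_def)
    then show ?thesis using Inv_inj z assms by blast
  next
    case False
    then have "wle z y" using wle_right_iff[OF assms s(1) z(3)] s(2) by blast
    then show ?thesis using wle_antisym z by blast
  qed
  then show "covby (carrier G) wle y w"
    unfolding covby_def using yc assms wle_right_ne[OF assms s(1), folded s(2)] by blast
qed

lemma weak_pop: assumes "w \<in> carrier G"
  shows "is_glb (carrier G) wle (insert w {y. covby (carrier G) wle y w}) (pop_down (carrier G) wle w)"
proof -
  let ?A = "insert w {y. covby (carrier G) wle y w}"
  have A: "?A \<subseteq> carrier G" using assms by (auto simp: covby_def)
  obtain z where z: "\<forall>x\<in>?A. wle z x" "\<forall>u. (\<forall>x\<in>?A. wle u x) \<longrightarrow> wle u z"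
    using meet_set_ex[OF finite_subset[OF A finite_G] insert_not_empty A] by (elim exE conjE)
  have "z \<in> carrier G" using z(1) by (auto simp: wle_def)
  then have g: "is_glb (carrier G) wle ?A z" unfolding is_glb_def using z by blast
  then show ?thesis using pop_down_eq by simp
qed

lemma weak_pop_le: assumes "w \<in> carrier G"
  shows "wle (pop_down (carrier G) wle w) w" "s \<in> Des w \<Longrightarrow> wle (pop_down (carrier G) wle w) (w \<otimes> s)"
  using weak_pop[OF assms] weak_cover[OF assms] unfolding is_glb_def by blast+

abbreviation commuting :: "'a \<Rightarrow> bool" where
  "commuting w \<equiv> \<forall>s\<in>Des w. \<forall>t\<in>Des w. s \<otimes> t = t \<otimes> s"

text \<open>\<open>X\<close> is left open so that one computation serves both the weak order and the
  sortable elements; it need only contain what arises from \<open>w\<close> by removing cover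
  roots.\<close>

lemma commuting_pop: assumes "w \<in> carrier G" "commuting w" "X \<subseteq> carrier G" "w \<in> X"
  "\<And>u. wle u w \<Longrightarrow> Inv w - Inv u \<subseteq> croot w ` Des w \<Longrightarrow> u \<in> X"
  shows "pop_down X wle w \<in> carrier G" "Inv (pop_down X wle w) = Inv w - croot w ` Des w"
proof -
  obtain p where p: "p \<in> carrier G" "Inv p = Inv w - croot w ` Des w" using commuting_remove[OF assms(1,2)] by blast
  have pw: "wle p w" using p assms by (auto simp: wle_def)
  have wsX: "w \<otimes> s \<in> X" if "s \<in> Des w" for s
    using assms(5)[OF wle_right[OF assms(1) that]] Inv_right[OF assms(1) that] that by auto
  have cov: "covby X wle y w \<longleftrightarrow> (\<exists>s\<in>Des w. y = w \<otimes> s)" for y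
  proof
    assume c: "covby X wle y w"
    then obtain s where s: "s \<in> Des w" "wle y (w \<otimes> s)" using wlt_des unfolding covby_def by blast
    then show "\<exists>s\<in>Des w. y = w \<otimes> s"
      using c wle_right_ne[OF assms(1) s(1)] wsX unfolding covby_def by metis
  next
    assume "\<exists>s\<in>Des w. y = w \<otimes> s"
    then have "covby (carrier G) wle y w" "y \<in> X" using weak_cover[OF assms(1)] wsX by auto
    then show "covby X wle y w" using assms(3,4) unfolding covby_def by blast
  qed
  have "is_glb X wle (insert w {y. covby X wle y w}) p"
    unfolding is_glb_def
  proof (intro conjI ballI impI)
    show "p \<in> X" using assms(5)[OF pw] p by auto
    fix y assume "y \<in> insert w {y. covby X wle y w}"
    then show "wle p y" using pw cov wle_right_iff[OF assms(1) _ pw] p by auto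
  next
    fix u assume u: "u \<in> X" "\<forall>y\<in>insert w {y. covby X wle y w}. wle u y"
    then have uw: "wle u w" by blast
    have "croot w s \<notin> Inv u" if "s \<in> Des w" for s
      using u(2) cov that wle_right_iff[OF assms(1) that uw] by blast
    then show "wle u p" using uw p by (auto simp: wle_def)
  qed
  then have "pop_down X wle w = p" by (rule pop_down_eq)
  then show "pop_down X wle w \<in> carrier G" "Inv (pop_down X wle w) = Inv w - croot w ` Des w" using p by auto
qed

lemma commuting_boolean: assumes "w \<in> carrier G" "commuting w"
  shows "boolean_lattice_on (interval (carrier G) wle (pop_down (carrier G) wle w) w) wle"
proof -
  let ?p = "pop_down (carrier G) wle w"
  let ?L = "interval (carrier G) wle ?p w"
  have "u \<in> carrier G" if "wle u w" for u using that by (simp add: wle_def)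
  then have p: "?p \<in> carrier G" "Inv ?p = Inv w - croot w ` Des w"
    using commuting_pop[OF assms, of "carrier G"] assms by auto
  have L: "?L = {u \<in> carrier G. Inv w - croot w ` Des w \<subseteq> Inv u \<and> Inv u \<subseteq> Inv w}"
    using p assms by (auto simp: interval_def wle_def)
  have ex: "\<exists>u\<in>?L. Inv u = A" if A: "Inv w - croot w ` Des w \<subseteq> A" "A \<subseteq> Inv w" for A
  proof -
    obtain u where u: "u \<in> carrier G" "Inv u = Inv w - croot w ` {t \<in> Des w. croot w t \<notin> A}"
      using commuting_remove[OF assms, of "{t \<in> Des w. croot w t \<notin> A}"] by blast
    have "Inv u = A" using u A by auto
    then show ?thesis using u A L by auto
  qed
  have im: "Inv ` ?L = {A. Inv w - croot w ` Des w \<subseteq> A \<and> A \<subseteq> Inv w}"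
  proof
    show "Inv ` ?L \<subseteq> {A. Inv w - croot w ` Des w \<subseteq> A \<and> A \<subseteq> Inv w}" unfolding L by blast
    show "{A. Inv w - croot w ` Des w \<subseteq> A \<and> A \<subseteq> Inv w} \<subseteq> Inv ` ?L" using ex by blast
  qed
  show ?thesis
  proof (rule boolean_of_sets[OF _ _ im])
    fix x y assume "x \<in> ?L" "y \<in> ?L"
    then show "wle x y \<longleftrightarrow> Inv x \<subseteq> Inv y" unfolding L by (simp add: wle_def)
  next
    show "inj_on Inv ?L" unfolding L using Inv_inj by (auto intro: inj_onI)
  qed auto
qed

lemma commuting_camb: assumes "sortable C w" "wd C" "commuting w"
  shows "interval {u. sortable C u} wle (pop_down {u. sortable C u} wle w) w
       = interval (carrier G) wle (pop_down (carrier G) wle w) w"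
proof -
  have w: "w \<in> carrier G" using assms by (simp add: sortable_def)
  have K: "u \<in> {u. sortable C u}" if "wle u w" "Inv w - Inv u \<subseteq> croot w ` Des w" for u
    using commuting_sortable[OF assms that] by simp
  have Kc: "{u. sortable C u} \<subseteq> carrier G" by (auto simp: sortable_def)
  have c1: "pop_down {u. sortable C u} wle w \<in> carrier G" "Inv (pop_down {u. sortable C u} wle w) = Inv w - croot w ` Des w"
    using commuting_pop[OF w assms(3) Kc _ K] assms by auto
  have "u \<in> carrier G" if "wle u w" for u using that by (simp add: wle_def)
  then have c2: "pop_down (carrier G) wle w \<in> carrier G" "Inv (pop_down (carrier G) wle w) = Inv w - croot w ` Des w"
    using commuting_pop[OF w assms(3), of "carrier G"] w by auto
  have e: "pop_down {u. sortable C u} wle w = pop_down (carrier G) wle w" using Inv_inj c1 c2 by simp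
  have "sortable C u" if "wle (pop_down (carrier G) wle w) u" "wle u w" for u
    using K[OF that(2)] that(1) c2 by (auto simp: wle_def)
  then show ?thesis unfolding e interval_def using Kc by auto
qed

text \<open>The pentagon consists of \<open>w \<otimes> s\<close> against
  \<open>w \<otimes> t\<close> and \<open>w \<otimes> t \<otimes> s\<close>. Without commutation the
  latter still has \<open>croot w s\<close>, so only \<open>w\<close> lies above both it and
  \<open>w \<otimes> s\<close>; by \<open>low_span\<close> it also lies above all common lower
  bounds of the coatoms.\<close>

lemma noncommuting_weak: assumes "w \<in> carrier G" "s \<in> Des w" "t \<in> Des w" "s \<otimes> t \<noteq> t \<otimes> s"
  shows "\<not> distrib_lattice_on (interval (carrier G) wle (pop_down (carrier G) wle w) w) wle"
proof
  let ?p = "pop_down (carrier G) wle w"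
  let ?L = "interval (carrier G) wle ?p w"
  assume d: "distrib_lattice_on ?L wle"
  have st: "s \<in> S" "t \<in> S" "s \<noteq> t" using assms D_S by auto
  have b: "bil t s \<noteq> 0" using bil_zero_iff[OF st(2,1)] st assms by auto
  have pl: "wle ?p w" "wle ?p (w \<otimes> s)" "wle ?p (w \<otimes> t)" using weak_pop_le[OF assms(1)] assms by auto
  have wc: "w \<otimes> s \<in> carrier G" "w \<otimes> t \<in> carrier G" using pl by (auto simp: wle_def)
  have sD: "s \<in> Des (w \<otimes> t)" and cvs: "croot (w \<otimes> t) s = (\<lambda>i. 1 * croot w s i + (- 2 * bil t s) * croot w t i)"
    using cover_next[OF assms(1-3) st(3)] by auto
  let ?z = "w \<otimes> t \<otimes> s"
  have Iz: "Inv ?z = Inv w - {croot w t} - {croot (w \<otimes> t) s}"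
    using Inv_right[OF wc(2) sD] Inv_right[OF assms(1,3)] by simp
  have zt: "wle ?z (w \<otimes> t)" using wle_right[OF wc(2) sD] .
  have zw: "wle ?z w" using wle_trans[OF zt wle_right[OF assms(1,3)]] .
  have supp: "in_span (croot w s) (croot w t) (croot (w \<otimes> t) s)" unfolding cvs in_span_def by blast
  have low: "wle u ?z" if u: "wle u (w \<otimes> s)" "wle u (w \<otimes> t)" for u
  proof -
    have uw: "wle u w" using wle_trans[OF u(1) wle_right[OF assms(1,2)]] .
    have n: "croot w s \<notin> Inv u" "croot w t \<notin> Inv u" using u wle_right_iff[OF assms(1) _ uw] assms by auto
    then have "croot (w \<otimes> t) s \<notin> Inv u" using low_span[OF uw assms(2,3) st(3) n] supp by blast
    then show ?thesis using wle_right_iff[OF wc(2) sD u(2)] by blast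
  qed
  have inz: "croot w s \<in> Inv ?z"
  proof -
    have "croot w s \<noteq> croot w t" using croot_inj[OF assms(1-3)] st by blast
    moreover have "croot w s \<noteq> croot (w \<otimes> t) s"
    proof
      assume "croot w s = croot (w \<otimes> t) s"
      then have "bil t s * croot w t i = 0" for i using fun_cong[OF cvs, of i] by simp
      then have "croot w t = (\<lambda>i. 0)" using b by auto
      then show False using root_form[of "croot w t"] croot_pos[OF assms(1,3)] by (simp add: pos_def)
    qed
    ultimately show ?thesis using Iz croot_Inv[OF assms(1,2)] by blast
  qed
  have "wle (w \<otimes> t) ?z"
  proof (rule distrib_modular[OF d, of "w \<otimes> s" "w \<otimes> t" ?z w])
    show "w \<otimes> s \<in> ?L" "w \<otimes> t \<in> ?L" "?z \<in> ?L" "w \<in> ?L" "wle (w \<otimes> t) w"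
      using pl wc wle_right[OF assms(1)] assms low zw wle_refl by (auto simp: interval_def wle_def)
    show "wle u ?z" if "wle u (w \<otimes> s)" "wle u (w \<otimes> t)" for u using low that .
    fix u assume u: "u \<in> ?L" "wle (w \<otimes> s) u" "wle ?z u"
    show "u = w"
    proof (rule ccontr)
      assume "u \<noteq> w"
      then obtain r where r: "r \<in> Des w" "wle u (w \<otimes> r)" using wlt_des u by (auto simp: interval_def)
      have uw: "wle u w" using u by (simp add: interval_def)
      have nr: "croot w r \<notin> Inv u" using r wle_right_iff[OF assms(1) r(1) uw] by blast
      have "croot w r \<notin> Inv (w \<otimes> s)" using nr u by (auto simp: wle_def)
      then have "croot w r = croot w s" using Inv_right[OF assms(1,2)] croot_Inv[OF assms(1) r(1)] by auto
      then show False using nr inz u by (auto simp: wle_def)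
    qed
  qed
  then show False using Iz Inv_right[OF assms(1,3)] croot_Inv[OF wc(2) sD] by (auto simp: wle_def)
qed

text \<open>A sortable element between lies below some coatom \<open>w \<otimes> r\<close>.
  \<open>cover_proj\<close> rules out \<open>r \<noteq> s\<close>, and maximality of the projection
  settles \<open>r = s\<close>.\<close>

lemma camb_cover: assumes "sortable C w" "wd C" "s \<in> Des w" shows "covby {u. sortable C u} wle (proj C (w \<otimes> s)) w"
proof -
  have w: "w \<in> carrier G" using assms by (simp add: sortable_def)
  have ws: "w \<otimes> s \<in> carrier G" using w assms D_S S_closed by blast
  let ?y = "proj C (w \<otimes> s)"
  have y: "sortable C ?y" "wle ?y (w \<otimes> s)" using proj_sortable[OF ws assms(2)] proj_le[OF ws assms(2)] by auto
  have yw: "wle ?y w" using wle_trans[OF y(2) wle_right[OF w assms(3)]] .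
  have ne: "?y \<noteq> w" using y(2) wle_right_ne[OF w assms(3)] wle_antisym by metis
  have "z = ?y \<or> z = w" if z: "sortable C z" "wle ?y z" "wle z w" for z
  proof (rule disjCI)
    assume "z \<noteq> w"
    then obtain r where r: "r \<in> Des w" "wle z (w \<otimes> r)" using wlt_des z by blast
    have "r = s"
    proof (rule ccontr)
      assume "r \<noteq> s"
      then have "croot w r \<in> Inv ?y" using cover_proj[OF assms r(1)] by blast
      then have "croot w r \<in> Inv (w \<otimes> r)" using z r by (auto simp: wle_def)
      then show False using Inv_right[OF w r(1)] by simp
    qed
    then have "wle z ?y" using proj_max[OF z(1) _ assms(2)] r by simp
    then show "z = ?y" using wle_antisym z by blast
  qed
  then show ?thesis unfolding covby_def using y yw ne assms(1) by blast
qed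

text \<open>The meet among sortable elements is the projection of the meet in the weak
  order.\<close>

lemma camb_pop: assumes "sortable C w" "wd C"
  shows "is_glb {u. sortable C u} wle (insert w {y. covby {u. sortable C u} wle y w}) (pop_down {u. sortable C u} wle w)"
proof -
  let ?A = "insert w {y. covby {u. sortable C u} wle y w}"
  have A: "?A \<subseteq> carrier G" using assms by (auto simp: covby_def sortable_def)
  obtain z where z: "\<forall>x\<in>?A. wle z x" "\<forall>u. (\<forall>x\<in>?A. wle u x) \<longrightarrow> wle u z"
    using meet_set_ex[OF finite_subset[OF A finite_G] insert_not_empty A] by (elim exE conjE)
  have zc: "z \<in> carrier G" using z(1) by (auto simp: wle_def)
  have "is_glb {u. sortable C u} wle ?A (proj C z)"
    unfolding is_glb_def
  proof (intro conjI ballI impI)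
    show "proj C z \<in> {u. sortable C u}" using proj_sortable[OF zc assms(2)] by simp
    fix x assume "x \<in> ?A"
    then show "wle (proj C z) x" using wle_trans[OF proj_le[OF zc assms(2)]] z(1) by blast
  next
    fix u assume "u \<in> {u. sortable C u}" "\<forall>x\<in>?A. wle u x"
    then show "wle u (proj C z)" using proj_max[OF _ _ assms(2)] z(2) by blast
  qed
  then show ?thesis using pop_down_eq by simp
qed

lemma camb_pop_le: assumes "sortable C w" "wd C" "s \<in> Des w"
  shows "sortable C (pop_down {u. sortable C u} wle w)" "wle (pop_down {u. sortable C u} wle w) (w \<otimes> s)"
proof -
  have ws: "w \<otimes> s \<in> carrier G" using assms D_S S_closed by (auto simp: sortable_def)
  show "sortable C (pop_down {u. sortable C u} wle w)" using camb_pop[OF assms(1,2)] by (simp add: is_glb_def)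
  have "wle (pop_down {u. sortable C u} wle w) (proj C (w \<otimes> s))"
    using camb_pop[OF assms(1,2)] camb_cover[OF assms] unfolding is_glb_def by blast
  then show "wle (pop_down {u. sortable C u} wle w) (w \<otimes> s)" using wle_trans proj_le[OF ws assms(2)] by blast
qed

text \<open>\<open>cover_proj\<close> and the third clause of \<open>gap\<close> leave no upper
  bound but \<open>w\<close>, the second clause with \<open>low_span\<close> controls the lower
  bounds, and the last clause makes the chain strict.\<close>

lemma gap_not_distrib: assumes "sortable C w" "wd C" "s \<in> Des w" "t \<in> Des w" "s \<noteq> t" "gap C w s t y"
  shows "\<not> distrib_lattice_on (interval {u. sortable C u} wle (pop_down {u. sortable C u} wle w) w) wle"
proof
  let ?p = "pop_down {u. sortable C u} wle w"
  let ?L = "interval {u. sortable C u} wle ?p w"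
  assume d: "distrib_lattice_on ?L wle"
  have w: "w \<in> carrier G" using assms by (simp add: sortable_def)
  have p: "sortable C ?p" "wle ?p (w \<otimes> s)" "wle ?p (w \<otimes> t)" using camb_pop_le[OF assms(1,2)] assms by auto
  have wc: "w \<otimes> s \<in> carrier G" "w \<otimes> t \<in> carrier G" using p by (auto simp: wle_def)
  have gy: "wle y (w \<otimes> t)" "\<And>r. r \<in> Inv w \<Longrightarrow> \<not> in_span (croot w s) (croot w t) r \<Longrightarrow> r \<in> Inv y" "croot w s \<in> Inv (proj C y)"
    using assms(6) unfolding gap_def by auto
  have yc: "y \<in> carrier G" using gy by (simp add: wle_def)
  have low: "wle u y" if u: "wle u (w \<otimes> s)" "wle u (w \<otimes> t)" for u
  proof -
    have uw: "wle u w" using wle_trans[OF u(1) wle_right[OF w assms(3)]] .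
    have n: "croot w s \<notin> Inv u" "croot w t \<notin> Inv u" using u wle_right_iff[OF w _ uw] assms by auto
    have "Inv u \<subseteq> Inv y" using gy(2) low_span[OF uw assms(3-5) n] uw by (auto simp: wle_def)
    then show ?thesis using u yc by (simp add: wle_def)
  qed
  have ws: "wle (proj C (w \<otimes> s)) (w \<otimes> s)" and wt: "wle (proj C (w \<otimes> t)) (w \<otimes> t)" and py: "wle (proj C y) y"
    using proj_le wc yc assms(2) by auto
  have le: "wle (proj C (w \<otimes> s)) w" "wle (proj C (w \<otimes> t)) w" "wle (proj C y) w"
    using wle_trans ws wt py gy(1) wle_right[OF w] assms(3,4) by blast+
  have sroot: "sortable C (proj C (w \<otimes> s))" "sortable C (proj C (w \<otimes> t))" "sortable C (proj C y)" using proj_sortable wc yc assms(2) by auto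
  have pge: "wle ?p (proj C (w \<otimes> s))" "wle ?p (proj C (w \<otimes> t))" "wle ?p (proj C y)"
    using proj_max[OF p(1) _ assms(2)] p low by auto
  have "wle ?p w" using wle_trans[OF p(2) wle_right[OF w assms(3)]] .
  have "wle (proj C (w \<otimes> t)) (proj C y)"
  proof (rule distrib_modular[OF d, of "proj C (w \<otimes> s)" "proj C (w \<otimes> t)" "proj C y" w])
    show "proj C (w \<otimes> s) \<in> ?L" "proj C (w \<otimes> t) \<in> ?L" "proj C y \<in> ?L" "w \<in> ?L"
      using sroot pge le assms(1) \<open>wle ?p w\<close> wle_refl[OF w] by (simp_all add: interval_def)
    show "wle (proj C (w \<otimes> t)) w" using le by simp
    fix u assume u: "u \<in> ?L"
    then have us: "sortable C u" "wle u w" by (auto simp: interval_def)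
    show "wle u (proj C y)" if "wle u (proj C (w \<otimes> s))" "wle u (proj C (w \<otimes> t))"
      by (rule proj_max[OF us(1) _ assms(2)]) (use that wle_trans ws wt low in blast)
    show "u = w" if u2: "wle (proj C (w \<otimes> s)) u" "wle (proj C y) u"
    proof (rule ccontr)
      assume "u \<noteq> w"
      then obtain r where r: "r \<in> Des w" "wle u (w \<otimes> r)" using wlt_des us by blast
      have nr: "croot w r \<notin> Inv u" using r wle_right_iff[OF w r(1) us(2)] by blast
      show False
      proof (cases "r = s")
        case True
        then show ?thesis using nr gy(3) u2 by (auto simp: wle_def)
      next
        case False
        then have "croot w r \<in> Inv (proj C (w \<otimes> s))" using cover_proj[OF assms(1-3) r(1)] by blast
        then show ?thesis using nr u2 by (auto simp: wle_def)
      qed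
    qed
  qed
  then have "wle (proj C (w \<otimes> t)) y" using wle_trans py by blast
  then show False using assms(6) unfolding gap_def by (auto simp: wle_def)
qed

lemma noncommuting_camb: assumes "sortable C w" "wd C" "s \<in> Des w" "t \<in> Des w" "s \<otimes> t \<noteq> t \<otimes> s"
  shows "\<not> distrib_lattice_on (interval {u. sortable C u} wle (pop_down {u. sortable C u} wle w) w) wle"
proof -
  have ne: "s \<noteq> t" using assms by auto
  then have "bil s t \<noteq> 0" using bil_zero_iff assms D_S by blast
  then show ?thesis using gap_ex[OF assms(1-4) ne] gap_not_distrib assms ne by metis
qed

lemma interval_eq_commuting: assumes "sortable C w" "wd C"
  "interval {u. sortable C u} wle (pop_down {u. sortable C u} wle w) w = interval (carrier G) wle (pop_down (carrier G) wle w) w"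
  shows "commuting w"
proof (intro ballI)
  fix s t assume st: "s \<in> Des w" "t \<in> Des w"
  have w: "w \<in> carrier G" using assms by (simp add: sortable_def)
  have "sortable C (w \<otimes> r)" if r: "r \<in> Des w" for r
  proof -
    have "w \<otimes> r \<in> interval (carrier G) wle (pop_down (carrier G) wle w) w"
      using weak_pop_le(2)[OF w r] wle_right[OF w r] by (simp add: interval_def wle_def)
    then show ?thesis using assms(3) by (auto simp: interval_def)
  qed
  then show "s \<otimes> t = t \<otimes> s"
    using sortable_commute[OF assms(1) _ _ assms(2) st] bil_zero_iff st D_S by metis
qed

end

subsection \<open>Sorting words\<close>

lemma lex_le_antisym: assumes "lex_le ps qs" "lex_le qs ps" shows "ps = qs"
proof (rule ccontr)
  assume "ps \<noteq> qs"
  then have "(ps, qs) \<in> lexord {(a, b). a < b}" "(qs, ps) \<in> lexord {(a, b). a < b}"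
    using assms by (auto simp: lex_le_def)
  moreover have "asym {(a, b). a < (b::nat)}" by (auto intro: asymI)
  ultimately show False using lexord_asymmetric by blast
qed

context coxeter
begin

lemma reduced_Cons: assumes "reduced_word G S (a # ws) w"
  shows "a \<in> S" "sroot a \<in> Inv w" "reduced_word G S ws (a \<otimes> w)"
proof -
  have a: "a \<in> S" and ws: "ws \<in> lists S" and w: "w = a \<otimes> ev ws" and l: "Suc (length ws) = len w"
    using assms by (auto simp: reduced_word_def)
  have wc: "w \<in> carrier G" and aw: "a \<otimes> w = ev ws" using w a ev_closed[OF ws] S_closed by auto
  have "len (a \<otimes> w) < len w" using len_le[OF ws] l aw by simp
  then have s: "sroot a \<in> Inv w" using len_left[OF wc a] by simp
  have "length ws = len (a \<otimes> w)" using len_left_Suc[OF wc a s] l by simp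
  then show "a \<in> S" "sroot a \<in> Inv w" "reduced_word G S ws (a \<otimes> w)"
    using a s ws aw by (simp_all add: reduced_word_def)
qed

lemma reduced_ConsI: assumes "w \<in> carrier G" "a \<in> S" "sroot a \<in> Inv w" "reduced_word G S ws (a \<otimes> w)"
  shows "reduced_word G S (a # ws) w"
  using assms len_left_Suc[OF assms(1-3)] by (simp add: reduced_word_def)

lemma reduced_one: "reduced_word G S ws \<one> \<longleftrightarrow> ws = []"
  by (auto simp: reduced_word_def)

text \<open>Every letter that is a left descent of what remains is taken. Unlike \<open>run\<close>,
  this reading does not remember the letters it passed.\<close>

inductive greedy :: "'a list \<Rightarrow> nat \<Rightarrow> 'a \<Rightarrow> nat list \<Rightarrow> bool" for cw where
  one: "greedy cw i \<one> []"
| take: "sroot (cinf cw i) \<in> Inv w \<Longrightarrow> greedy cw (Suc i) (cinf cw i \<otimes> w) ps \<Longrightarrow> greedy cw i w (i # ps)"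
| pass: "w \<noteq> \<one> \<Longrightarrow> sroot (cinf cw i) \<notin> Inv w \<Longrightarrow> greedy cw (Suc i) w ps \<Longrightarrow> greedy cw i w ps"

lemma cinf_S: "cw \<noteq> [] \<Longrightarrow> set cw = S \<Longrightarrow> cinf cw i \<in> S"
  by (auto simp: cinf_def)

text \<open>A reduced word can use position \<open>i\<close> only if that letter is a left descent,
  and then starting at \<open>i\<close> beats any later start. Restricting to positions from
  \<open>i\<close> on makes this inductive.\<close>

lemma greedy_lex: "greedy cw i w ps \<Longrightarrow> w \<in> carrier G \<Longrightarrow> cw \<noteq> [] \<Longrightarrow> set cw = S \<Longrightarrow>
  sorted_wrt (<) ps \<and> (\<forall>p\<in>set ps. i \<le> p) \<and> reduced_word G S (map (cinf cw) ps) w \<and>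
  (\<forall>qs. sorted_wrt (<) qs \<and> (\<forall>q\<in>set qs. i \<le> q) \<and> reduced_word G S (map (cinf cw) qs) w \<longrightarrow> lex_le ps qs)"
proof (induction rule: greedy.induct)
  case (one i)
  then show ?case by (auto simp: reduced_one lex_le_def)
next
  case (take i w ps)
  have c: "cinf cw i \<in> S" using cinf_S take by blast
  have IH: "sorted_wrt (<) ps" "\<forall>p\<in>set ps. Suc i \<le> p" "reduced_word G S (map (cinf cw) ps) (cinf cw i \<otimes> w)"
    "\<And>qs. sorted_wrt (<) qs \<Longrightarrow> \<forall>q\<in>set qs. Suc i \<le> q \<Longrightarrow> reduced_word G S (map (cinf cw) qs) (cinf cw i \<otimes> w) \<Longrightarrow> lex_le ps qs"
    using take.IH take.prems c S_closed by auto
  have "lex_le (i # ps) qs" if q: "sorted_wrt (<) qs" "\<forall>q\<in>set qs. i \<le> q" "reduced_word G S (map (cinf cw) qs) w" for qs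
  proof (cases qs)
    case Nil
    then have "w = \<one>" using q by (simp add: reduced_word_def)
    then show ?thesis using take.hyps by simp
  next
    case (Cons k qs')
    show ?thesis
    proof (cases "k = i")
      case True
      have "lex_le ps qs'"
        by (rule IH(4)) (use q Cons True reduced_Cons(3)[of "cinf cw k" "map (cinf cw) qs'" w] in auto)
      then show ?thesis using Cons True by (auto simp: lex_le_def)
    next
      case False
      then have "i < k" using q Cons by simp
      then show ?thesis using Cons by (auto simp: lex_le_def)
    qed
  qed
  moreover have "reduced_word G S (map (cinf cw) (i # ps)) w"
    using reduced_ConsI[OF take.prems(1) c take.hyps(1) IH(3)] by simp
  ultimately show ?case using IH(1,2) by fastforce
next
  case (pass w i ps)
  have IH: "sorted_wrt (<) ps" "\<forall>p\<in>set ps. Suc i \<le> p" "reduced_word G S (map (cinf cw) ps) w"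
    "\<And>qs. sorted_wrt (<) qs \<Longrightarrow> \<forall>q\<in>set qs. Suc i \<le> q \<Longrightarrow> reduced_word G S (map (cinf cw) qs) w \<Longrightarrow> lex_le ps qs"
    using pass.IH pass.prems by auto
  have "lex_le ps qs" if q: "sorted_wrt (<) qs" "\<forall>q\<in>set qs. i \<le> q" "reduced_word G S (map (cinf cw) qs) w" for qs
  proof (rule IH(4)[OF q(1) _ q(3)])
    show "\<forall>q\<in>set qs. Suc i \<le> q"
    proof (cases qs)
      case (Cons k qs')
      have "k \<noteq> i" using reduced_Cons(2)[of "cinf cw k" "map (cinf cw) qs'" w] q Cons pass.hyps by auto
      then have "i < k" using q Cons by simp
      then show ?thesis using q(1) Cons by auto
    qed simp
  qed
  then show ?case using IH by fastforce
qed

lemma greedy_total: "w \<in> carrier G \<Longrightarrow> cw \<noteq> [] \<Longrightarrow> set cw = S \<Longrightarrow> \<exists>ps. greedy cw i w ps"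
proof (induction "len w" arbitrary: w i rule: less_induct)
  case less
  show ?case
  proof (cases "w = \<one>")
    case True
    then show ?thesis using greedy.one by blast
  next
    case False
    then obtain a where a: "a \<in> S" "sroot a \<in> Inv w" using left_des_ex less.prems by blast
    then obtain m where m: "m < length cw" "cw ! m = a" using less.prems by (metis in_set_conv_nth)
    \<comment> \<open>A copy of the letter in a period late enough to lie at or beyond
      \<open>i\<close>.\<close>
    have "cinf cw (m + i * length cw) = a" using m by (simp add: cinf_def)
    moreover have "i \<le> m + i * length cw" using m by (cases "length cw") auto
    ultimately have ex: "\<exists>j. i \<le> j \<and> sroot (cinf cw j) \<in> Inv w" using a by metis
    define j where "j = (LEAST j. i \<le> j \<and> sroot (cinf cw j) \<in> Inv w)"
    have j: "i \<le> j" "sroot (cinf cw j) \<in> Inv w" using LeastI_ex[OF ex] unfolding j_def by auto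
    have jl: "sroot (cinf cw k) \<notin> Inv w" if "i \<le> k" "k < j" for k
      using not_less_Least[of k "\<lambda>j. i \<le> j \<and> sroot (cinf cw j) \<in> Inv w"] that unfolding j_def by auto
    have c: "cinf cw j \<in> S" using cinf_S less.prems by blast
    have "len (cinf cw j \<otimes> w) < len w" using len_left[OF less.prems(1) c] j by simp
    then obtain ps where "greedy cw (Suc j) (cinf cw j \<otimes> w) ps"
      using less.hyps[of "cinf cw j \<otimes> w"] less.prems c S_closed by auto
    then have g: "greedy cw j w (j # ps)" using greedy.take j by blast
    \<comment> \<open>Walks back from the first usable position \<open>j\<close> to
      \<open>i\<close>, passing every position in between.\<close>
    have "greedy cw (j - d) w (j # ps)" if "d \<le> j - i" for d
      using that
    proof (induction d)
      case (Suc d)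
      have e: "Suc (j - Suc d) = j - d" using Suc.prems by simp
      have "greedy cw (j - d) w (j # ps)" using Suc by simp
      then show ?case
        using greedy.pass[OF False jl, of "j - Suc d" "j # ps"] Suc.prems j(1) e by simp
    qed (use g in simp)
    from this[of "j - i"] show ?thesis using j by auto
  qed
qed

lemma sorting_greedy: assumes "w \<in> carrier G" "cw \<noteq> []" "set cw = S"
  shows "sorting_positions G S cw w ps \<longleftrightarrow> greedy cw 0 w ps"
proof -
  have g: "sorting_positions G S cw w ps" if "greedy cw 0 w ps" for ps
    using greedy_lex[OF that assms] unfolding sorting_positions_def by auto
  obtain qs where qs: "greedy cw 0 w qs" using greedy_total[OF assms] by blast
  have "ps = qs" if "sorting_positions G S cw w ps"
    using that g[OF qs] lex_le_antisym unfolding sorting_positions_def by blast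
  then show ?thesis using g qs by blast
qed

text \<open>The word that remains to be read at position \<open>i\<close> if only the letters of \<open>K\<close> have never
  been passed over.\<close>
definition rest :: "'a list \<Rightarrow> nat \<Rightarrow> 'a set \<Rightarrow> 'a list" where
  "rest cw i K = filter (\<lambda>x. x \<in> K) (rotate i cw)"

text \<open>Nesting of blocks, cut at an arbitrary position. Letters passed before \<open>i\<close>
  recur within the first period, where \<open>K\<close> forbids them; letters passed later are
  forbidden one period on by the second clause.\<close>

definition nested :: "'a list \<Rightarrow> nat \<Rightarrow> 'a set \<Rightarrow> nat list \<Rightarrow> bool" where
  "nested cw i K ps \<longleftrightarrow> (\<forall>j\<in>set ps. j < i + length cw \<longrightarrow> cinf cw j \<in> K) \<and>
     (\<forall>j\<ge>i. j \<notin> set ps \<longrightarrow> j + length cw \<notin> set ps)"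

lemma rotate_cinf: assumes "cw \<noteq> []"
  shows "\<exists>R. rotate i cw = cinf cw i # R \<and> rotate (Suc i) cw = R @ [cinf cw i]"
proof -
  have "rotate i cw \<noteq> []" using assms by simp
  then have e: "rotate i cw = cinf cw i # tl (rotate i cw)"
    using hd_rotate_conv_nth[OF assms, of i] by (metis cinf_def list.collapse)
  then have "rotate (Suc i) cw = tl (rotate i cw) @ [cinf cw i]"
    unfolding rotate_Suc by (metis rotate1.simps(2))
  then show ?thesis using e by blast
qed

lemma rest_in: assumes "cw \<noteq> []" "cinf cw i \<in> K" "distinct cw"
  shows "\<exists>C. rest cw i K = cinf cw i # C \<and> rest cw (Suc i) K = C @ [cinf cw i] \<and>
     rest cw (Suc i) (K - {cinf cw i}) = C"
proof -
  obtain R where R: "rotate i cw = cinf cw i # R" "rotate (Suc i) cw = R @ [cinf cw i]"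
    using rotate_cinf[OF assms(1)] by blast
  have "distinct (cinf cw i # R)" using assms(3) R(1) distinct_rotate[of i cw] by simp
  then have "filter (\<lambda>x. x \<in> K - {cinf cw i}) R = filter (\<lambda>x. x \<in> K) R"
    by (intro filter_cong) auto
  then show ?thesis unfolding rest_def R using assms(2) by (intro exI[of _ "filter (\<lambda>x. x \<in> K) R"]) auto
qed

lemma rest_out: assumes "cw \<noteq> []" "cinf cw i \<notin> K" shows "rest cw (Suc i) K = rest cw i K"
  using rotate_cinf[OF assms(1), of i] assms(2) unfolding rest_def by auto

lemma rest_wd: assumes "distinct cw" "set cw = S" shows "wd (rest cw i K)" "set (rest cw i K) = S \<inter> K"
  using assms unfolding rest_def by auto

lemma greedy_ge: "greedy cw i w ps \<Longrightarrow> p \<in> set ps \<Longrightarrow> i \<le> p"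
  by (induction rule: greedy.induct) fastforce+

lemma sortable_one: "wd C \<Longrightarrow> sortable C \<one>"
proof (induction C)
  case (Cons a C)
  then show ?case using sortable_skip[of a \<one> C] by simp
qed (simp add: sortable_Nil)

lemma cinf_period: "cinf cw (i + length cw) = cinf cw i"
  by (simp add: cinf_def)

text \<open>The reading without memory agrees with the one that deletes letters exactly if no passed
  letter is ever taken again. Both are followed one position at a time.\<close>

lemma greedy_sortable: "greedy cw i w ps \<Longrightarrow> w \<in> carrier G \<Longrightarrow> cw \<noteq> [] \<Longrightarrow> distinct cw \<Longrightarrow> set cw = S \<Longrightarrow>
  sortable (rest cw i K) w \<longleftrightarrow> nested cw i K ps"
proof (induction arbitrary: K rule: greedy.induct)
  case (one i)
  then show ?case using sortable_one rest_wd by (simp add: nested_def)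
next
  case (take i w ps)
  let ?c = "cinf cw i"
  note wds = rest_wd[OF take.prems(3,4)]
  have c: "?c \<in> S" using cinf_S take by blast
  have cwc: "?c \<otimes> w \<in> carrier G" using c S_closed take.prems by simp
  have IH: "sortable (rest cw (Suc i) K) (?c \<otimes> w) \<longleftrightarrow> nested cw (Suc i) K ps"
    using take.IH cwc take.prems by blast
  have ge: "Suc i \<le> p" if "p \<in> set ps" for p using greedy_ge[OF take.hyps(2) that] .
  have pos: "0 < length cw" using take.prems by simp
  show ?case
  proof (cases "?c \<in> K")
    case True
    obtain C where C: "rest cw i K = ?c # C" "rest cw (Suc i) K = C @ [?c]"
      using rest_in[OF take.prems(2) True take.prems(3)] by blast
    have "sortable (rest cw i K) w \<longleftrightarrow> sortable (rest cw (Suc i) K) (?c \<otimes> w)"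
      using sortable_use[OF take.hyps(1) _ take.prems(1), of C] wds(1)[of i K] C by simp
    moreover have "nested cw i K (i # ps) \<longleftrightarrow> nested cw (Suc i) K ps"
    proof
      assume n: "nested cw i K (i # ps)"
      show "nested cw (Suc i) K ps" unfolding nested_def
      proof (intro conjI ballI allI impI)
        fix j assume j: "j \<in> set ps" "j < Suc i + length cw"
        show "cinf cw j \<in> K"
        proof (cases "j = i + length cw")
          case True
          then show ?thesis using \<open>?c \<in> K\<close> by (simp add: cinf_period)
        next
          case False
          then show ?thesis using n j unfolding nested_def by auto
        qed
      next
        fix j assume "Suc i \<le> j" "j \<notin> set ps"
        then have "j + length cw \<notin> set (i # ps)" using n unfolding nested_def by auto
        then show "j + length cw \<notin> set ps" by simp
      qed
    next
      assume n: "nested cw (Suc i) K ps"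
      show "nested cw i K (i # ps)" unfolding nested_def
      proof (intro conjI ballI allI impI)
        fix j assume "j \<in> set (i # ps)" "j < i + length cw"
        then show "cinf cw j \<in> K" using n True unfolding nested_def by auto
      next
        fix j assume j: "i \<le> j" "j \<notin> set (i # ps)"
        then have "j + length cw \<notin> set ps" using n unfolding nested_def by auto
        then show "j + length cw \<notin> set (i # ps)" using j pos by auto
      qed
    qed
    ultimately show ?thesis using IH by blast
  next
    case False
    have "\<not> sortable (rest cw i K) w"
    proof
      assume "sortable (rest cw i K) w"
      then have "supp (S \<inter> K) (sroot ?c)" using sortable_supp[OF _ wds(1) take.hyps(1)] wds(2) by metis
      then have "sroot ?c ?c = 0" using False unfolding supp_def by blast
      then show False by (simp add: sroot_def)
    qed
    moreover have "\<not> nested cw i K (i # ps)" using False pos unfolding nested_def by auto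
    ultimately show ?thesis by blast
  qed
next
  case (pass w i ps)
  let ?c = "cinf cw i"
  note wds = rest_wd[OF pass.prems(3,4)]
  have ge: "Suc i \<le> p" if "p \<in> set ps" for p using greedy_ge[OF pass.hyps(3) that] .
  have ni: "i \<notin> set ps" using ge by fastforce
  have IH: "sortable (rest cw (Suc i) K) w \<longleftrightarrow> nested cw (Suc i) K ps" for K using pass.IH pass.prems by blast
  \<comment> \<open>Passing \<open>?c\<close> removes it from \<open>K\<close>: the second clause at
    position \<open>i\<close> becomes the first clause at \<open>i + length cw\<close>, the only new
    position in the window.\<close>
  have *: "nested cw i K ps \<longleftrightarrow> nested cw (Suc i) (K - {?c}) ps"
  proof
    assume n: "nested cw i K ps"
    then have np: "i + length cw \<notin> set ps" using ni unfolding nested_def by auto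
    show "nested cw (Suc i) (K - {?c}) ps" unfolding nested_def
    proof (intro conjI ballI allI impI)
      fix j assume j: "j \<in> set ps" "j < Suc i + length cw"
      then have j2: "j < i + length cw" "i < j" using np ge[OF j(1)] by (auto simp: less_Suc_eq)
      have "cinf cw j \<noteq> ?c"
      proof
        assume "cinf cw j = ?c"
        then have "j mod length cw = i mod length cw"
          using nth_eq_iff_index_eq[OF pass.prems(3)] pass.prems(2) unfolding cinf_def by simp
        then have "length cw dvd j - i" using j2 by (simp add: mod_eq_dvd_iff_nat)
        then have "length cw \<le> j - i" using j2 by (intro dvd_imp_le) auto
        then show False using j2 by simp
      qed
      moreover have "cinf cw j \<in> K" using n j(1) j2(1) unfolding nested_def by blast
      ultimately show "cinf cw j \<in> K - {?c}" by blast
    next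
      fix j assume "Suc i \<le> j" "j \<notin> set ps"
      then show "j + length cw \<notin> set ps" using n unfolding nested_def by auto
    qed
  next
    assume n: "nested cw (Suc i) (K - {?c}) ps"
    have np: "i + length cw \<notin> set ps"
    proof
      assume "i + length cw \<in> set ps"
      then have "cinf cw (i + length cw) \<in> K - {?c}" using n unfolding nested_def by auto
      then show False by (simp add: cinf_period)
    qed
    show "nested cw i K ps" unfolding nested_def
    proof (intro conjI ballI allI impI)
      fix j assume "j \<in> set ps" "j < i + length cw"
      then show "cinf cw j \<in> K" using n unfolding nested_def by auto
    next
      fix j assume "i \<le> j" "j \<notin> set ps"
      then show "j + length cw \<notin> set ps" using n np unfolding nested_def by (cases "j = i") auto
    qed
  qed
  have "sortable (rest cw i K) w \<longleftrightarrow> sortable (rest cw (Suc i) (K - {?c})) w"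
  proof (cases "?c \<in> K")
    case True
    obtain C where C: "rest cw i K = ?c # C" "rest cw (Suc i) (K - {?c}) = C"
      using rest_in[OF pass.prems(2) True pass.prems(3)] by blast
    then show ?thesis using sortable_skip[OF pass.hyps(2), of C] wds(1)[of i K] by simp
  next
    case False
    then show ?thesis using rest_out[OF pass.prems(2) False] by simp
  qed
  then show ?case using IH * by blast
qed

text \<open>Letters of \<open>cw\<close> are distinct, so a letter and a block determine a position,
  and inclusion of consecutive blocks becomes closure under going back one period.\<close>

lemma sort_block_nested: assumes "distinct cw" "set cw = S" "cw \<noteq> []"
  shows "(\<forall>k. sort_block cw ps (Suc k) \<subseteq> sort_block cw ps k) \<longleftrightarrow> nested cw 0 S ps"
proof -
  have n: "0 < length cw" using assms by simp
  have "(\<forall>k. sort_block cw ps (Suc k) \<subseteq> sort_block cw ps k) \<longleftrightarrow> (\<forall>j. j + length cw \<in> set ps \<longrightarrow> j \<in> set ps)"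
  proof
    assume b: "\<forall>k. sort_block cw ps (Suc k) \<subseteq> sort_block cw ps k"
    show "\<forall>j. j + length cw \<in> set ps \<longrightarrow> j \<in> set ps"
    proof (intro allI impI)
      fix j assume j: "j + length cw \<in> set ps"
      have "(j + length cw) div length cw = Suc (j div length cw)" using n by simp
      then have "cinf cw (j + length cw) \<in> sort_block cw ps (Suc (j div length cw))"
        using j unfolding sort_block_def by blast
      then have "cinf cw j \<in> sort_block cw ps (j div length cw)" using b cinf_period[of cw j] by auto
      then obtain i where i: "i \<in> set ps" "cinf cw i = cinf cw j" "i div length cw = j div length cw"
        unfolding sort_block_def by auto
      then have "i mod length cw = j mod length cw"
        using nth_eq_iff_index_eq[OF assms(1)] n unfolding cinf_def by simp
      then have "i = j" using i(3) by (metis div_mult_mod_eq)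
      then show "j \<in> set ps" using i by simp
    qed
  next
    assume s: "\<forall>j. j + length cw \<in> set ps \<longrightarrow> j \<in> set ps"
    show "\<forall>k. sort_block cw ps (Suc k) \<subseteq> sort_block cw ps k"
    proof (intro allI subsetI)
      fix k x assume "x \<in> sort_block cw ps (Suc k)"
      then obtain i where i: "i \<in> set ps" "x = cinf cw i" "i div length cw = Suc k" unfolding sort_block_def by auto
      have "length cw \<le> i" using i(3) n by (metis div_less not_less nat.distinct(1))
      then obtain j where j: "i = j + length cw" by (metis le_add_diff_inverse2)
      then have "j div length cw = k" using i(3) n by simp
      moreover have "j \<in> set ps" "x = cinf cw j" using s i j cinf_period[of cw j] by auto
      ultimately show "x \<in> sort_block cw ps k" unfolding sort_block_def by blast
    qed
  qed
  then show ?thesis using cinf_S[OF assms(3,2)] unfolding nested_def by auto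
qed

lemma c_sortable_sortable: assumes "distinct cw" "set cw = S"
  shows "c_sortable G S cw w \<longleftrightarrow> sortable cw w"
proof (cases "w \<in> carrier G")
  case False
  then show ?thesis by (simp add: c_sortable_def sortable_def)
next
  case w: True
  show ?thesis
  proof (cases "cw = []")
    \<comment> \<open>Rank 0 is treated apart: \<open>cinf\<close> would index an empty list, and
      the only element is \<open>\<one>\<close> with the empty sorting word.\<close>
    case True
    then have S: "S = {}" using assms by simp
    have w1: "w = \<one>" using word_ex[OF w] S by auto
    have e: "ws = []" if "reduced_word G S ws w" for ws using that w1 reduced_one by simp
    have "sorting_positions G S cw w []"
      unfolding sorting_positions_def using w1 reduced_one e by (auto simp: lex_le_def)
    then have "c_sortable G S cw w"
      unfolding c_sortable_def using w by (auto simp: sort_block_def intro!: exI[of _ "[]"])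
    then show ?thesis using True w1 sortable_Nil by simp
  next
    case False
    obtain ps where ps: "greedy cw 0 w ps" using greedy_total[OF w False assms(2)] by blast
    have "rest cw 0 S = cw" using assms(2) by (simp add: rest_def)
    then have g: "sortable cw w \<longleftrightarrow> nested cw 0 S qs" if "greedy cw 0 w qs" for qs
      using greedy_sortable[OF that w False assms, of S] by simp
    show ?thesis
      unfolding c_sortable_def sort_block_nested[OF assms False] sorting_greedy[OF w False assms(2)]
      using w g ps by blast
  qed
qed

theorem pop_intervals: assumes "distinct cw" "set cw = S" "c_sortable G S cw w"
  shows "commuting w \<longleftrightarrow> distrib_lattice_on (weak_pop_interval G S w) (weak_le G S)"
    "commuting w \<longleftrightarrow> boolean_lattice_on (weak_pop_interval G S w) (weak_le G S)"
    "commuting w \<longleftrightarrow> distrib_lattice_on (camb_pop_interval G S cw w) (weak_le G S)"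
    "commuting w \<longleftrightarrow> boolean_lattice_on (camb_pop_interval G S cw w) (weak_le G S)"
    "commuting w \<longleftrightarrow> camb_pop_interval G S cw w = weak_pop_interval G S w"
    "w \<in> carrier G"
proof -
  have le: "weak_le G S = wle" by (intro ext) (rule weak_le_iff)
  have C: "camb G S cw = {u. sortable cw u}"
    unfolding camb_def c_sortable_sortable[OF assms(1,2)] by (auto simp: sortable_def)
  have wd: "wd cw" using assms by simp
  have s: "sortable cw w" using assms c_sortable_sortable by blast
  show w: "w \<in> carrier G" using s by (simp add: sortable_def)
  have W: "weak_pop_interval G S w = interval (carrier G) wle (pop_down (carrier G) wle w) w"
    by (simp add: weak_pop_interval_def le)
  have K: "camb_pop_interval G S cw w = interval {u. sortable cw u} wle (pop_down {u. sortable cw u} wle w) w"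
    by (simp add: camb_pop_interval_def le C)
  have b: "commuting w \<Longrightarrow> boolean_lattice_on (weak_pop_interval G S w) (weak_le G S)"
    unfolding W le by (rule commuting_boolean[OF w])
  have e: "commuting w \<Longrightarrow> camb_pop_interval G S cw w = weak_pop_interval G S w"
    unfolding W K by (rule commuting_camb[OF s wd])
  have bd: "boolean_lattice_on L r \<Longrightarrow> distrib_lattice_on L r" for L and r :: "'a \<Rightarrow> 'a \<Rightarrow> bool"
    by (simp add: boolean_lattice_on_def)
  have nw: "\<not> commuting w \<Longrightarrow> \<not> distrib_lattice_on (weak_pop_interval G S w) (weak_le G S)"
    unfolding W le using noncommuting_weak[OF w] by blast
  have nc: "\<not> commuting w \<Longrightarrow> \<not> distrib_lattice_on (camb_pop_interval G S cw w) (weak_le G S)"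
    unfolding K le using noncommuting_camb[OF s wd] by blast
  show "commuting w \<longleftrightarrow> distrib_lattice_on (weak_pop_interval G S w) (weak_le G S)"
    using b bd nw by blast
  show "commuting w \<longleftrightarrow> boolean_lattice_on (weak_pop_interval G S w) (weak_le G S)"
    using b bd nw by blast
  show "commuting w \<longleftrightarrow> distrib_lattice_on (camb_pop_interval G S cw w) (weak_le G S)"
    using b bd e nc by metis
  show "commuting w \<longleftrightarrow> boolean_lattice_on (camb_pop_interval G S cw w) (weak_le G S)"
    using b bd e nc by metis
  show "commuting w \<longleftrightarrow> camb_pop_interval G S cw w = weak_pop_interval G S w"
    using e interval_eq_commuting[OF s wd] unfolding W K by blast
qed

end

theorem theorem7p6:
  fixes G :: "('a, 'b) monoid_scheme" and S :: "'a set" and cw :: "'a list" and w :: 'a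
  assumes "coxeter_system G S"
    and "distinct cw" and "set cw = S"
    and "c_sortable G S cw w"
  shows "((\<forall>s\<in>descents G S w. \<forall>t\<in>descents G S w. s \<otimes>\<^bsub>G\<^esub> t = t \<otimes>\<^bsub>G\<^esub> s)
            \<longleftrightarrow> distrib_lattice_on (weak_pop_interval G S w) (weak_le G S))
       \<and> ((\<forall>s\<in>descents G S w. \<forall>t\<in>descents G S w. s \<otimes>\<^bsub>G\<^esub> t = t \<otimes>\<^bsub>G\<^esub> s)
            \<longleftrightarrow> boolean_lattice_on (weak_pop_interval G S w) (weak_le G S))
       \<and> ((\<forall>s\<in>descents G S w. \<forall>t\<in>descents G S w. s \<otimes>\<^bsub>G\<^esub> t = t \<otimes>\<^bsub>G\<^esub> s)
            \<longleftrightarrow> distrib_lattice_on (camb_pop_interval G S cw w) (weak_le G S))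
       \<and> ((\<forall>s\<in>descents G S w. \<forall>t\<in>descents G S w. s \<otimes>\<^bsub>G\<^esub> t = t \<otimes>\<^bsub>G\<^esub> s)
            \<longleftrightarrow> boolean_lattice_on (camb_pop_interval G S cw w) (weak_le G S))
       \<and> ((\<forall>s\<in>descents G S w. \<forall>t\<in>descents G S w. s \<otimes>\<^bsub>G\<^esub> t = t \<otimes>\<^bsub>G\<^esub> s)
            \<longleftrightarrow> camb_pop_interval G S cw w = weak_pop_interval G S w)"
proof -
  interpret coxeter G S
    using assms(1) by (intro coxeter.intro coxeter_axioms.intro) (simp_all add: coxeter_system_def)
  note I = pop_intervals[OF assms(2-4)]
  show ?thesis unfolding descents_D[OF I(6)] using I(1-5) by blast
qed

end
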